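(* (Big Box) Let $\mathfrak{M}$ be a minimal matchbox manifold whose local transverse models are Cantor sets, let $x\in\mathfrak{M}$ with leaf $L_x$ through $x$, and let $K_x\subset L_x$ be a proper base. Then there exist a clopen transversal $V_x\subset\mathfrak{M}$ containing $x$ and a foliated homeomorphic inclusion $\Phi:K_x\times V_x\to\mathfrak{N}_{K_x}\subset\mathfrak{M}$ (with $\mathfrak{N}_{K_x}$ its image) such that the images $\Phi(\{y\}\times V_x)$, $y\in K_x$, form a continuous family of Cantor transversals for $\mathcal{F}|\mathfrak{N}_{K_x}$.
   Context: A continuum is a compact connected metrizable space. A foliated space of dimension $n$ is a continuum $\mathfrak{M}$ such that there is a compact separable metric space $\mathfrak{X}$ and, for each $x\in\mathfrak{M}$, a compact subset $\mathfrak{T}_x\subset\mathfrak{X}$ (the local transverse model), an open set $U_x\subset\mathfrak{M}$ containing $x$ and a homeomorphism $\varphi_x:\overline{U}_x\to[-1,1]^n\times\mathfrak{T}_x$ with $\varphi_x(x)=(0,w_x)$, $w_x\in \mathrm{int}(\mathfrak{T}_x)$, which extends to a foliated homeomorphism $\widehat\varphi_x:\widehat U_x\to(-2,2)^n\times\mathfrak{T}_x$ with $\overline U_x\subset\widehat U_x$. Plaques are the sets $\mathcal{P}_x(w)=\varphi_x^{-1}([-1,1]^n\times\{w\})$; the leaves of the foliation $\mathcal{F}$ are the connected components of the fine topology generated by the sets $\varphi_x^{-1}(V\times\{w\})$, $V\subset(-1,1)^n$ open. It is smooth if the charts can be chosen so that the leafwise transition maps are smooth and depend continuously, in the $C^\infty$-topology,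 on the transverse parameter. A matchbox manifold is a smooth foliated space for which $\mathfrak{X}$ is totally disconnected and every $\mathfrak{T}_x\subset\mathfrak{X}$ is clopen; it is always equipped with a leafwise Riemannian metric (continuous in the transverse direction), so leaves are complete with bounded geometry. It is minimal if every leaf is dense in $\mathfrak{M}$. Fix a finite regular covering of $\mathfrak{M}$: foliation charts $\varphi_i:\overline U_i\to[-1,1]^n\times\mathfrak{T}_i$, $1\le i\le\nu$ (homeomorphisms defined on closures of open sets $U_i\subset\mathfrak{M}$, with $\mathfrak{T}_i\subset\mathfrak{X}$ clopen, with plaques $\mathcal{P}_i(w)=\varphi_i^{-1}([-1,1]^n\times\{w\})$, with leafwise transition maps smooth and depending continuously in the $C^\infty$-topology on the transverse parameter, and each extending to a foliated homeomorphism $\widehat\varphi_i:\widehat U_i\to(-2,2)^n\times\mathfrak{T}_i$ with $\overline U_i\subset\widehat U_i\subset\mathfrak{M}$), whose open sets $U_i$ cover $\mathfrak{M}$ and whose plaques are strongly convex in the leafwise metric (any two points of a plaque are joined by a unique shortest leafwise geodesic, contained in the plaque) with leafwise diameter less than $\lambda_{\mathcal F}/2$, where $\lambda_{\mathcal F}>0$ is such that all closed leafwise balls of radius $\lambda_{\mathcal F}$ are strongly convex. Let $\pi_i:\overline U_i\to\mathfrak{T}_i$ be the projection. Holonomy covering: covering a leafwise path by a chain of plaques and composing the corresponding transverse coordinate changes defines the germ of a local homeomorphism of $\mathfrak{T}_*=\mathfrak{T}_1\cup\cdots\cup\mathfrak{T}_\nu$ depending only on the endpoint-homotopy class of the path.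 For $x\in U_i$ with $w=\pi_i(x)$ this gives a homomorphism $h_{\mathcal F,x}:\pi_1(L_x,x)\to\Gamma^w_{\mathcal F}$ to the group of germs at $w$ of holonomy maps fixing $w$. The holonomy covering $\Pi:\widetilde L_x\to L_x$ is the covering associated to the kernel of $h_{\mathcal F,x}$. Proper base: $K_x\subset L_x$ is a proper base if $K_x$ is a union of closed foliation plaques with $x\in K_x$, and there is a connected compact subset $\widetilde K_x\subset\widetilde L_x$ such that the composition $\widetilde K_x\subset\widetilde L_x\to L_x\subset\mathfrak{M}$ is injective with image $K_x$. A clopen transversal is a subset of $\mathfrak{M}$ of the form $\varphi_i^{-1}(\{\xi\}\times V)$ with $\xi\in(-1,1)^n$ and $V\subset\mathfrak{T}_i$ clopen. The map $\Phi$ is foliated if it sends each $K_x\times\{w\}$ into a leaf of $\mathcal{F}$. A Cantor transversal is a Cantor set transverse to $\mathcal F$, i.e. one which meets each leaf (path component) of the restricted foliation $\mathcal{F}|\mathfrak{N}_{K_x}$, whose leaves are the sets $\Phi(K_x\times\{w\})$, in exactly one point. *)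

theory Defs
  imports "HOL-Analysis.Analysis"
begin

section \<open>Smooth maps and smooth families\<close>

text \<open>\<open>iter_partial [i\<^sub>1, \<dots>, i\<^sub>k] f\<close> is the iterated partial derivative
  \<open>\<partial>\<^sub>i\<^sub>1 \<dots> \<partial>\<^sub>i\<^sub>k f\<close>. It is only meaningful where \<open>f\<close> is sufficiently often differentiable,
  which \<open>smooth_on\<close> guarantees on open sets.\<close>

fun iter_partial ::
  "'n::finite list \<Rightarrow> (real ^ 'n \<Rightarrow> 'b::real_normed_vector) \<Rightarrow> real ^ 'n \<Rightarrow> 'b" where
  "iter_partial [] f = f"
| "iter_partial (i # is) f =
     (\<lambda>v. frechet_derivative (iter_partial is f) (at v) (axis i 1))"

definition smooth_on ::
  "(real ^ 'n::finite) set \<Rightarrow> (real ^ 'n \<Rightarrow> 'b::real_normed_vector) \<Rightarrow> bool" where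
  "smooth_on S f \<longleftrightarrow> (\<forall>is. \<forall>v\<in>S. iter_partial is f differentiable (at v))"

text \<open>A family \<open>F w\<close> of smooth maps on the open sets \<open>D w\<close>, depending continuously on
  \<open>w\<close> in the (compact-open) \<open>C\<^sup>\<infinity>\<close>-topology: all derivatives converge uniformly on compact
  sets. The domains may vary with \<open>w\<close>.\<close>

definition smooth_family ::
  "'x topology \<Rightarrow> ('x \<Rightarrow> (real ^ 'n::finite) set) \<Rightarrow>
   ('x \<Rightarrow> real ^ 'n \<Rightarrow> 'b::real_normed_vector) \<Rightarrow> bool" where
  "smooth_family T D F \<longleftrightarrow>
     (\<forall>w\<in>topspace T. smooth_on (D w) (F w)) \<and>
     (\<forall>w\<in>topspace T. \<forall>C is. \<forall>e>0. compact C \<and> C \<subseteq> D w \<longrightarrow>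
        (\<exists>W. openin T W \<and> w \<in> W \<and>
          (\<forall>w'\<in>W. C \<subseteq> D w' \<and>
             (\<forall>v\<in>C. norm (iter_partial is (F w') v - iter_partial is (F w) v) < e))))"


section \<open>Foliated spaces and matchbox manifolds\<close>

text \<open>A chart \<open>\<phi> : cl U \<rightarrow> [-1,1]\<^sup>n \<times> T\<close> with its extension
  \<open>\<phi>' : U' \<rightarrow> (-2,2)\<^sup>n \<times> T\<close>. Since \<open>\<phi>\<close> is the restriction of \<open>\<phi>'\<close> to \<open>cl U\<close>, a single function
  \<open>fc_map\<close> represents both; \<open>fc_dom\<close>, \<open>fc_ext\<close>, \<open>fc_mod\<close> are \<open>U\<close>, \<open>U'\<close>, \<open>T\<close>.\<close>

record ('m, 'n, 'x) fchart =
  fc_dom :: "'m set"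
  fc_ext :: "'m set"
  fc_mod :: "'x set"
  fc_map :: "'m \<Rightarrow> (real ^ 'n) \<times> 'x"

definition ocube :: "real \<Rightarrow> (real ^ 'n::finite) set" where
  "ocube r = box (vec (- r)) (vec r)"

definition ccube :: "real \<Rightarrow> (real ^ 'n::finite) set" where
  "ccube r = cbox (vec (- r)) (vec r)"

definition plaque :: "'m topology \<Rightarrow> ('m, 'n::finite, 'x) fchart \<Rightarrow> 'x \<Rightarrow> 'm set" where
  "plaque M c w = {p \<in> M closure_of fc_dom c. fc_map c p \<in> ccube 1 \<times> {w}}"

text \<open>A foliation is represented by an atlas \<open>A\<close>, i.e. a set of charts.\<close>

definition fine_topology ::
  "'m topology \<Rightarrow> ('m, 'n::finite, 'x) fchart set \<Rightarrow> 'm topology" where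
  "fine_topology M A = topology_generated_by
     {{p \<in> M closure_of fc_dom c. fc_map c p \<in> V \<times> {w}} | c V w.
        c \<in> A \<and> open V \<and> V \<subseteq> ocube 1 \<and> w \<in> fc_mod c}"

definition leaf ::
  "'m topology \<Rightarrow> ('m, 'n::finite, 'x) fchart set \<Rightarrow> 'm \<Rightarrow> 'm set" where
  "leaf M A x = connected_component_of_set (fine_topology M A) x"

definition leaf_topology ::
  "'m topology \<Rightarrow> ('m, 'n::finite, 'x) fchart set \<Rightarrow> 'm \<Rightarrow> 'm topology" where
  "leaf_topology M A x = subtopology (fine_topology M A) (leaf M A x)"

text \<open>The open set \<open>U\<close> of a chart is normalised to be the part of \<open>cl U\<close> over the open box
  \<open>(-1,1)\<^sup>n \<times> int T\<close>. The last clause says that the extended chart is foliated.\<close>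

definition foliation_chart ::
  "'m topology \<Rightarrow> 'x topology \<Rightarrow> ('m, 'n::finite, 'x) fchart set \<Rightarrow>
   ('m, 'n, 'x) fchart \<Rightarrow> bool" where
  "foliation_chart M X A c \<longleftrightarrow>
     openin M (fc_dom c) \<and>
     compactin X (fc_mod c) \<and>
     M closure_of fc_dom c \<subseteq> fc_ext c \<and> fc_ext c \<subseteq> topspace M \<and>
     homeomorphic_map (subtopology M (M closure_of fc_dom c))
       (prod_topology (top_of_set (ccube 1)) (subtopology X (fc_mod c))) (fc_map c) \<and>
     homeomorphic_map (subtopology M (fc_ext c))
       (prod_topology (top_of_set (ocube 2)) (subtopology X (fc_mod c))) (fc_map c) \<and>
     fc_map c ` fc_dom c = ocube 1 \<times> (X interior_of fc_mod c) \<and>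
     (\<forall>w\<in>fc_mod c. \<exists>y\<in>topspace M. {p \<in> fc_ext c. snd (fc_map c p) = w} \<subseteq> leaf M A y)"

text \<open>The dimension of the foliated space is \<open>CARD('n)\<close>.\<close>

definition foliated_space ::
  "'m topology \<Rightarrow> 'x topology \<Rightarrow> ('m, 'n::finite, 'x) fchart set \<Rightarrow> bool" where
  "foliated_space M X A \<longleftrightarrow>
     compact_space M \<and> connected_space M \<and> metrizable_space M \<and>
     compact_space X \<and> metrizable_space X \<and> separable_space X \<and>
     (\<forall>c\<in>A. foliation_chart M X A c) \<and>
     (\<forall>x\<in>topspace M. \<exists>c\<in>A. x \<in> fc_dom c \<and>
        (\<exists>w \<in> X interior_of fc_mod c. fc_map c x = (0, w)))"

definition chart_inv :: "('m, 'n::finite, 'x) fchart \<Rightarrow> (real ^ 'n) \<times> 'x \<Rightarrow> 'm" where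
  "chart_inv c = inv_into (fc_ext c) (fc_map c)"

text \<open>The leafwise transition map from \<open>c\<close> to \<open>d\<close> on the plaque of \<open>c\<close> at \<open>w\<close>.\<close>

definition transition ::
  "('m, 'n::finite, 'x) fchart \<Rightarrow> ('m, 'n, 'x) fchart \<Rightarrow> 'x \<Rightarrow> real ^ 'n \<Rightarrow> real ^ 'n" where
  "transition c d w v = fst (fc_map d (chart_inv c (v, w)))"

definition transition_dom ::
  "('m, 'n::finite, 'x) fchart \<Rightarrow> ('m, 'n, 'x) fchart \<Rightarrow> 'x \<Rightarrow> (real ^ 'n) set" where
  "transition_dom c d w = {v. \<exists>p \<in> fc_dom c \<inter> fc_dom d. fc_map c p = (v, w)}"

definition smooth_foliated_space ::
  "'m topology \<Rightarrow> 'x topology \<Rightarrow> ('m, 'n::finite, 'x) fchart set \<Rightarrow> bool" where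
  "smooth_foliated_space M X A \<longleftrightarrow>
     foliated_space M X A \<and>
     (\<forall>c\<in>A. \<forall>d\<in>A. smooth_family (subtopology X (X interior_of fc_mod c))
        (transition_dom c d) (transition c d))"

definition totally_disconnected :: "'a topology \<Rightarrow> bool" where
  "totally_disconnected X \<longleftrightarrow> (\<forall>S. connectedin X S \<longrightarrow> (\<exists>a. S \<subseteq> {a}))"

definition cantor_space :: "'a topology \<Rightarrow> bool" where
  "cantor_space X \<longleftrightarrow>
     topspace X \<noteq> {} \<and> compact_space X \<and> metrizable_space X \<and> totally_disconnected X \<and>
     X derived_set_of topspace X = topspace X"

text \<open>A leafwise Riemannian metric: \<open>g c w v\<close> is the Gram matrix, in the coordinates of the
  chart \<open>c\<close>, at the point with coordinates \<open>(v, w)\<close>.\<close>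

definition leafwise_metric ::
  "'x topology \<Rightarrow> ('m, 'n::finite, 'x) fchart set \<Rightarrow>
   (('m, 'n, 'x) fchart \<Rightarrow> 'x \<Rightarrow> real ^ 'n \<Rightarrow> real ^ 'n ^ 'n) \<Rightarrow> bool" where
  "leafwise_metric X A g \<longleftrightarrow>
     (\<forall>c\<in>A.
        (\<forall>w \<in> X interior_of fc_mod c. smooth_on (ocube 1) (g c w)) \<and>
        continuous_map
          (prod_topology (top_of_set (ocube 1)) (subtopology X (X interior_of fc_mod c)))
          euclidean (\<lambda>(v, w). g c w v) \<and>
        (\<forall>w \<in> X interior_of fc_mod c. \<forall>v \<in> ocube 1.
           transpose (g c w v) = g c w v \<and> (\<forall>a. a \<noteq> 0 \<longrightarrow> a \<bullet> (g c w v *v a) > 0))) \<and>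
     (\<forall>c\<in>A. \<forall>d\<in>A. \<forall>w \<in> X interior_of fc_mod c. \<forall>v \<in> transition_dom c d w.
        let f = transition c d w; f' = frechet_derivative f (at v);
            w' = snd (fc_map d (chart_inv c (v, w)))
        in \<forall>a b. a \<bullet> (g c w v *v b) = f' a \<bullet> (g d w' (f v) *v f' b))"

definition matchbox_manifold ::
  "'m topology \<Rightarrow> 'x topology \<Rightarrow> ('m, 'n::finite, 'x) fchart set \<Rightarrow>
   (('m, 'n, 'x) fchart \<Rightarrow> 'x \<Rightarrow> real ^ 'n \<Rightarrow> real ^ 'n ^ 'n) \<Rightarrow> bool" where
  "matchbox_manifold M X A g \<longleftrightarrow>
     smooth_foliated_space M X A \<and> totally_disconnected X \<and>
     (\<forall>c\<in>A. openin X (fc_mod c) \<and> closedin X (fc_mod c)) \<and>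
     leafwise_metric X A g"

definition minimal_foliation ::
  "'m topology \<Rightarrow> ('m, 'n::finite, 'x) fchart set \<Rightarrow> bool" where
  "minimal_foliation M A \<longleftrightarrow>
     (\<forall>y\<in>topspace M. M closure_of leaf M A y = topspace M)"


section \<open>Leafwise length, distance and convexity\<close>

text \<open>\<open>leafwise_length A g \<gamma> a b l\<close>: on \<open>[a, b]\<close> the curve \<open>\<gamma>\<close> is leafwise piecewise \<open>C\<^sup>1\<close>
  and has length \<open>l\<close>.\<close>

inductive leafwise_length ::
  "('m, 'n::finite, 'x) fchart set \<Rightarrow>
   (('m, 'n, 'x) fchart \<Rightarrow> 'x \<Rightarrow> real ^ 'n \<Rightarrow> real ^ 'n ^ 'n) \<Rightarrow>
   (real \<Rightarrow> 'm) \<Rightarrow> real \<Rightarrow> real \<Rightarrow> real \<Rightarrow> bool"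
  for A g \<gamma> where
  piece: "\<lbrakk>c \<in> A; a \<le> b; \<gamma> ` {a..b} \<subseteq> fc_dom c;
     \<And>t. t \<in> {a..b} \<Longrightarrow> fc_map c (\<gamma> t) = (u t, w);
     \<And>t. t \<in> {a..b} \<Longrightarrow> (u has_vector_derivative u' t) (at t within {a..b});
     continuous_on {a..b} u'\<rbrakk>
   \<Longrightarrow> leafwise_length A g \<gamma> a b (integral {a..b} (\<lambda>t. sqrt (u' t \<bullet> (g c w (u t) *v u' t))))"
| join: "\<lbrakk>leafwise_length A g \<gamma> a b l; leafwise_length A g \<gamma> b c l'\<rbrakk>
   \<Longrightarrow> leafwise_length A g \<gamma> a c (l + l')"

text \<open>Only meaningful for two points of the same leaf.\<close>

definition leafwise_dist ::
  "('m, 'n::finite, 'x) fchart set \<Rightarrow>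
   (('m, 'n, 'x) fchart \<Rightarrow> 'x \<Rightarrow> real ^ 'n \<Rightarrow> real ^ 'n ^ 'n) \<Rightarrow> 'm \<Rightarrow> 'm \<Rightarrow> real" where
  "leafwise_dist A g p q = Inf {l. \<exists>\<gamma>. \<gamma> 0 = p \<and> \<gamma> 1 = q \<and> leafwise_length A g \<gamma> 0 1 l}"

text \<open>A shortest geodesic is a length-minimising curve, parametrised on \<open>[0, 1]\<close>
  proportionally to arc length.\<close>

definition shortest_geodesic ::
  "('m, 'n::finite, 'x) fchart set \<Rightarrow>
   (('m, 'n, 'x) fchart \<Rightarrow> 'x \<Rightarrow> real ^ 'n \<Rightarrow> real ^ 'n ^ 'n) \<Rightarrow>
   'm \<Rightarrow> 'm \<Rightarrow> (real \<Rightarrow> 'm) \<Rightarrow> bool" where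
  "shortest_geodesic A g p q \<gamma> \<longleftrightarrow>
     \<gamma> 0 = p \<and> \<gamma> 1 = q \<and>
     (\<forall>s t. 0 \<le> s \<and> s \<le> t \<and> t \<le> 1 \<longrightarrow>
        leafwise_length A g \<gamma> s t ((t - s) * leafwise_dist A g p q))"

definition strongly_convex ::
  "('m, 'n::finite, 'x) fchart set \<Rightarrow>
   (('m, 'n, 'x) fchart \<Rightarrow> 'x \<Rightarrow> real ^ 'n \<Rightarrow> real ^ 'n ^ 'n) \<Rightarrow> 'm set \<Rightarrow> bool" where
  "strongly_convex A g S \<longleftrightarrow>
     (\<forall>p\<in>S. \<forall>q\<in>S. \<exists>\<gamma>. shortest_geodesic A g p q \<gamma> \<and> \<gamma> ` {0..1} \<subseteq> S \<and>
        (\<forall>\<delta>. shortest_geodesic A g p q \<delta> \<longrightarrow> (\<forall>t\<in>{0..1}. \<delta> t = \<gamma> t)))"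


section \<open>Regular coverings and holonomy\<close>

definition regular_covering ::
  "'m topology \<Rightarrow> ('m, 'n::finite, 'x) fchart set \<Rightarrow>
   (('m, 'n, 'x) fchart \<Rightarrow> 'x \<Rightarrow> real ^ 'n \<Rightarrow> real ^ 'n ^ 'n) \<Rightarrow>
   real \<Rightarrow> nat \<Rightarrow> (nat \<Rightarrow> ('m, 'n, 'x) fchart) \<Rightarrow> bool" where
  "regular_covering M A g lam \<nu> \<phi> \<longleftrightarrow>
     lam > 0 \<and>
     (\<forall>p\<in>topspace M. strongly_convex A g {q \<in> leaf M A p. leafwise_dist A g p q \<le> lam}) \<and>
     (\<forall>i\<in>{1..\<nu>}. \<phi> i \<in> A) \<and>
     (\<Union>i\<in>{1..\<nu>}. fc_dom (\<phi> i)) = topspace M \<and>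
     (\<forall>i\<in>{1..\<nu>}. \<forall>w\<in>fc_mod (\<phi> i).
        strongly_convex A g (plaque M (\<phi> i) w) \<and>
        (\<exists>r < lam / 2. \<forall>p\<in>plaque M (\<phi> i) w. \<forall>q\<in>plaque M (\<phi> i) w. leafwise_dist A g p q \<le> r))"

text \<open>\<open>holonomy \<nu> \<phi> \<gamma> a b i j h\<close>: the restriction of the leafwise path \<open>\<gamma>\<close> to \<open>[a, b]\<close> is
  covered by a chain of plaques from a plaque of the chart \<open>i\<close> to a plaque of the chart \<open>j\<close>, and
  \<open>h\<close> is the composition of the transverse coordinate changes along it. Only the germ of \<open>h\<close> at
  the transverse coordinate of \<open>\<gamma> a\<close> in the chart \<open>i\<close> is meaningful.\<close>

inductive holonomy ::
  "nat \<Rightarrow> (nat \<Rightarrow> ('m, 'n::finite, 'x) fchart) \<Rightarrow> (real \<Rightarrow> 'm) \<Rightarrow>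
   real \<Rightarrow> real \<Rightarrow> nat \<Rightarrow> nat \<Rightarrow> ('x \<Rightarrow> 'x) \<Rightarrow> bool"
  for \<nu> \<phi> \<gamma> where
  stay: "\<lbrakk>i \<in> {1..\<nu>}; a \<le> b; \<gamma> ` {a..b} \<subseteq> fc_dom (\<phi> i);
     \<And>t. t \<in> {a..b} \<Longrightarrow> snd (fc_map (\<phi> i) (\<gamma> t)) = w\<rbrakk>
   \<Longrightarrow> holonomy \<nu> \<phi> \<gamma> a b i i (\<lambda>w. w)"
| change: "\<lbrakk>i \<in> {1..\<nu>}; j \<in> {1..\<nu>}; \<gamma> a \<in> fc_dom (\<phi> i) \<inter> fc_dom (\<phi> j);
     fc_map (\<phi> i) (\<gamma> a) = (v, w)\<rbrakk>
   \<Longrightarrow> holonomy \<nu> \<phi> \<gamma> a a i j (\<lambda>w'. snd (fc_map (\<phi> j) (chart_inv (\<phi> i) (v, w'))))"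
| comp: "\<lbrakk>holonomy \<nu> \<phi> \<gamma> a b i j h; holonomy \<nu> \<phi> \<gamma> b c j k h'\<rbrakk>
   \<Longrightarrow> holonomy \<nu> \<phi> \<gamma> a c i k (h' \<circ> h)"

definition loop_at :: "'a topology \<Rightarrow> 'a \<Rightarrow> (real \<Rightarrow> 'a) \<Rightarrow> bool" where
  "loop_at X x \<gamma> \<longleftrightarrow> pathin X \<gamma> \<and> \<gamma> 0 = x \<and> \<gamma> 1 = x"

definition homotopic_loops_at ::
  "'a topology \<Rightarrow> 'a \<Rightarrow> (real \<Rightarrow> 'a) \<Rightarrow> (real \<Rightarrow> 'a) \<Rightarrow> bool" where
  "homotopic_loops_at X x = homotopic_with (\<lambda>\<gamma>. \<gamma> 0 = x \<and> \<gamma> 1 = x) (top_of_set {0..1}) X"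

text \<open>The leafwise loop \<open>\<gamma>\<close> at \<open>x\<close> represents an element of the kernel of the holonomy
  homomorphism at \<open>x\<close>, i.e. its holonomy is the germ of the identity.\<close>

definition in_holonomy_kernel ::
  "'x topology \<Rightarrow> nat \<Rightarrow> (nat \<Rightarrow> ('m, 'n::finite, 'x) fchart) \<Rightarrow> 'm \<Rightarrow> (real \<Rightarrow> 'm) \<Rightarrow> bool" where
  "in_holonomy_kernel X \<nu> \<phi> x \<gamma> \<longleftrightarrow>
     (\<exists>i\<in>{1..\<nu>}. x \<in> fc_dom (\<phi> i) \<and>
        (\<exists>h W. holonomy \<nu> \<phi> \<gamma> 0 1 i i h \<and>
           openin (subtopology X (fc_mod (\<phi> i))) W \<and> snd (fc_map (\<phi> i) x) \<in> W \<and>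
           (\<forall>w\<in>W. h w = w)))"

text \<open>The counterpart of \<^const>\<open>covering_space\<close> for abstract topologies; it is needed because
  the leaf topology is not the topology of a type class instance.\<close>

definition covering_projection :: "'e topology \<Rightarrow> ('e \<Rightarrow> 'b) \<Rightarrow> 'b topology \<Rightarrow> bool" where
  "covering_projection E p B \<longleftrightarrow>
     continuous_map E B p \<and> p ` topspace E = topspace B \<and>
     (\<forall>y\<in>topspace B. \<exists>U. openin B U \<and> y \<in> U \<and>
        (\<exists>\<V>. \<Union>\<V> = {e \<in> topspace E. p e \<in> U} \<and>
           (\<forall>V\<in>\<V>. openin E V) \<and> pairwise disjnt \<V> \<and>
           (\<forall>V\<in>\<V>. homeomorphic_map (subtopology E V) (subtopology B U) p)))"

text \<open>The covering of the leaf through \<open>x\<close> associated to the kernel of the holonomy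
  homomorphism: the image of \<open>\<pi>\<^sub>1(E, e)\<close> under \<open>p\<close> is exactly that kernel. It is unique up to
  isomorphism of pointed coverings.\<close>

definition holonomy_covering ::
  "'m topology \<Rightarrow> 'x topology \<Rightarrow> ('m, 'n::finite, 'x) fchart set \<Rightarrow>
   nat \<Rightarrow> (nat \<Rightarrow> ('m, 'n, 'x) fchart) \<Rightarrow> 'm \<Rightarrow> 'e topology \<Rightarrow> 'e \<Rightarrow> ('e \<Rightarrow> 'm) \<Rightarrow> bool" where
  "holonomy_covering M X A \<nu> \<phi> x E e p \<longleftrightarrow>
     covering_projection E p (leaf_topology M A x) \<and> path_connected_space E \<and>
     e \<in> topspace E \<and> p e = x \<and>
     (\<forall>\<gamma>. loop_at (leaf_topology M A x) x \<gamma> \<longrightarrow>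
        ((\<exists>\<delta>. loop_at E e \<delta> \<and> homotopic_loops_at (leaf_topology M A x) x (p \<circ> \<delta>) \<gamma>)
          \<longleftrightarrow> in_holonomy_kernel X \<nu> \<phi> x \<gamma>))"

definition proper_base ::
  "'m topology \<Rightarrow> ('m, 'n::finite, 'x) fchart set \<Rightarrow> nat \<Rightarrow> (nat \<Rightarrow> ('m, 'n, 'x) fchart) \<Rightarrow>
   'm \<Rightarrow> 'e topology \<Rightarrow> ('e \<Rightarrow> 'm) \<Rightarrow> 'm set \<Rightarrow> bool" where
  "proper_base M A \<nu> \<phi> x E p K \<longleftrightarrow>
     K \<subseteq> leaf M A x \<and> x \<in> K \<and>
     (\<exists>\<P>. \<P> \<subseteq> {plaque M (\<phi> i) w | i w. i \<in> {1..\<nu>} \<and> w \<in> fc_mod (\<phi> i)} \<and> K = \<Union>\<P>) \<and>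
     (\<exists>K'. connectedin E K' \<and> compactin E K' \<and> inj_on p K' \<and> p ` K' = K)"


section \<open>Transversals\<close>

definition clopen_transversal ::
  "'m topology \<Rightarrow> 'x topology \<Rightarrow> nat \<Rightarrow> (nat \<Rightarrow> ('m, 'n::finite, 'x) fchart) \<Rightarrow> 'm set \<Rightarrow> bool" where
  "clopen_transversal M X \<nu> \<phi> V \<longleftrightarrow>
     (\<exists>i\<in>{1..\<nu>}. \<exists>\<xi>\<in>ocube 1. \<exists>S.
        openin (subtopology X (fc_mod (\<phi> i))) S \<and> closedin (subtopology X (fc_mod (\<phi> i))) S \<and>
        V = {p \<in> M closure_of fc_dom (\<phi> i). fc_map (\<phi> i) p \<in> {\<xi>} \<times> S})"

text \<open>The leaves of the foliation restricted to a subset \<open>N\<close>.\<close>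

definition restricted_leaves ::
  "'m topology \<Rightarrow> ('m, 'n::finite, 'x) fchart set \<Rightarrow> 'm set \<Rightarrow> 'm set set" where
  "restricted_leaves M A N = path_components_of (subtopology (fine_topology M A) N)"

definition cantor_transversal ::
  "'m topology \<Rightarrow> ('m, 'n::finite, 'x) fchart set \<Rightarrow> 'm set \<Rightarrow> 'm set \<Rightarrow> bool" where
  "cantor_transversal M A N C \<longleftrightarrow>
     C \<subseteq> N \<and> cantor_space (subtopology M C) \<and>
     (\<forall>L\<in>restricted_leaves M A N. \<exists>!z. z \<in> C \<inter> L)"

definition foliated_on ::
  "'m topology \<Rightarrow> ('m, 'n::finite, 'x) fchart set \<Rightarrow> 'm set \<Rightarrow> 'm set \<Rightarrow> ('m \<times> 'm \<Rightarrow> 'm) \<Rightarrow> bool" where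
  "foliated_on M A K V \<Phi> \<longleftrightarrow>
     (\<forall>v\<in>V. \<exists>y\<in>topspace M. \<Phi> ` (K \<times> {v}) \<subseteq> leaf M A y)"

text \<open>The sets \<open>\<Phi> ({y} \<times> V)\<close>, \<open>y \<in> K\<close>, are Cantor transversals parametrised by embeddings of \<open>V\<close>
  that vary continuously with \<open>y\<close> (that is, \<open>\<Phi>\<close> is jointly continuous).\<close>

definition continuous_family_of_cantor_transversals ::
  "'m topology \<Rightarrow> ('m, 'n::finite, 'x) fchart set \<Rightarrow> 'm set \<Rightarrow> 'm set \<Rightarrow> ('m \<times> 'm \<Rightarrow> 'm) \<Rightarrow> 'm set \<Rightarrow> bool" where
  "continuous_family_of_cantor_transversals M A K V \<Phi> N \<longleftrightarrow>
     continuous_map (prod_topology (subtopology M K) (subtopology M V)) M \<Phi> \<and>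
     (\<forall>y\<in>K. embedding_map (subtopology M V) M (\<lambda>v. \<Phi> (y, v)) \<and>
        cantor_transversal M A N (\<Phi> ` ({y} \<times> V)))"

end

theory Submission
  imports Defs
begin

text \<open>Two facts make the big box. First, since the holonomy along every loop of the lift of \<open>K\<close> is
  trivial, the germ at \<open>x\<close> of the projection of a chart to its transversal can be transported along
  paths of the holonomy covering without ambiguity; by compactness the resulting germs along \<open>K\<close> come
  from one function \<open>k\<close> on a neighbourhood of \<open>K\<close> whose fibres are, locally, plaques. Second, one
  constructs maps \<open>\<Phi>(\<cdot>, s)\<close> from \<open>K\<close> into the fibres \<open>{k = s}\<close> with \<open>\<Phi>(\<cdot>, w\<^sub>0)\<close> the inclusion of
  \<open>K\<close>, chart by chart: over a coordinate disc the map found so far is interpolated, by a cutoff function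
  in the coordinates, with the vertical translation of the chart. The smooth dependence of the leafwise
  transition maps on the transverse parameter keeps \<open>\<Phi>(\<cdot>, s)\<close> close to the inclusion in the Lipschitz
  sense in every chart, so \<open>\<Phi>(\<cdot>, s)\<close> is injective for \<open>s\<close> near \<open>w\<^sub>0\<close>, and different values of
  \<open>s\<close> are separated by \<open>k\<close>.\<close>

section \<open>Neighbourhood filters and totally disconnected spaces\<close>

text \<open>Uniform closeness to the inclusion of \<open>K\<close> would not make
  \<open>\<Phi>(\<cdot>, s)\<close> injective, so closeness has to hold at first order. As
  \<open>K\<close> is only a compact union of plaques and \<open>\<Phi>(\<cdot>, s)\<close> lives on
  \<open>K\<close> alone, differences of displacements at pairs of points of \<open>K\<close>
  replace derivatives. A bound on them passes from one chart to another because one linear map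
  approximates a transition on all neighbouring plaques; it survives a Lipschitz cutoff because the
  displacement itself tends to 0 as \<open>s\<close> tends to \<open>w\<^sub>0\<close>; and with any
  factor below 1 it gives local injectivity.

  Every condition is a germ condition at \<open>(y, w\<^sub>0)\<close>. The induction over charts
  may therefore shrink the range of \<open>s\<close> freely and tracks no constants; compactness of
  \<open>K\<close> supplies one range at the end.

  Transverse rigidity comes from total disconnectedness: a continuous map from a connected piece of
  a plaque to \<open>X\<close> is constant. Hence coordinate changes respect plaques, and paths
  inside the box keep the value of \<open>s\<close>.\<close>

lemma eventually_nhdsinI:
  assumes "openin X U" "x \<in> U" "\<And>y. y \<in> U \<Longrightarrow> P y"
  shows "eventually P (nhdsin X x)"
  using assms by (auto simp: eventually_nhdsin)

lemma eventually_nhdsin_obtain: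
  assumes "eventually P (nhdsin X x)" "x \<in> topspace X"
  obtains U where "openin X U" "x \<in> U" "\<And>y. y \<in> U \<Longrightarrow> P y"
  using assms by (auto simp: eventually_nhdsin)

lemma eventually_nhdsin_self:
  "\<lbrakk>eventually P (nhdsin X x); x \<in> topspace X\<rbrakk> \<Longrightarrow> P x"
  by (auto simp: eventually_nhdsin)

lemma eventually_eventually_nhdsin:
  assumes "eventually P (nhdsin X x)"
  shows "eventually (\<lambda>y. eventually P (nhdsin X y)) (nhdsin X x)"
  using assms by (force simp: eventually_nhdsin)

lemma limitin_eventually_nhdsin:
  assumes "limitin X f x F" "eventually P (nhdsin X x)"
  shows "eventually (\<lambda>s. P (f s)) F"
proof -
  have "x \<in> topspace X" using assms(1) by (auto simp: limitin_def)
  then obtain U where U: "openin X U" "x \<in> U" "\<And>y. y \<in> U \<Longrightarrow> P y"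
    using eventually_nhdsin_obtain[OF assms(2)] by metis
  have "eventually (\<lambda>s. f s \<in> U) F" using assms(1) U by (auto simp: limitin_def)
  then show ?thesis by (rule eventually_mono) (use U in auto)
qed

lemma limitin_nhdsin_continuous:
  assumes "continuous_map (subtopology X S) Y f" "openin X S" "x \<in> S"
  shows "limitin Y f (f x) (nhdsin X x)"
  unfolding limitin_def
proof (intro conjI allI impI)
  have xS: "x \<in> topspace (subtopology X S)" using assms openin_subset by fastforce
  show "f x \<in> topspace Y" using assms(1) xS by (auto simp: continuous_map_def)
  fix U assume U: "openin Y U \<and> f x \<in> U"
  have "openin (subtopology X S) {z \<in> topspace (subtopology X S). f z \<in> U}"
    by (rule openin_continuous_map_preimage[OF assms(1)]) (use U in simp)
  then have "openin X {z \<in> topspace (subtopology X S). f z \<in> U}"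
    using assms(2) openin_trans_full by blast
  then show "\<forall>\<^sub>F z in nhdsin X x. f z \<in> U"
    by (rule eventually_nhdsinI) (use U xS in auto)
qed

lemma totally_disconnected_connected_eq:
  assumes "totally_disconnected X" "connectedin X S" "a \<in> S" "b \<in> S"
  shows "a = b"
  using assms unfolding totally_disconnected_def by (metis singletonD subsetD)

text \<open>In a compact Hausdorff space components coincide with quasi-components. The
  quasi-component \<open>{x}\<close> is therefore separated by a clopen set from the compact
  complement of \<open>U\<close>.\<close>

lemma totally_disconnected_clopen_nbhd:
  assumes "compact_space X" "Hausdorff_space X" "totally_disconnected X" "openin X U" "x \<in> U"
  obtains S where "openin X S" "closedin X S" "x \<in> S" "S \<subseteq> U"
proof -
  have xX: "x \<in> topspace X" using assms openin_subset by blast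
  have "quasi_components_of X = connected_components_of X"
    using assms(1,2) by (simp add: compact_imp_locally_compact_space
        quasi_eq_connected_components_of)
  define C where "C = connected_component_of_set X x"
  have CX: "C \<in> connected_components_of X" using xX unfolding C_def connected_components_of_def by blast
  have xC: "x \<in> C" unfolding C_def using xX by (simp add: connected_component_of_refl)
  have "connectedin X C" unfolding C_def by (rule connectedin_connected_component_of)
  then have C: "C = {x}" using xC totally_disconnected_connected_eq[OF assms(3), of C] by blast
  have qC: "C \<in> quasi_components_of X" using CX \<open>quasi_components_of X = _\<close> by simp
  have "compactin X (topspace X - U)"
    using assms(1,4) by (simp add: closedin_compact_space closedin_diff)
  then have "separated_between X C (topspace X - U)"
    using separated_between_quasi_component_compact[OF qC] C assms(5) by (auto simp: disjnt_def)
  then obtain S V where SV: "openin X S" "openin X V" "S \<union> V = topspace X" "disjnt S V" "C \<subseteq> S"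
    "topspace X - U \<subseteq> V" unfolding separated_between_def by blast
  have "closedin X S"
  proof -
    have "S = topspace X - V" using SV openin_subset by (auto simp: disjnt_def)
    then show ?thesis using SV by (simp add: closedin_diff)
  qed
  moreover have "S \<subseteq> U" using SV openin_subset[OF SV(1)] by (auto simp: disjnt_def)
  ultimately show ?thesis using that SV C by auto
qed

section \<open>Charts of a matchbox manifold\<close>

abbreviation lcoord :: "('m, 'n::finite, 'x) fchart \<Rightarrow> 'm \<Rightarrow> real ^ 'n" where
  "lcoord c q \<equiv> fst (fc_map c q)"

abbreviation tcoord :: "('m, 'n::finite, 'x) fchart \<Rightarrow> 'm \<Rightarrow> 'x" where
  "tcoord c q \<equiv> snd (fc_map c q)"

abbreviation chart_pt :: "('m, 'n::finite, 'x) fchart \<Rightarrow> real ^ 'n \<Rightarrow> 'x \<Rightarrow> 'm" where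
  "chart_pt c v w \<equiv> chart_inv c (v, w)"

lemma open_ocube: "open (ocube r)"
  by (simp add: ocube_def open_box)

lemma ocube_subset_ccube: "ocube r \<subseteq> ccube r"
  by (simp add: ocube_def ccube_def box_subset_cbox)

lemma ccube_1_subset_ocube_2: "ccube 1 \<subseteq> ocube 2"
proof
  fix v :: "real ^ 'n" assume "v \<in> ccube 1"
  then have *: "- 1 \<le> v $ i \<and> v $ i \<le> 1" for i by (auto simp: ccube_def mem_box_cart)
  have "- 2 < v $ i \<and> v $ i < 2" for i using *[of i] by linarith
  then show "v \<in> ocube 2" by (auto simp: ocube_def mem_box_cart)
qed

lemma zero_in_ocube_1: "0 \<in> ocube 1"
  by (simp add: ocube_def mem_box_cart)

text \<open>The topological part of a matchbox manifold, on which the transport of germs rests;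
  smoothness is added in \<open>smooth_matchbox_atlas\<close>.\<close>

locale matchbox_atlas =
  fixes M :: "'m topology" and X :: "'x topology" and A :: "('m, 'n::finite, 'x) fchart set"
  assumes compM: "compact_space M" and metrM: "metrizable_space M"
    and compX: "compact_space X" and metrX: "metrizable_space X" and tdX: "totally_disconnected X"
    and chart: "c \<in> A \<Longrightarrow> foliation_chart M X A c"
    and mod_open: "c \<in> A \<Longrightarrow> openin X (fc_mod c)"
    and mod_closed: "c \<in> A \<Longrightarrow> closedin X (fc_mod c)"
    and covered: "y \<in> topspace M \<Longrightarrow> \<exists>c\<in>A. y \<in> fc_dom c"
begin

lemma hausM: "Hausdorff_space M"
  using metrM metrizable_imp_Hausdorff_space by blast

lemma hausX: "Hausdorff_space X"
  using metrX metrizable_imp_Hausdorff_space by blast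

lemma dom_open: "c \<in> A \<Longrightarrow> openin M (fc_dom c)"
  using chart by (auto simp: foliation_chart_def)

lemma dom_topspace: "c \<in> A \<Longrightarrow> q \<in> fc_dom c \<Longrightarrow> q \<in> topspace M"
  using dom_open openin_subset by blast

lemma mod_topspace: "c \<in> A \<Longrightarrow> w \<in> fc_mod c \<Longrightarrow> w \<in> topspace X"
  using mod_open openin_subset by blast

text \<open>\<open>chart_inv\<close> is a mere choice of preimages (\<open>inv_into\<close>).
  Injectivity of the extended chart makes it agree on \<open>ocube 2 \<times> fc_mod c\<close> with
  the genuine inverse homeomorphism.\<close>

lemma ext_maps:
  assumes "c \<in> A"
  shows "homeomorphic_maps (subtopology M (fc_ext c))
    (prod_topology (top_of_set (ocube 2)) (subtopology X (fc_mod c))) (fc_map c) (chart_inv c)"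
proof -
  have ext: "fc_ext c \<subseteq> topspace M" using chart[OF assms] by (auto simp: foliation_chart_def)
  then have tp: "topspace (subtopology M (fc_ext c)) = fc_ext c" by auto
  have h: "homeomorphic_map (subtopology M (fc_ext c))
    (prod_topology (top_of_set (ocube 2)) (subtopology X (fc_mod c))) (fc_map c)"
    using chart[OF assms] by (auto simp: foliation_chart_def)
  then obtain g where g: "homeomorphic_maps (subtopology M (fc_ext c))
    (prod_topology (top_of_set (ocube 2)) (subtopology X (fc_mod c))) (fc_map c) g"
    by (auto simp: homeomorphic_map_maps)
  have inj: "inj_on (fc_map c) (fc_ext c)" using homeomorphic_imp_injective_map[OF h] tp by simp
  have "g z = chart_inv c z" if "z \<in> topspace (prod_topology (top_of_set (ocube 2)) (subtopology X (fc_mod c)))" for z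
  proof -
    have gz: "g z \<in> topspace (subtopology M (fc_ext c))" "fc_map c (g z) = z"
      using g that by (auto simp: homeomorphic_maps_def continuous_map_def)
    then have "g z \<in> fc_ext c" using tp by simp
    then have "inv_into (fc_ext c) (fc_map c) (fc_map c (g z)) = g z" using inj by simp
    then show ?thesis using gz by (simp add: chart_inv_def)
  qed
  then show ?thesis using g by (auto intro: homeomorphic_maps_eq)
qed

lemma dom_subset_closure: "c \<in> A \<Longrightarrow> fc_dom c \<subseteq> M closure_of fc_dom c"
  by (simp add: closure_of_subset dom_open openin_subset)

lemma closure_subset_ext: "c \<in> A \<Longrightarrow> M closure_of fc_dom c \<subseteq> fc_ext c"
  using chart by (auto simp: foliation_chart_def)

text \<open>Open models equal their interiors, so the chart domain fills the whole open box over
  \<open>fc_mod c\<close>.\<close>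

lemma map_dom: "c \<in> A \<Longrightarrow> fc_map c ` fc_dom c = ocube 1 \<times> fc_mod c"
  using chart mod_open by (fastforce simp: foliation_chart_def interior_of_openin)

lemma map_closure:
  assumes "c \<in> A"
  shows "fc_map c ` (M closure_of fc_dom c) = ccube 1 \<times> fc_mod c"
proof -
  have "homeomorphic_map (subtopology M (M closure_of fc_dom c))
       (prod_topology (top_of_set (ccube 1)) (subtopology X (fc_mod c))) (fc_map c)"
    using chart[OF assms] by (auto simp: foliation_chart_def)
  from homeomorphic_imp_surjective_map[OF this]
  show ?thesis using mod_topspace[OF assms] closure_of_subset_topspace[of M "fc_dom c"]
    by (auto simp: Int_absorb1 subset_iff)
qed

lemma chart_pt_inv: "c \<in> A \<Longrightarrow> q \<in> fc_ext c \<Longrightarrow> chart_pt c (lcoord c q) (tcoord c q) = q"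
proof -
  assume a: "c \<in> A" "q \<in> fc_ext c"
  have "fc_ext c \<subseteq> topspace M" using chart[OF a(1)] by (auto simp: foliation_chart_def)
  then show ?thesis using ext_maps[OF a(1)] a(2) by (auto simp: homeomorphic_maps_def)
qed

lemma map_chart_pt:
  assumes "c \<in> A" "v \<in> ocube 2" "w \<in> fc_mod c"
  shows "fc_map c (chart_pt c v w) = (v, w)" "chart_pt c v w \<in> fc_ext c"
proof -
  have "w \<in> topspace X" using mod_topspace assms by blast
  then show "fc_map c (chart_pt c v w) = (v, w)"
    using ext_maps[OF assms(1)] assms by (auto simp: homeomorphic_maps_def)
  have "chart_inv c \<in> topspace (prod_topology (top_of_set (ocube 2)) (subtopology X (fc_mod c)))
     \<rightarrow> topspace (subtopology M (fc_ext c))"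
    using ext_maps[OF assms(1)] by (auto simp: homeomorphic_maps_def continuous_map_def)
  then show "chart_pt c v w \<in> fc_ext c" using assms \<open>w \<in> topspace X\<close> by (auto simp: Pi_def)
qed

lemma ocube_1_subset_2: "ocube 1 \<subseteq> ocube 2"
  using ocube_subset_ccube ccube_1_subset_ocube_2 by blast

lemma chart_pt_dom:
  assumes "c \<in> A" "v \<in> ocube 1" "w \<in> fc_mod c"
  shows "chart_pt c v w \<in> fc_dom c"
proof -
  have "(v, w) \<in> fc_map c ` fc_dom c" using map_dom[OF assms(1)] assms by auto
  then obtain q where q: "q \<in> fc_dom c" "fc_map c q = (v,w)" by auto
  then have "q \<in> fc_ext c" using dom_subset_closure closure_subset_ext assms(1) by blast
  then have "chart_pt c v w = q" using chart_pt_inv[OF assms(1)] q by force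
  then show ?thesis using q by simp
qed

lemma chart_pt_closure:
  assumes "c \<in> A" "v \<in> ccube 1" "w \<in> fc_mod c"
  shows "chart_pt c v w \<in> M closure_of fc_dom c"
proof -
  have "(v, w) \<in> fc_map c ` (M closure_of fc_dom c)" using map_closure[OF assms(1)] assms by auto
  then obtain q where q: "q \<in> M closure_of fc_dom c" "fc_map c q = (v,w)" by auto
  then have "q \<in> fc_ext c" using closure_subset_ext assms(1) by blast
  then have "chart_pt c v w = q" using chart_pt_inv[OF assms(1)] q by force
  then show ?thesis using q by simp
qed

lemma coords_chart_pt [simp]:
  assumes "c \<in> A" "v \<in> ocube 1" "w \<in> fc_mod c"
  shows "fc_map c (chart_pt c v w) = (v, w)"
  using map_chart_pt(1)[OF assms(1)] assms ocube_1_subset_2 by blast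

lemma dom_coords:
  assumes "c \<in> A" "q \<in> fc_dom c"
  shows "lcoord c q \<in> ocube 1" "tcoord c q \<in> fc_mod c"
    "chart_pt c (lcoord c q) (tcoord c q) = q"
proof -
  have "fc_map c q \<in> ocube 1 \<times> fc_mod c" using map_dom[OF assms(1)] assms(2) by blast
  then show "lcoord c q \<in> ocube 1" "tcoord c q \<in> fc_mod c" by (auto simp: mem_Times_iff)
  show "chart_pt c (lcoord c q) (tcoord c q) = q"
    using chart_pt_inv assms dom_subset_closure closure_subset_ext by blast
qed

lemma dom_eqI:
  assumes "c \<in> A" "q \<in> fc_dom c" "q' \<in> fc_dom c"
    "lcoord c q = lcoord c q'" "tcoord c q = tcoord c q'"
  shows "q = q'"
  using dom_coords(3) assms by metis

lemma map_ext_cont: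
  assumes "c \<in> A"
  shows "continuous_map (prod_topology (top_of_set (ocube 2)) (subtopology X (fc_mod c))) M (chart_inv c)"
  using ext_maps[OF assms] by (auto simp: homeomorphic_maps_def continuous_map_in_subtopology)

lemma dom_maps:
  assumes "c \<in> A"
  shows "homeomorphic_maps (subtopology M (fc_dom c))
    (prod_topology (top_of_set (ocube 1)) (subtopology X (fc_mod c))) (fc_map c) (chart_inv c)"
proof -
  have 1: "topspace (subtopology M (fc_ext c)) \<inter> fc_dom c = fc_dom c"
    using dom_subset_closure[OF assms] closure_subset_ext[OF assms] dom_topspace[OF assms] by auto
  have 2: "topspace (prod_topology (top_of_set (ocube 2)) (subtopology X (fc_mod c))) \<inter> ocube 1 \<times> fc_mod c = ocube 1 \<times> fc_mod c"
    using ocube_1_subset_2 mod_topspace[OF assms] by auto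
  have "homeomorphic_maps (subtopology (subtopology M (fc_ext c)) (fc_dom c))
    (subtopology (prod_topology (top_of_set (ocube 2)) (subtopology X (fc_mod c))) (ocube 1 \<times> fc_mod c)) (fc_map c) (chart_inv c)"
    by (rule homeomorphic_maps_subtopologies[OF ext_maps[OF assms]]) (simp add: 1 2 map_dom[OF assms] del: topspace_subtopology topspace_prod_topology)
  moreover have "subtopology (subtopology M (fc_ext c)) (fc_dom c) = subtopology M (fc_dom c)"
    using dom_subset_closure[OF assms] closure_subset_ext[OF assms]
    by (simp add: subtopology_subtopology Int_absorb1 inf.absorb2 order_trans)
  moreover have "subtopology (prod_topology (top_of_set (ocube 2)) (subtopology X (fc_mod c))) (ocube 1 \<times> fc_mod c)
     = prod_topology (top_of_set (ocube 1)) (subtopology X (fc_mod c))"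
    unfolding subtopology_Times subtopology_subtopology Int_absorb1[OF ocube_1_subset_2] Int_absorb ..
  ultimately show ?thesis by metis
qed

lemma coord_cont:
  assumes "c \<in> A"
  shows "continuous_map (subtopology M (fc_dom c)) euclidean (lcoord c)"
    and "continuous_map (subtopology M (fc_dom c)) X (tcoord c)"
proof -
  have "continuous_map (subtopology M (fc_dom c)) (prod_topology (top_of_set (ocube 1)) (subtopology X (fc_mod c))) (fc_map c)"
    using dom_maps[OF assms] by (simp add: homeomorphic_maps_def)
  then show "continuous_map (subtopology M (fc_dom c)) euclidean (lcoord c)"
    "continuous_map (subtopology M (fc_dom c)) X (tcoord c)"
    by (auto simp: continuous_map_pairwise continuous_map_in_subtopology o_def)
qed

lemma chart_inv_cont:
  assumes "c \<in> A"
  shows "continuous_map (prod_topology (top_of_set (ocube 1)) (subtopology X (fc_mod c))) M (chart_inv c)"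
  using dom_maps[OF assms] by (auto simp: homeomorphic_maps_def continuous_map_in_subtopology)

lemma chart_open:
  assumes "c \<in> A" "open B" "openin X W"
  shows "openin M {q \<in> fc_dom c. lcoord c q \<in> B \<and> tcoord c q \<in> W}"
proof -
  have t: "topspace (subtopology M (fc_dom c)) = fc_dom c" using dom_topspace[OF assms(1)] by auto
  have "openin (subtopology M (fc_dom c)) {q \<in> topspace (subtopology M (fc_dom c)). lcoord c q \<in> B}"
    using openin_continuous_map_preimage[OF coord_cont(1)[OF assms(1)]] assms(2) by simp
  moreover have "openin (subtopology M (fc_dom c)) {q \<in> topspace (subtopology M (fc_dom c)). tcoord c q \<in> W}"
    using openin_continuous_map_preimage[OF coord_cont(2)[OF assms(1)]] assms(3) by simp
  ultimately have "openin (subtopology M (fc_dom c)) ({q \<in> fc_dom c. lcoord c q \<in> B} \<inter> {q \<in> fc_dom c. tcoord c q \<in> W})"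
    unfolding t by (rule openin_Int)
  then have "openin M ({q \<in> fc_dom c. lcoord c q \<in> B} \<inter> {q \<in> fc_dom c. tcoord c q \<in> W})"
    using dom_open[OF assms(1)] openin_trans_full by blast
  moreover have "{q \<in> fc_dom c. lcoord c q \<in> B} \<inter> {q \<in> fc_dom c. tcoord c q \<in> W} = {q \<in> fc_dom c. lcoord c q \<in> B \<and> tcoord c q \<in> W}"
    by auto
  ultimately show ?thesis by simp
qed

text \<open>Neighbourhoods of \<open>y\<close> are traded for boxes in coordinates, by openness of
  preimages under \<open>chart_inv\<close>. The leafwise factor is a ball, hence connected, so that
  \<open>tcoord_const\<close> applies to each slice.\<close>

lemma chart_box:
  assumes c: "c \<in> A" "y \<in> fc_dom c" and ev: "eventually P (nhdsin M y)"
  obtains r W where "r > 0" "ball (lcoord c y) r \<subseteq> ocube 1" "openin X W" "tcoord c y \<in> W"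
    "W \<subseteq> fc_mod c" "\<And>v w. \<lbrakk>v \<in> ball (lcoord c y) r; w \<in> W\<rbrakk> \<Longrightarrow> P (chart_pt c v w)"
proof -
  have yM: "y \<in> topspace M" using dom_topspace c by blast
  obtain U where U: "openin M U" "y \<in> U" "\<And>q. q \<in> U \<Longrightarrow> P q"
    using eventually_nhdsin_obtain[OF ev yM] by metis
  let ?Y = "prod_topology (top_of_set (ocube 1)) (subtopology X (fc_mod c))"
  have "openin ?Y {z \<in> topspace ?Y. chart_inv c z \<in> U}"
    by (rule openin_continuous_map_preimage[OF chart_inv_cont[OF c(1)] U(1)])
  moreover have "(lcoord c y, tcoord c y) \<in> {z \<in> topspace ?Y. chart_inv c z \<in> U}"
    using dom_coords[OF c] U mod_topspace[OF c(1)] by (simp add: mem_Times_iff)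
  ultimately have "\<exists>B W. openin (top_of_set (ocube 1)) B \<and> openin (subtopology X (fc_mod c)) W \<and>
    lcoord c y \<in> B \<and> tcoord c y \<in> W \<and> B \<times> W \<subseteq> {z \<in> topspace ?Y. chart_inv c z \<in> U}"
    by (simp only: openin_prod_topology_alt)
  then obtain B W where BW: "openin (top_of_set (ocube 1)) B" "openin (subtopology X (fc_mod c)) W"
    "lcoord c y \<in> B" "tcoord c y \<in> W" "B \<times> W \<subseteq> {z \<in> topspace ?Y. chart_inv c z \<in> U}"
    by (elim exE conjE) (rule that)
  have B: "open B" using BW(1) open_ocube openin_open_eq by blast
  have Bo: "B \<subseteq> ocube 1" using BW(1) openin_imp_subset by blast
  obtain r where r: "r > 0" "ball (lcoord c y) r \<subseteq> B" using B BW(3) open_contains_ball by blast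
  have W: "openin X W" using BW(2) mod_open[OF c(1)] openin_trans_full by blast
  have Wm: "W \<subseteq> fc_mod c" using BW(2) openin_imp_subset by blast
  show ?thesis
  proof (rule that[OF r(1) _ W BW(4) Wm])
    show "ball (lcoord c y) r \<subseteq> ocube 1" using r Bo by blast
    fix v w assume "v \<in> ball (lcoord c y) r" "w \<in> W"
    then have "(v, w) \<in> {z \<in> topspace ?Y. chart_inv c z \<in> U}" using BW(5) r(2) by blast
    then show "P (chart_pt c v w)" using U by simp
  qed
qed

lemma eventually_chart_box:
  assumes "c \<in> A" "y \<in> fc_dom c" "r > 0" "openin X W" "tcoord c y \<in> W"
    "\<And>q. \<lbrakk>q \<in> fc_dom c; lcoord c q \<in> ball (lcoord c y) r; tcoord c q \<in> W\<rbrakk> \<Longrightarrow> P q"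
  shows "eventually P (nhdsin M y)"
  by (rule eventually_nhdsinI[OF chart_open[OF assms(1) open_ball assms(4), of "lcoord c y" r]])
    (use assms in auto)

lemma eventually_dom: "c \<in> A \<Longrightarrow> y \<in> fc_dom c \<Longrightarrow> \<forall>\<^sub>F q in nhdsin M y. q \<in> fc_dom c"
  by (auto simp: eventually_nhdsin intro: dom_open)

lemma chart_inv_slice_cont:
  assumes "c \<in> A" "w \<in> fc_mod c"
  shows "continuous_map (top_of_set (ocube 2)) M (\<lambda>v. chart_pt c v w)"
proof -
  have w: "w \<in> topspace (subtopology X (fc_mod c))" using assms mod_topspace by auto
  have "continuous_map (top_of_set (ocube 2)) (prod_topology (top_of_set (ocube 2)) (subtopology X (fc_mod c))) (\<lambda>v. (v, w))"
    using w by (auto simp: continuous_map_pairwise o_def)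
  from continuous_map_compose[OF this map_ext_cont[OF assms(1)]] show ?thesis by (simp add: o_def)
qed

text \<open>Plaques are connected and the transversals are totally disconnected, so a coordinate change
  maps small plaques into plaques.\<close>

lemma tcoord_const:
  assumes c: "c \<in> A" and d: "d \<in> A" and w: "w \<in> fc_mod c" and B: "connected B" "B \<subseteq> ocube 2"
    and in_d: "\<And>v. v \<in> B \<Longrightarrow> chart_pt c v w \<in> fc_dom d" and v: "v \<in> B" "v' \<in> B"
  shows "tcoord d (chart_pt c v w) = tcoord d (chart_pt c v' w)"
proof -
  have "continuous_map (top_of_set B) M (\<lambda>v. chart_pt c v w)"
    using continuous_map_from_subtopology_mono[OF chart_inv_slice_cont[OF c w] B(2)] .
  then have "continuous_map (top_of_set B) (subtopology M (fc_dom d)) (\<lambda>v. chart_pt c v w)"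
    using in_d by (simp add: continuous_map_in_subtopology image_subset_iff Pi_iff)
  from continuous_map_compose[OF this coord_cont(2)[OF d]]
  have "continuous_map (top_of_set B) X (\<lambda>v. tcoord d (chart_pt c v w))" by (simp add: o_def)
  then have "connectedin X ((\<lambda>v. tcoord d (chart_pt c v w)) ` B)"
    by (rule connectedin_continuous_map_image) (use B(1) in \<open>simp add: connectedin_subtopology\<close>)
  then show ?thesis using totally_disconnected_connected_eq[OF tdX] v by blast
qed

text \<open>\<open>chart_pt c (lcoord c y) s\<close>, with \<open>s\<close> variable, runs through
  the transversal of \<open>c\<close> at the height of \<open>y\<close>; it passes through
  \<open>y\<close> at \<open>s = tcoord c y\<close>.\<close>

lemma limitin_slide:
  assumes c: "c \<in> A" "y \<in> fc_dom c" and f: "limitin X f (tcoord c y) F"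
  shows "limitin M (\<lambda>s. chart_pt c (lcoord c y) (f s)) y F"
  unfolding limitin_def
proof (intro conjI allI impI)
  show "y \<in> topspace M" using c dom_topspace by blast
  fix U assume U: "openin M U \<and> y \<in> U"
  then have "\<forall>\<^sub>F q in nhdsin M y. q \<in> U"
    by (auto simp: eventually_nhdsin)
  obtain r W where rW: "r > 0" "ball (lcoord c y) r \<subseteq> ocube 1" "openin X W" "tcoord c y \<in> W"
    "W \<subseteq> fc_mod c"
    "\<And>v w. \<lbrakk>v \<in> ball (lcoord c y) r; w \<in> W\<rbrakk> \<Longrightarrow> chart_pt c v w \<in> U"
    by (rule chart_box[OF c \<open>\<forall>\<^sub>F q in nhdsin M y. q \<in> U\<close>]) (rule that)
  have "\<forall>\<^sub>F s in F. f s \<in> W" using f rW by (auto simp: limitin_def)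
  then show "\<forall>\<^sub>F s in F. chart_pt c (lcoord c y) (f s) \<in> U"
    by (rule eventually_mono) (use rW in auto)
qed

lemma limitin_tcoord:
  assumes c: "c \<in> A" "y \<in> fc_dom c"
  shows "limitin X (tcoord c) (tcoord c y) (nhdsin M y)"
  by (rule limitin_nhdsin_continuous[OF coord_cont(2)[OF c(1)] dom_open[OF c(1)] c(2)])

text \<open>In a small box of \<open>c\<close> the slices are connected and lie in
  \<open>fc_dom d\<close>. By \<open>tcoord_const\<close>, sliding \<open>q\<close> along its plaque
  to the transversal through \<open>y\<close> leaves its \<open>d\<close>-coordinate
  unchanged.\<close>

lemma tcoord_slide:
  assumes c: "c \<in> A" "y \<in> fc_dom c" and d: "d \<in> A" "y \<in> fc_dom d"
  shows "\<forall>\<^sub>F q in nhdsin M y. tcoord d q = tcoord d (chart_pt c (lcoord c y) (tcoord c q))"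
proof -
  obtain r W where rW: "r > 0" "ball (lcoord c y) r \<subseteq> ocube 1" "openin X W" "tcoord c y \<in> W"
    "W \<subseteq> fc_mod c"
    "\<And>v w. \<lbrakk>v \<in> ball (lcoord c y) r; w \<in> W\<rbrakk> \<Longrightarrow> chart_pt c v w \<in> fc_dom d"
    by (rule chart_box[OF c eventually_dom[OF d]]) (rule that)
  show ?thesis
  proof (rule eventually_chart_box[OF c rW(1,3,4)])
    fix q assume q: "q \<in> fc_dom c" "lcoord c q \<in> ball (lcoord c y) r" "tcoord c q \<in> W"
    have "tcoord d (chart_pt c (lcoord c q) (tcoord c q)) = tcoord d (chart_pt c (lcoord c y) (tcoord c q))"
    proof (rule tcoord_const[OF c(1) d(1)])
      show "tcoord c q \<in> fc_mod c" using q rW by blast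
      show "connected (ball (lcoord c y) r)" by simp
      show "ball (lcoord c y) r \<subseteq> ocube 2" using rW ocube_1_subset_2 by blast
    qed (use rW q in auto)
    then show "tcoord d q = tcoord d (chart_pt c (lcoord c y) (tcoord c q))"
      using dom_coords(3)[OF c(1) q(1)] by simp
  qed
qed


section \<open>The fine topology\<close>

text \<open>A point of the closure whose leafwise coordinate lies in the open cube is already in
  \<open>fc_dom c\<close>: the chart sends some point of \<open>fc_dom c\<close> to the same
  coordinates and is injective.\<close>

lemma fine_generator:
  assumes "c \<in> A" "V \<subseteq> ocube 1" "w \<in> fc_mod c"
  shows "{p \<in> M closure_of fc_dom c. fc_map c p \<in> V \<times> {w}}
    = {p \<in> fc_dom c. lcoord c p \<in> V \<and> tcoord c p = w}"
proof -
  have "p \<in> fc_dom c" if "p \<in> M closure_of fc_dom c" "lcoord c p \<in> V" "tcoord c p = w" for p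
  proof -
    have "p \<in> fc_ext c" using closure_subset_ext assms that by blast
    then have "chart_pt c (lcoord c p) (tcoord c p) = p" using chart_pt_inv assms by blast
    then show ?thesis using chart_pt_dom[OF assms(1), of "lcoord c p" "tcoord c p"] that assms by auto
  qed
  then show ?thesis using dom_subset_closure[OF assms(1)] by (auto simp: mem_Times_iff)
qed

lemma fine_open_plaque:
  assumes "c \<in> A" "open B" "B \<subseteq> ocube 1" "w \<in> fc_mod c"
  shows "openin (fine_topology M A) {p \<in> fc_dom c. lcoord c p \<in> B \<and> tcoord c p = w}"
  unfolding fine_topology_def fine_generator[OF assms(1,3,4), symmetric]
  by (rule topology_generated_by_Basis) (use assms in blast)

lemma topspace_fine: "topspace (fine_topology M A) = topspace M"
proof
  show "topspace (fine_topology M A) \<subseteq> topspace M"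
    unfolding fine_topology_def topology_generated_by_topspace
    using closure_of_subset_topspace[of M] by blast
  show "topspace M \<subseteq> topspace (fine_topology M A)"
  proof
    fix y assume "y \<in> topspace M"
    then obtain c where c: "c \<in> A" "y \<in> fc_dom c" using covered by blast
    have "openin (fine_topology M A) {p \<in> fc_dom c. lcoord c p \<in> ocube 1 \<and> tcoord c p = tcoord c y}"
      using c dom_coords by (intro fine_open_plaque) (auto simp: open_ocube)
    then show "y \<in> topspace (fine_topology M A)" using c dom_coords openin_subset by blast
  qed
qed

text \<open>Generators of the fine topology come from all charts \<open>d\<close>, while
  \<open>loc\<close> controls a single chart \<open>c\<close>. Near \<open>f z\<close> the
  coordinate \<open>tcoord d\<close> is a function of \<open>tcoord c\<close> by
  \<open>tcoord_slide\<close>, so it too is locally constant along \<open>f\<close>.\<close>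

lemma continuous_map_fine:
  assumes f: "continuous_map Z M f"
    and loc: "\<And>z. z \<in> topspace Z \<Longrightarrow>
      \<exists>U c w. openin Z U \<and> z \<in> U \<and> c \<in> A \<and> (\<forall>z'\<in>U. f z' \<in> fc_dom c \<and> tcoord c (f z') = w)"
  shows "continuous_map Z (fine_topology M A) f"
  unfolding fine_topology_def
proof (rule continuous_on_generated_topo)
  show "f ` topspace Z \<subseteq> \<Union> {{p \<in> M closure_of fc_dom c. fc_map c p \<in> V \<times> {w}} | c V w.
        c \<in> A \<and> open V \<and> V \<subseteq> ocube 1 \<and> w \<in> fc_mod c}"
    using f topspace_fine unfolding fine_topology_def topology_generated_by_topspace continuous_map_def
    by auto
  fix G assume "G \<in> {{p \<in> M closure_of fc_dom c. fc_map c p \<in> V \<times> {w}} | c V w.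
        c \<in> A \<and> open V \<and> V \<subseteq> ocube 1 \<and> w \<in> fc_mod c}"
  then obtain d V w' where G: "G = {p \<in> M closure_of fc_dom d. fc_map d p \<in> V \<times> {w'}}"
    and d: "d \<in> A" "open V" "V \<subseteq> ocube 1" "w' \<in> fc_mod d" by blast
  have G: "G = {p \<in> fc_dom d. lcoord d p \<in> V \<and> tcoord d p = w'}"
    unfolding G by (rule fine_generator[OF d(1,3,4)])
  show "openin Z (f -` G \<inter> topspace Z)"
  proof (subst openin_subopen, safe)
    fix z assume z: "f z \<in> G" "z \<in> topspace Z"
    let ?y = "f z"
    obtain U c w where U: "openin Z U" "z \<in> U" "c \<in> A" "\<And>z'. z' \<in> U \<Longrightarrow> f z' \<in> fc_dom c \<and> tcoord c (f z') = w"
      using loc[OF z(2)] by blast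
    have y: "?y \<in> fc_dom c" "?y \<in> fc_dom d" "tcoord c ?y = w" using U z G by auto
    have "\<forall>\<^sub>F q in nhdsin M ?y. tcoord d q = tcoord d (chart_pt c (lcoord c ?y) (tcoord c q))"
      by (rule tcoord_slide[OF U(3) y(1) d(1) y(2)])
    then obtain Q where Q: "openin M Q" "?y \<in> Q" "\<And>q. q \<in> Q \<Longrightarrow> tcoord d q = tcoord d (chart_pt c (lcoord c ?y) (tcoord c q))"
      by (rule eventually_nhdsin_obtain[OF _ dom_topspace[OF d(1) y(2)]]) (rule that)
    define Q' where "Q' = Q \<inter> {q \<in> fc_dom d. lcoord d q \<in> V \<and> tcoord d q \<in> topspace X}"
    have Q': "openin M Q'" unfolding Q'_def using Q(1) chart_open[OF d(1,2) openin_topspace] by blast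
    define T where "T = U \<inter> {z' \<in> topspace Z. f z' \<in> Q'}"
    have "openin Z T" unfolding T_def using U(1) openin_continuous_map_preimage[OF f Q'] by blast
    moreover have "z \<in> T" unfolding T_def Q'_def using U z Q G d mod_topspace[OF d(1)] by auto
    moreover have "T \<subseteq> f -` G \<inter> topspace Z"
    proof
      fix z' assume z': "z' \<in> T"
      have "tcoord d (f z') = tcoord d (chart_pt c (lcoord c ?y) w)"
        using z' U(4)[of z'] Q(3)[of "f z'"] by (auto simp: T_def Q'_def)
      also have "\<dots> = w'" using dom_coords(3)[OF U(3) y(1)] y(3) z(1) G by auto
      finally show "z' \<in> f -` G \<inter> topspace Z" using z' by (auto simp: T_def Q'_def G)
    qed
    ultimately show "\<exists>T. openin Z T \<and> z \<in> T \<and> T \<subseteq> f -` G \<inter> topspace Z" by blast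
  qed
qed

lemma fine_slice_cont:
  assumes "c \<in> A" "w \<in> fc_mod c"
  shows "continuous_map (top_of_set (ocube 1)) (fine_topology M A) (\<lambda>v. chart_pt c v w)"
proof (rule continuous_map_fine)
  show "continuous_map (top_of_set (ocube 1)) M (\<lambda>v. chart_pt c v w)"
    using continuous_map_from_subtopology_mono[OF chart_inv_slice_cont[OF assms] ocube_1_subset_2] .
  show "\<exists>U c' w'. openin (top_of_set (ocube 1)) U \<and> z \<in> U \<and> c' \<in> A \<and>
      (\<forall>z'\<in>U. chart_pt c z' w \<in> fc_dom c' \<and> tcoord c' (chart_pt c z' w) = w')"
    if "z \<in> topspace (top_of_set (ocube 1))" for z
    using that assms chart_pt_dom[OF assms(1) _ assms(2)]
    by (intro exI[of _ "ocube 1"] exI[of _ c] exI[of _ w]) auto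
qed

lemma openin_fine:
  assumes "openin M U" shows "openin (fine_topology M A) U"
proof (subst openin_subopen, safe)
  fix y assume y: "y \<in> U"
  then obtain c where c: "c \<in> A" "y \<in> fc_dom c" using covered assms openin_subset by blast
  have "\<forall>\<^sub>F q in nhdsin M y. q \<in> U" using y assms by (auto simp: eventually_nhdsin)
  from this obtain r W where rW: "r > 0" "ball (lcoord c y) r \<subseteq> ocube 1" "openin X W" "tcoord c y \<in> W"
    "W \<subseteq> fc_mod c" "\<And>v w. \<lbrakk>v \<in> ball (lcoord c y) r; w \<in> W\<rbrakk> \<Longrightarrow> chart_pt c v w \<in> U"
    by (rule chart_box[OF c]) (rule that)
  let ?P = "{p \<in> fc_dom c. lcoord c p \<in> ball (lcoord c y) r \<and> tcoord c p = tcoord c y}"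
  have "openin (fine_topology M A) ?P"
    by (rule fine_open_plaque[OF c(1) open_ball rW(2)]) (use rW in blast)
  moreover have "y \<in> ?P" using c rW by simp
  moreover have "?P \<subseteq> U"
  proof
    fix p assume p: "p \<in> ?P"
    then have "chart_pt c (lcoord c p) (tcoord c p) \<in> U" using rW(4,6) by simp
    then show "p \<in> U" using dom_coords(3)[OF c(1), of p] p by simp
  qed
  ultimately show "\<exists>T. openin (fine_topology M A) T \<and> y \<in> T \<and> T \<subseteq> U" by blast
qed

lemma continuous_map_fine_id: "continuous_map (fine_topology M A) M (\<lambda>y. y)"
  by (auto simp: continuous_map_def topspace_fine openin_fine openin_Int inf.absorb2 Collect_conj_eq
      simp flip: Int_def intro: openin_fine)

section \<open>Flat sections along leafwise paths\<close>

text \<open>Near \<open>y\<close>, \<open>k\<close> factors through the transverse coordinate. The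
  factor is written as \<open>k\<close> itself on the transversal through \<open>y\<close>, which
  avoids a quantifier over functions; the choice of chart is immaterial by
  \<open>leafwise_constD\<close>.\<close>

definition leafwise_const :: "('m \<Rightarrow> 'z) \<Rightarrow> 'm \<Rightarrow> bool" where
  "leafwise_const k y \<longleftrightarrow> (\<exists>c\<in>A. y \<in> fc_dom c \<and>
     (\<forall>\<^sub>F q in nhdsin M y. k q = k (chart_pt c (lcoord c y) (tcoord c q))))"

lemma leafwise_constD:
  assumes "leafwise_const k y" and d: "d \<in> A" "y \<in> fc_dom d"
  shows "\<forall>\<^sub>F q in nhdsin M y. k q = k (chart_pt d (lcoord d y) (tcoord d q))"
proof -
  obtain c where c: "c \<in> A" "y \<in> fc_dom c"
    and k: "\<forall>\<^sub>F q in nhdsin M y. k q = k (chart_pt c (lcoord c y) (tcoord c q))"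
    using assms(1) by (auto simp: leafwise_const_def)
  have "limitin M (\<lambda>q. chart_pt d (lcoord d y) (tcoord d q)) y (nhdsin M y)"
    by (rule limitin_slide[OF d limitin_tcoord[OF d]])
  from limitin_eventually_nhdsin[OF this k]
  have "\<forall>\<^sub>F q in nhdsin M y. k (chart_pt d (lcoord d y) (tcoord d q))
     = k (chart_pt c (lcoord c y) (tcoord c (chart_pt d (lcoord d y) (tcoord d q))))" .
  with tcoord_slide[OF d c] k show ?thesis
    by eventually_elim simp
qed

lemma leafwise_const_cong:
  assumes "leafwise_const k y" "\<forall>\<^sub>F q in nhdsin M y. k q = k' q"
  shows "leafwise_const k' y"
proof -
  obtain c where c: "c \<in> A" "y \<in> fc_dom c"
    and k: "\<forall>\<^sub>F q in nhdsin M y. k q = k (chart_pt c (lcoord c y) (tcoord c q))"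
    using assms(1) by (auto simp: leafwise_const_def)
  have "\<forall>\<^sub>F q in nhdsin M y. k' q = k' (chart_pt c (lcoord c y) (tcoord c q))"
    using limitin_eventually_nhdsin[OF limitin_slide[OF c limitin_tcoord[OF c]] assms(2)] k assms(2)
    by eventually_elim simp
  then show ?thesis using c by (auto simp: leafwise_const_def)
qed

lemma leafwise_const_comp: "leafwise_const k y \<Longrightarrow> leafwise_const (\<lambda>q. \<theta> (k q)) y"
  unfolding leafwise_const_def by (elim bexE conjE, rule bexI, rule conjI, assumption)
    (auto elim: eventually_mono)

lemma leafwise_const_trans:
  assumes c: "c \<in> A" "y \<in> fc_dom c"
  shows "leafwise_const (\<lambda>q. f (tcoord c q)) y"
proof -
  have "\<forall>\<^sub>F q in nhdsin M y. f (tcoord c q) = f (tcoord c (chart_pt c (lcoord c y) (tcoord c q)))"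
    using eventually_dom[OF c] by eventually_elim (simp add: c dom_coords)
  then show ?thesis using c by (auto simp: leafwise_const_def)
qed

text \<open>\<open>tcoord c\<close> is continuous and open at \<open>y\<close>, so germs at
  \<open>y\<close> of transverse conditions are germs at \<open>tcoord c y\<close>. They do not see
  the position of \<open>y\<close> in its plaque.\<close>

lemma eventually_tcoord:
  assumes c: "c \<in> A" "y \<in> fc_dom c"
  shows "(\<forall>\<^sub>F q in nhdsin M y. P (tcoord c q)) \<longleftrightarrow> (\<forall>\<^sub>F w in nhdsin X (tcoord c y). P w)"
proof
  assume "\<forall>\<^sub>F w in nhdsin X (tcoord c y). P w"
  then show "\<forall>\<^sub>F q in nhdsin M y. P (tcoord c q)"
    by (rule limitin_eventually_nhdsin[OF limitin_tcoord[OF c]])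
next
  assume "\<forall>\<^sub>F q in nhdsin M y. P (tcoord c q)"
  then obtain r W where rW: "r > 0" "ball (lcoord c y) r \<subseteq> ocube 1" "openin X W" "tcoord c y \<in> W"
    "W \<subseteq> fc_mod c" "\<And>v w. \<lbrakk>v \<in> ball (lcoord c y) r; w \<in> W\<rbrakk> \<Longrightarrow> P (tcoord c (chart_pt c v w))"
    by (rule chart_box[OF c]) (rule that)
  have "P w" if "w \<in> W" for w
  proof -
    have "lcoord c y \<in> ball (lcoord c y) r" using rW by simp
    then have "P (tcoord c (chart_pt c (lcoord c y) w))" using rW(6) that by blast
    moreover have "w \<in> fc_mod c" using that rW by blast
    ultimately show ?thesis using c dom_coords(1)[OF c] by simp
  qed
  then show "\<forall>\<^sub>F w in nhdsin X (tcoord c y). P w" by (rule eventually_nhdsinI[OF rW(3,4)])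
qed

text \<open>A section along \<open>\<gamma>\<close> of the sheaf of germs of leafwise constant
  functions: only the germ of \<open>\<Sigma> t\<close> at \<open>\<gamma> t\<close> matters, and
  representatives for nearby parameters have the same germ.\<close>

definition flat_along :: "(real \<Rightarrow> 'm) \<Rightarrow> (real \<Rightarrow> 'm \<Rightarrow> 'z) \<Rightarrow> real \<Rightarrow> real \<Rightarrow> bool" where
  "flat_along \<gamma> \<Sigma> a b \<longleftrightarrow> continuous_map (top_of_set {a..b}) M \<gamma> \<and>
     (\<forall>t\<in>{a..b}. leafwise_const (\<Sigma> t) (\<gamma> t) \<and>
       (\<exists>\<delta>>0. \<forall>t'\<in>{a..b}. \<bar>t' - t\<bar> < \<delta> \<longrightarrow> (\<forall>\<^sub>F q in nhdsin M (\<gamma> t'). \<Sigma> t' q = \<Sigma> t q)))"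

lemma flat_along_subset:
  assumes "flat_along \<gamma> \<Sigma> a b" "{a'..b'} \<subseteq> {a..b}"
  shows "flat_along \<gamma> \<Sigma> a' b'"
  using assms unfolding flat_along_def
  by (meson continuous_map_from_subtopology_mono subset_iff)

lemma path_eventually:
  fixes t :: real
  assumes \<gamma>: "continuous_map (top_of_set {a..b}) M \<gamma>" and t: "t \<in> {a..b}"
    and ev: "eventually P (nhdsin M (\<gamma> t))"
  shows "\<exists>\<delta>>0. \<forall>t'\<in>{a..b}. \<bar>t' - t\<bar> < \<delta> \<longrightarrow> eventually P (nhdsin M (\<gamma> t'))"
proof -
  have "\<gamma> t \<in> topspace M" using \<gamma> t by (auto simp: continuous_map_def)
  then obtain U where U: "openin M U" "\<gamma> t \<in> U" "\<And>q. q \<in> U \<Longrightarrow> P q"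
    by (rule eventually_nhdsin_obtain[OF ev]) (rule that)
  have "openin (top_of_set {a..b}) {s \<in> {a..b}. \<gamma> s \<in> U}"
    using openin_continuous_map_preimage[OF \<gamma> U(1)] by simp
  then obtain \<delta> where "\<delta> > 0" "ball t \<delta> \<inter> {a..b} \<subseteq> {s \<in> {a..b}. \<gamma> s \<in> U}"
    using U t by (force simp: openin_contains_ball)
  then show ?thesis using U eventually_nhdsinI[OF U(1), of _ P]
    by (intro exI[of _ \<delta>]) (force simp: dist_real_def subset_iff)
qed

text \<open>Inside one plaque, whether a flat section factors through \<open>f\<close> is both an open and a
  closed condition on the parameter.\<close>

lemma flat_along_plaque:
  assumes c: "c \<in> A" and ab: "a \<le> b" and dom: "\<gamma> ` {a..b} \<subseteq> fc_dom c"
    and w: "\<And>t. t \<in> {a..b} \<Longrightarrow> tcoord c (\<gamma> t) = w"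
    and flat: "flat_along \<gamma> \<Sigma> a b"
    and end_b: "\<forall>\<^sub>F q in nhdsin M (\<gamma> b). \<Sigma> b q = f (tcoord c q)"
  shows "\<forall>\<^sub>F q in nhdsin M (\<gamma> a). \<Sigma> a q = f (tcoord c q)"
proof -
  define R where "R t \<longleftrightarrow> (\<forall>\<^sub>F q in nhdsin M (\<gamma> t). \<Sigma> t q = f (tcoord c q))" for t
  have \<gamma>: "continuous_map (top_of_set {a..b}) M \<gamma>" using flat by (auto simp: flat_along_def)
  have loc: "\<exists>\<delta>>0. \<forall>t'\<in>{a..b}. \<bar>t' - t\<bar> < \<delta> \<longrightarrow> R t' = R t" if t: "t \<in> {a..b}" for t
  proof -
    have y: "\<gamma> t \<in> fc_dom c" using dom t by auto
    define G where "G \<omega> = \<Sigma> t (chart_pt c (lcoord c (\<gamma> t)) \<omega>)" for \<omega>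
    have lc: "leafwise_const (\<Sigma> t) (\<gamma> t)" using flat t by (auto simp: flat_along_def)
    have ev: "\<forall>\<^sub>F q in nhdsin M (\<gamma> t). \<Sigma> t q = G (tcoord c q)"
      using leafwise_constD[OF lc c y] by (simp add: G_def)
    obtain \<delta>1 where \<delta>1: "\<delta>1 > 0" "\<And>t'. \<lbrakk>t' \<in> {a..b}; \<bar>t' - t\<bar> < \<delta>1\<rbrakk> \<Longrightarrow> \<forall>\<^sub>F q in nhdsin M (\<gamma> t'). \<Sigma> t q = G (tcoord c q)"
      using path_eventually[OF \<gamma> t ev] by blast
    obtain \<delta>2 where \<delta>2: "\<delta>2 > 0" "\<And>t'. \<lbrakk>t' \<in> {a..b}; \<bar>t' - t\<bar> < \<delta>2\<rbrakk> \<Longrightarrow> \<forall>\<^sub>F q in nhdsin M (\<gamma> t'). \<Sigma> t' q = \<Sigma> t q"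
      using flat t unfolding flat_along_def by blast
    \<comment> \<open>By \<open>eventually_tcoord\<close> the condition lives at the common
      transverse point \<open>w\<close>, so its truth does not depend on \<open>t'\<close>:
      \<open>R\<close> is locally constant.\<close>
    have key: "R t' \<longleftrightarrow> (\<forall>\<^sub>F \<omega> in nhdsin X w. G \<omega> = f \<omega>)" if t': "t' \<in> {a..b}" "\<bar>t' - t\<bar> < min \<delta>1 \<delta>2" for t'
    proof -
      have y': "\<gamma> t' \<in> fc_dom c" using dom t' by auto
      have e: "\<forall>\<^sub>F q in nhdsin M (\<gamma> t'). \<Sigma> t' q = G (tcoord c q)"
        using \<delta>1(2)[of t'] \<delta>2(2)[of t'] t' by (auto elim: eventually_elim2)
      have "R t' \<longleftrightarrow> (\<forall>\<^sub>F q in nhdsin M (\<gamma> t'). G (tcoord c q) = f (tcoord c q))"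
        unfolding R_def using e by (auto elim: eventually_elim2)
      then show ?thesis using eventually_tcoord[OF c y', of "\<lambda>\<omega>. G \<omega> = f \<omega>"] w[OF t'(1)] by simp
    qed
    show ?thesis
    proof (intro exI[of _ "min \<delta>1 \<delta>2"] conjI ballI impI)
      show "0 < min \<delta>1 \<delta>2" using \<delta>1 \<delta>2 by simp
      fix t' assume "t' \<in> {a..b}" "\<bar>t' - t\<bar> < min \<delta>1 \<delta>2"
      then show "R t' = R t" using key[of t'] key[of t] t \<delta>1 \<delta>2 by simp
    qed
  qed
  \<comment> \<open>A locally constant predicate takes equal values at both ends of an interval;
    \<open>Bolzano\<close> combines the local equalities. The guard keeps its subintervals inside
    \<open>{a..b}\<close>.\<close>
  have "a \<le> a \<and> b \<le> b \<longrightarrow> R a = R b" using ab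
  proof (rule Bolzano[of a b "\<lambda>s t. a \<le> s \<and> t \<le> b \<longrightarrow> R s = R t"])
    fix x assume x: "a \<le> x" "x \<le> b"
    obtain \<delta> where \<delta>: "\<delta> > 0" "\<And>t'. \<lbrakk>t' \<in> {a..b}; \<bar>t' - x\<bar> < \<delta>\<rbrakk> \<Longrightarrow> R t' = R x"
      using loc[OF atLeastAtMost_iff[THEN iffD2, OF conjI[OF x]]] by blast
    show "\<exists>d>0. \<forall>s t. s \<le> x \<and> x \<le> t \<and> t - s < d \<longrightarrow> a \<le> s \<and> t \<le> b \<longrightarrow> R s = R t"
    proof (intro exI[of _ \<delta>] conjI allI impI)
      fix s t assume st: "s \<le> x \<and> x \<le> t \<and> t - s < \<delta>" "a \<le> s \<and> t \<le> b"
      have "R s = R x" using st by (intro \<delta>(2)) auto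
      moreover have "R t = R x" using st by (intro \<delta>(2)) auto
      ultimately show "R s = R t" by simp
    qed (use \<delta> in simp)
  next
    fix s t u assume "a \<le> s \<and> t \<le> b \<longrightarrow> R s = R t" "a \<le> t \<and> u \<le> b \<longrightarrow> R t = R u" "s \<le> t" "t \<le> u"
    then show "a \<le> s \<and> u \<le> b \<longrightarrow> R s = R u" by linarith
  qed
  then show ?thesis using end_b by (simp add: R_def)
qed

lemma holonomy_le: "holonomy \<nu> \<phi> \<gamma> a b i j h \<Longrightarrow> a \<le> b"
  by (induction rule: holonomy.induct) auto

text \<open>Pulling back along a flat section reverses the direction of the holonomy.\<close>

lemma holonomy_flat:
  assumes "holonomy \<nu> \<phi> \<gamma> a b i j h" and "\<And>i. i \<in> {1..\<nu>} \<Longrightarrow> \<phi> i \<in> A"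
    and "flat_along \<gamma> \<Sigma> a b"
    and "\<forall>\<^sub>F q in nhdsin M (\<gamma> b). \<Sigma> b q = f (tcoord (\<phi> j) q)"
  shows "\<forall>\<^sub>F q in nhdsin M (\<gamma> a). \<Sigma> a q = f (h (tcoord (\<phi> i) q))"
  using assms
proof (induction arbitrary: f rule: holonomy.induct)
  case (stay i a b w)
  then show ?case using flat_along_plaque[of "\<phi> i" a b \<gamma> w \<Sigma> f] by simp
next
  case (change i j a v w)
  have i: "\<phi> i \<in> A" "\<gamma> a \<in> fc_dom (\<phi> i)" and j: "\<phi> j \<in> A" "\<gamma> a \<in> fc_dom (\<phi> j)"
    using change by auto
  have v: "lcoord (\<phi> i) (\<gamma> a) = v" using change by simp
  show ?case using tcoord_slide[OF i j] change.prems(3)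
    by eventually_elim (simp add: v)
next
  case (comp a b i j h c k h')
  have le: "a \<le> b" "b \<le> c" using comp.hyps holonomy_le by blast+
  \<comment> \<open>What is known sits at the right end, so the second half of the chain is treated
    first.\<close>
  have "\<forall>\<^sub>F q in nhdsin M (\<gamma> b). \<Sigma> b q = f (h' (tcoord (\<phi> j) q))"
    by (rule comp.IH(2)) (use comp.prems flat_along_subset[OF comp.prems(2)] le in auto)
  then have "\<forall>\<^sub>F q in nhdsin M (\<gamma> a). \<Sigma> a q = f (h' (h (tcoord (\<phi> i) q)))"
    by (intro comp.IH(1)[of "\<lambda>z. f (h' z)"]) (use comp.prems flat_along_subset[OF comp.prems(2)] le in auto)
  then show ?case by simp
qed

end

section \<open>Concatenation of paths\<close>

text \<open>Applied to paths of points and to sections \<open>\<Sigma>\<close> alike, so that both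
  are reparametrized in the same way.\<close>

definition concat_path :: "(real \<Rightarrow> 'a) \<Rightarrow> (real \<Rightarrow> 'a) \<Rightarrow> real \<Rightarrow> 'a" where
  "concat_path f g t = (if t \<le> 1/2 then f (2 * t) else g (2 * t - 1))"

lemma concat_path_simps [simp]: "concat_path f g 0 = f 0" "concat_path f g 1 = g 1"
  by (auto simp: concat_path_def)

lemma comp_concat_path: "h \<circ> concat_path f g = concat_path (h \<circ> f) (h \<circ> g)"
  by (auto simp: concat_path_def)

lemma continuous_map_affine:
  assumes f: "continuous_map (top_of_set {a..b}) Z f" and ab: "\<And>t. t \<in> {a'..b'} \<Longrightarrow> m * t + q \<in> {a..b::real}"
  shows "continuous_map (top_of_set {a'..b'}) Z (\<lambda>t. f (m * t + q))"
proof -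
  have "continuous_map (top_of_set {a'..b'}) (top_of_set {a..b}) (\<lambda>t. m * t + q)"
    using ab by (auto simp: continuous_map_in_subtopology intro!: continuous_intros)
  from continuous_map_compose[OF this f] show ?thesis by (simp add: o_def)
qed

lemma continuous_map_join:
  assumes f: "continuous_map (top_of_set {a..b}) Z f" and g: "continuous_map (top_of_set {b..c}) Z g"
    and abc: "f b = g b" "a \<le> b" "b \<le> (c::real)"
  shows "continuous_map (top_of_set {a..c}) Z (\<lambda>t. if t \<le> b then f t else g t)"
proof (rule continuous_map_cases_le)
  let ?T = "top_of_set {a..c}"
  have "{a..c} \<inter> {t \<in> topspace ?T. t \<le> b} = {a..b}" "{a..c} \<inter> {t \<in> topspace ?T. b \<le> t} = {b..c}"
    using abc by auto
  then show "continuous_map (subtopology ?T {t \<in> topspace ?T. t \<le> b}) Z f"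
    "continuous_map (subtopology ?T {t \<in> topspace ?T. b \<le> t}) Z g"
    unfolding subtopology_subtopology using f g by simp_all
qed (use abc in auto)

lemma concat_path_eq: "concat_path f g = (\<lambda>t. if t \<le> 1/2 then f (2 * t + 0) else g (2 * t + - 1))"
  by (simp add: concat_path_def fun_eq_iff)

lemma pathin_concat_path:
  assumes "pathin Z f" "pathin Z g" "f 1 = g 0"
  shows "pathin Z (concat_path f g)"
  unfolding pathin_def concat_path_eq
  by (rule continuous_map_join; (rule continuous_map_affine[of 0 1])?) (use assms in \<open>auto simp: pathin_def\<close>)

lemma pathin_reverse: "pathin Z f \<Longrightarrow> pathin Z (\<lambda>t. f (1 - t))"
  using continuous_map_affine[of 0 1 Z f 0 1 "-1" 1] by (simp add: pathin_def)

context matchbox_atlas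
begin

lemma flat_along_obtain:
  assumes "flat_along \<gamma> \<Sigma> a b" "t \<in> {a..b}"
  obtains \<delta> where "\<delta> > 0"
    "\<And>t'. \<lbrakk>t' \<in> {a..b}; \<bar>t' - t\<bar> < \<delta>\<rbrakk> \<Longrightarrow> \<forall>\<^sub>F q in nhdsin M (\<gamma> t'). \<Sigma> t' q = \<Sigma> t q"
  using assms unfolding flat_along_def by blast

lemma flat_along_affine:
  assumes f: "flat_along \<gamma> \<Sigma> a b" and m: "m \<noteq> 0" and ab: "\<And>t. t \<in> {a'..b'} \<Longrightarrow> m * t + q \<in> {a..b}"
  shows "flat_along (\<lambda>t. \<gamma> (m * t + q)) (\<lambda>t. \<Sigma> (m * t + q)) a' b'"
  unfolding flat_along_def
proof (intro conjI ballI)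
  show "continuous_map (top_of_set {a'..b'}) M (\<lambda>t. \<gamma> (m * t + q))"
    by (rule continuous_map_affine[OF _ ab]) (use f in \<open>simp add: flat_along_def\<close>)
  fix t assume t: "t \<in> {a'..b'}"
  show "leafwise_const (\<Sigma> (m * t + q)) (\<gamma> (m * t + q))" using f ab[OF t] unfolding flat_along_def by blast
  obtain \<delta> where \<delta>: "\<delta> > 0" "\<And>t'. \<lbrakk>t' \<in> {a..b}; \<bar>t' - (m * t + q)\<bar> < \<delta>\<rbrakk> \<Longrightarrow>
      \<forall>\<^sub>F z in nhdsin M (\<gamma> t'). \<Sigma> t' z = \<Sigma> (m * t + q) z"
    by (rule flat_along_obtain[OF f ab[OF t]]) (rule that)
  show "\<exists>\<delta>>0. \<forall>t'\<in>{a'..b'}. \<bar>t' - t\<bar> < \<delta> \<longrightarrow>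
      (\<forall>\<^sub>F z in nhdsin M (\<gamma> (m * t' + q)). \<Sigma> (m * t' + q) z = \<Sigma> (m * t + q) z)"
  proof (intro exI[of _ "\<delta> / \<bar>m\<bar>"] conjI ballI impI \<delta>(2) ab)
    fix t' assume "\<bar>t' - t\<bar> < \<delta> / \<bar>m\<bar>"
    then have "\<bar>m\<bar> * \<bar>t' - t\<bar> < \<delta>" using m by (simp add: pos_less_divide_eq mult.commute)
    then show "\<bar>m * t' + q - (m * t + q)\<bar> < \<delta>" by (simp add: abs_mult[symmetric] algebra_simps)
  qed (use \<delta>(1) m in auto)
qed

lemma flat_along_reverse:
  "flat_along \<gamma> \<Sigma> 0 1 \<Longrightarrow> flat_along (\<lambda>t. \<gamma> (1 - t)) (\<lambda>t. \<Sigma> (1 - t)) 0 1"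
  using flat_along_affine[of \<gamma> \<Sigma> 0 1 "-1" 0 1 1] by simp

text \<open>At the junction \<open>\<Sigma>1 b\<close> and \<open>\<Sigma>2 b\<close> may be
  different functions. It suffices that their germs agree there: the agreement persists at nearby
  points of \<open>\<gamma>2\<close> and restores local constancy across \<open>b\<close>.\<close>

lemma flat_along_join:
  assumes f1: "flat_along \<gamma>1 \<Sigma>1 a b" and f2: "flat_along \<gamma>2 \<Sigma>2 b c" and abc: "a \<le> b" "b \<le> c" "\<gamma>1 b = \<gamma>2 b"
    and ev: "\<forall>\<^sub>F q in nhdsin M (\<gamma>1 b). \<Sigma>2 b q = \<Sigma>1 b q"
  shows "flat_along (\<lambda>t. if t \<le> b then \<gamma>1 t else \<gamma>2 t) (\<lambda>t. if t \<le> b then \<Sigma>1 t else \<Sigma>2 t) a c"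
    (is "flat_along ?g ?S a c")
  unfolding flat_along_def
proof (intro conjI ballI)
  have p1: "continuous_map (top_of_set {a..b}) M \<gamma>1" and p2: "continuous_map (top_of_set {b..c}) M \<gamma>2"
    using f1 f2 by (auto simp: flat_along_def)
  show "continuous_map (top_of_set {a..c}) M ?g" by (rule continuous_map_join[OF p1 p2 abc(3,1,2)])
  fix t assume t: "t \<in> {a..c}"
  show "leafwise_const (?S t) (?g t)" using f1 f2 t by (auto simp: flat_along_def)
  have 1: "\<exists>\<delta>>0. \<forall>t'\<in>{a..b}. \<bar>t' - t\<bar> < \<delta> \<longrightarrow> (\<forall>\<^sub>F q in nhdsin M (\<gamma>1 t'). \<Sigma>1 t' q = ?S t q)"
  proof (cases "t \<le> b")
    case True then show ?thesis using f1 t by (simp add: flat_along_def)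
  next
    case False then show ?thesis by (intro exI[of _ "t - b"]) auto
  qed
  have 2: "\<exists>\<delta>>0. \<forall>t'\<in>{b..c}. \<bar>t' - t\<bar> < \<delta> \<longrightarrow> (\<forall>\<^sub>F q in nhdsin M (\<gamma>2 t'). \<Sigma>2 t' q = ?S t q)"
  proof -
    consider "t < b" | "t = b" | "t > b" by linarith
    then show ?thesis
    proof cases
      case 1 then show ?thesis by (intro exI[of _ "b - t"]) auto
    next
      case 2
      have b: "b \<in> {b..c}" using abc by simp
      obtain \<delta> where \<delta>: "\<delta> > 0" "\<And>t'. \<lbrakk>t' \<in> {b..c}; \<bar>t' - b\<bar> < \<delta>\<rbrakk> \<Longrightarrow> \<forall>\<^sub>F q in nhdsin M (\<gamma>2 t'). \<Sigma>2 t' q = \<Sigma>2 b q"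
        by (rule flat_along_obtain[OF f2 b]) (rule that)
      obtain \<delta>' where \<delta>': "\<delta>' > 0" "\<And>t'. \<lbrakk>t' \<in> {b..c}; \<bar>t' - b\<bar> < \<delta>'\<rbrakk> \<Longrightarrow> \<forall>\<^sub>F q in nhdsin M (\<gamma>2 t'). \<Sigma>2 b q = \<Sigma>1 b q"
        using path_eventually[OF p2 b ev[unfolded abc(3)]] by blast
      show ?thesis
      proof (intro exI[of _ "min \<delta> \<delta>'"] conjI ballI impI)
        fix t' assume "t' \<in> {b..c}" "\<bar>t' - t\<bar> < min \<delta> \<delta>'"
        then have "\<forall>\<^sub>F q in nhdsin M (\<gamma>2 t'). \<Sigma>2 t' q = \<Sigma>2 b q" "\<forall>\<^sub>F q in nhdsin M (\<gamma>2 t'). \<Sigma>2 b q = \<Sigma>1 b q"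
          using 2 \<delta>(2) \<delta>'(2) by auto
        then show "\<forall>\<^sub>F q in nhdsin M (\<gamma>2 t'). \<Sigma>2 t' q = ?S t q" by eventually_elim (simp add: 2)
      qed (use \<delta> \<delta>' in simp)
    next
      case 3 then show ?thesis using f2 t by (simp add: flat_along_def)
    qed
  qed
  from 1 obtain \<delta>1 where \<delta>1: "\<delta>1 > 0" "\<forall>t'\<in>{a..b}. \<bar>t' - t\<bar> < \<delta>1 \<longrightarrow> (\<forall>\<^sub>F q in nhdsin M (\<gamma>1 t'). \<Sigma>1 t' q = ?S t q)"
    by (elim exE conjE) (rule that)
  from 2 obtain \<delta>2 where \<delta>2: "\<delta>2 > 0" "\<forall>t'\<in>{b..c}. \<bar>t' - t\<bar> < \<delta>2 \<longrightarrow> (\<forall>\<^sub>F q in nhdsin M (\<gamma>2 t'). \<Sigma>2 t' q = ?S t q)"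
    by (elim exE conjE) (rule that)
  show "\<exists>\<delta>>0. \<forall>t'\<in>{a..c}. \<bar>t' - t\<bar> < \<delta> \<longrightarrow> (\<forall>\<^sub>F q in nhdsin M (?g t'). ?S t' q = ?S t q)"
    by (intro exI[of _ "min \<delta>1 \<delta>2"]) (use \<delta>1 \<delta>2 in auto)
qed

lemma flat_along_concat:
  assumes "flat_along \<gamma>1 \<Sigma>1 0 1" "flat_along \<gamma>2 \<Sigma>2 0 1" "\<gamma>1 1 = \<gamma>2 0"
    and "\<forall>\<^sub>F q in nhdsin M (\<gamma>1 1). \<Sigma>2 0 q = \<Sigma>1 1 q"
  shows "flat_along (concat_path \<gamma>1 \<gamma>2) (concat_path \<Sigma>1 \<Sigma>2) 0 1"
  unfolding concat_path_eq
  by (rule flat_along_join; (rule flat_along_affine[of _ _ 0 1])?) (use assms in auto)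

lemma flat_along_comp:
  assumes "flat_along \<gamma> \<Sigma> a b"
  shows "flat_along \<gamma> (\<lambda>t q. \<theta> (\<Sigma> t q)) a b"
  unfolding flat_along_def
proof (intro conjI ballI)
  show "continuous_map (top_of_set {a..b}) M \<gamma>" using assms by (simp add: flat_along_def)
  fix t assume t: "t \<in> {a..b}"
  show "leafwise_const (\<lambda>q. \<theta> (\<Sigma> t q)) (\<gamma> t)" using assms t by (auto simp: flat_along_def intro: leafwise_const_comp)
  obtain \<delta> where \<delta>: "\<delta> > 0" "\<And>t'. \<lbrakk>t' \<in> {a..b}; \<bar>t' - t\<bar> < \<delta>\<rbrakk> \<Longrightarrow> \<forall>\<^sub>F q in nhdsin M (\<gamma> t'). \<Sigma> t' q = \<Sigma> t q"
    using assms t unfolding flat_along_def by blast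
  show "\<exists>\<delta>>0. \<forall>t'\<in>{a..b}. \<bar>t' - t\<bar> < \<delta> \<longrightarrow> (\<forall>\<^sub>F q in nhdsin M (\<gamma> t'). \<theta> (\<Sigma> t' q) = \<theta> (\<Sigma> t q))"
  proof (intro exI[of _ \<delta>] conjI ballI impI)
    fix t' assume "t' \<in> {a..b}" "\<bar>t' - t\<bar> < \<delta>"
    from \<delta>(2)[OF this] show "\<forall>\<^sub>F q in nhdsin M (\<gamma> t'). \<theta> (\<Sigma> t' q) = \<theta> (\<Sigma> t q)"
      by eventually_elim simp
  qed (use \<delta> in simp)
qed

section \<open>Germs of transverse projections\<close>

text \<open>\<open>k\<close> is, near \<open>y\<close>, a projection along the plaques to the transverse space, with
  \<open>k y = w\<^sub>0\<close>, and \<open>G\<close> is a local transversal through \<open>y\<close> inverse to it.\<close>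

definition transverse_germ :: "'x \<Rightarrow> ('m \<Rightarrow> 'x) \<Rightarrow> ('x \<Rightarrow> 'm) \<Rightarrow> 'm \<Rightarrow> bool" where
  "transverse_germ w\<^sub>0 k G y \<longleftrightarrow> k y = w\<^sub>0 \<and> G w\<^sub>0 = y \<and>
     (\<exists>U. openin M U \<and> y \<in> U \<and> continuous_map (subtopology M U) X k) \<and>
     (\<exists>S. openin X S \<and> w\<^sub>0 \<in> S \<and> continuous_map (subtopology X S) M G) \<and>
     (\<forall>\<^sub>F s in nhdsin X w\<^sub>0. k (G s) = s) \<and> leafwise_const k y \<and>
     (\<exists>c\<in>A. y \<in> fc_dom c \<and> (\<forall>\<^sub>F q in nhdsin M y. tcoord c (G (k q)) = tcoord c q))"

lemma transverse_germ_limits: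
  assumes "transverse_germ w\<^sub>0 k G y"
  shows "limitin X k w\<^sub>0 (nhdsin M y)" "limitin M G y (nhdsin X w\<^sub>0)"
    "limitin M (\<lambda>q. G (k q)) y (nhdsin M y)"
proof -
  obtain U where "openin M U" "y \<in> U" "continuous_map (subtopology M U) X k" "k y = w\<^sub>0"
    using assms by (auto simp: transverse_germ_def)
  then show 1: "limitin X k w\<^sub>0 (nhdsin M y)" using limitin_nhdsin_continuous[of M U X k y] by simp
  obtain S where "openin X S" "w\<^sub>0 \<in> S" "continuous_map (subtopology X S) M G" "G w\<^sub>0 = y"
    using assms by (auto simp: transverse_germ_def)
  then show 2: "limitin M G y (nhdsin X w\<^sub>0)" using limitin_nhdsin_continuous[of X S M G w\<^sub>0] by simp
  show "limitin M (\<lambda>q. G (k q)) y (nhdsin M y)"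
    unfolding limitin_def
  proof (intro conjI allI impI)
    show "y \<in> topspace M" by (rule limitin_topspace[OF 2])
    fix U assume "openin M U \<and> y \<in> U"
    then have "\<forall>\<^sub>F s in nhdsin X w\<^sub>0. G s \<in> U" using 2 by (simp add: limitin_def)
    from limitin_eventually_nhdsin[OF 1 this] show "\<forall>\<^sub>F q in nhdsin M y. G (k q) \<in> U" .
  qed
qed

text \<open>The last clause of \<open>transverse_germ\<close> speaks of one chart only. Both
  \<open>q\<close> and \<open>G (k q)\<close> are near \<open>y\<close>, so
  \<open>tcoord_slide\<close> carries the equality of their \<open>c\<close>-coordinates over to
  \<open>d\<close>.\<close>

lemma transverse_germ_section:
  assumes g: "transverse_germ w\<^sub>0 k G y" and d: "d \<in> A" "y \<in> fc_dom d"
  shows "\<forall>\<^sub>F q in nhdsin M y. tcoord d (G (k q)) = tcoord d q"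
proof -
  obtain c where c: "c \<in> A" "y \<in> fc_dom c" "\<forall>\<^sub>F q in nhdsin M y. tcoord c (G (k q)) = tcoord c q"
    using g by (auto simp: transverse_germ_def)
  show ?thesis
    using c(3) tcoord_slide[OF c(1,2) d]
      limitin_eventually_nhdsin[OF transverse_germ_limits(3)[OF g] tcoord_slide[OF c(1,2) d]]
    by eventually_elim simp
qed

lemma transverse_germ_cong:
  assumes g: "transverse_germ w\<^sub>0 k G y" and ev: "\<forall>\<^sub>F q in nhdsin M y. k q = k' q"
  shows "transverse_germ w\<^sub>0 k' G y"
proof -
  have yM: "y \<in> topspace M" by (rule limitin_topspace[OF transverse_germ_limits(2)[OF g]])
  obtain U where U: "openin M U" "y \<in> U" "continuous_map (subtopology M U) X k"
    using g by (auto simp: transverse_germ_def)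
  from ev obtain U' where U': "openin M U'" "y \<in> U'" "\<And>q. q \<in> U' \<Longrightarrow> k q = k' q"
    by (rule eventually_nhdsin_obtain[OF _ yM]) (rule that)
  have "continuous_map (subtopology M (U \<inter> U')) X k"
    by (rule continuous_map_from_subtopology_mono[OF U(3)]) simp
  then have "continuous_map (subtopology M (U \<inter> U')) X k'"
    by (rule continuous_map_eq) (use U' in auto)
  moreover have "openin M (U \<inter> U')" "y \<in> U \<inter> U'" using U U' by auto
  ultimately have 1: "\<exists>U. openin M U \<and> y \<in> U \<and> continuous_map (subtopology M U) X k'" by blast
  have 2: "\<forall>\<^sub>F s in nhdsin X w\<^sub>0. k' (G s) = s"
  proof -
    have "\<forall>\<^sub>F s in nhdsin X w\<^sub>0. k (G s) = s" using g by (simp add: transverse_germ_def)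
    with limitin_eventually_nhdsin[OF transverse_germ_limits(2)[OF g] ev]
    show ?thesis by eventually_elim simp
  qed
  have 3: "leafwise_const k' y" using g leafwise_const_cong[OF _ ev] by (simp add: transverse_germ_def)
  obtain c where c: "c \<in> A" "y \<in> fc_dom c" "\<forall>\<^sub>F q in nhdsin M y. tcoord c (G (k q)) = tcoord c q"
    using g by (auto simp: transverse_germ_def)
  have 4: "\<forall>\<^sub>F q in nhdsin M y. tcoord c (G (k' q)) = tcoord c q"
    using c(3) ev by eventually_elim simp
  have 5: "k' y = w\<^sub>0" using eventually_nhdsin_self[OF ev yM] g by (simp add: transverse_germ_def)
  show ?thesis using g 1 2 3 4 5 c(1,2) by (auto simp: transverse_germ_def)
qed

lemma chart_pt_cont:
  assumes c: "c \<in> A" and g: "continuous_map Z euclidean g" "\<And>z. z \<in> topspace Z \<Longrightarrow> g z \<in> ocube 1"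
    and f: "continuous_map Z X f" "\<And>z. z \<in> topspace Z \<Longrightarrow> f z \<in> fc_mod c"
  shows "continuous_map Z M (\<lambda>z. chart_pt c (g z) (f z))"
proof -
  have "continuous_map Z (prod_topology (top_of_set (ocube 1)) (subtopology X (fc_mod c))) (\<lambda>z. (g z, f z))"
    using g f by (auto simp: continuous_map_pairwise continuous_map_in_subtopology o_def)
  from continuous_map_compose[OF this chart_inv_cont[OF c]] show ?thesis by (simp add: o_def)
qed

lemma transverse_germ_chart:
  assumes c: "c \<in> A" "y \<in> fc_dom c"
  shows "transverse_germ (tcoord c y) (tcoord c) (\<lambda>s. chart_pt c (lcoord c y) s) y"
  unfolding transverse_germ_def
proof (intro conjI)
  note dc = dom_coords[OF c]
  show "chart_pt c (lcoord c y) (tcoord c y) = y" by (rule dc(3))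
  show "\<exists>U. openin M U \<and> y \<in> U \<and> continuous_map (subtopology M U) X (tcoord c)"
    using coord_cont(2)[OF c(1)] dom_open[OF c(1)] c(2) by blast
  have "continuous_map (subtopology X (fc_mod c)) M (\<lambda>s. chart_pt c (lcoord c y) s)"
    by (rule chart_pt_cont[OF c(1)]) (use dc in \<open>auto simp: continuous_map_from_subtopology\<close>)
  then show "\<exists>S. openin X S \<and> tcoord c y \<in> S \<and> continuous_map (subtopology X S) M (\<lambda>s. chart_pt c (lcoord c y) s)"
    using mod_open[OF c(1)] dc(2) by blast
  show "\<forall>\<^sub>F s in nhdsin X (tcoord c y). tcoord c (chart_pt c (lcoord c y) s) = s"
    by (rule eventually_nhdsinI[OF mod_open[OF c(1)] dc(2)]) (simp add: c dc)
  show "leafwise_const (tcoord c) y" using leafwise_const_trans[OF c, of "\<lambda>z. z"] by simp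
  have "\<forall>\<^sub>F q in nhdsin M y. tcoord c (chart_pt c (lcoord c y) (tcoord c q)) = tcoord c q"
    using eventually_dom[OF c] by eventually_elim (simp add: c dom_coords)
  then show "\<exists>ca\<in>A. y \<in> fc_dom ca \<and>
      (\<forall>\<^sub>F q in nhdsin M y. tcoord ca (chart_pt c (lcoord c y) (tcoord c q)) = tcoord ca q)"
    using c by blast
qed simp

text \<open>Transport of a germ within one plaque: points near \<open>y'\<close> are slid in
  \<open>c\<close> to the transversal through \<open>y\<close>, where \<open>k\<close> is evaluated,
  and \<open>G\<close> is slid to the transversal through \<open>y'\<close>.\<close>

lemma transverse_germ_slide:
  assumes g: "transverse_germ w\<^sub>0 k G y" and c: "c \<in> A" "y \<in> fc_dom c"
    and y': "y' \<in> fc_dom c" "tcoord c y' = tcoord c y"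
  shows "transverse_germ w\<^sub>0 (\<lambda>q. k (chart_pt c (lcoord c y) (tcoord c q)))
    (\<lambda>s. chart_pt c (lcoord c y') (tcoord c (G s))) y'"
    (is "transverse_germ w\<^sub>0 ?k ?G y'")
  unfolding transverse_germ_def
proof (intro conjI)
  note dc = dom_coords[OF c] and dc' = dom_coords[OF c(1) y'(1)]
  show "?k y' = w\<^sub>0" using g y' dc by (simp add: transverse_germ_def)
  show "?G w\<^sub>0 = y'" using g y' dc' by (simp add: transverse_germ_def)
  have slide: "limitin M (\<lambda>q. chart_pt c (lcoord c y) (tcoord c q)) y (nhdsin M y')"
    by (rule limitin_slide[OF c]) (use limitin_tcoord[OF c(1) y'(1)] y'(2) in simp)
  show "\<exists>U. openin M U \<and> y' \<in> U \<and> continuous_map (subtopology M U) X ?k"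
  proof -
    obtain U where U: "openin M U" "y \<in> U" "continuous_map (subtopology M U) X k"
      using g by (auto simp: transverse_germ_def)
    let ?s = "\<lambda>q. chart_pt c (lcoord c y) (tcoord c q)"
    have sc: "continuous_map (subtopology M (fc_dom c)) M ?s"
      by (rule chart_pt_cont[OF c(1)]) (use dc coord_cont[OF c(1)] dom_coords[OF c(1)] in auto)
    define U' where "U' = {q \<in> fc_dom c. ?s q \<in> U}"
    have t: "topspace (subtopology M (fc_dom c)) = fc_dom c" using dom_topspace[OF c(1)] by auto
    have "openin (subtopology M (fc_dom c)) {q \<in> topspace (subtopology M (fc_dom c)). ?s q \<in> U}"
      by (rule openin_continuous_map_preimage[OF sc U(1)])
    then have U'o: "openin M U'" unfolding t U'_def[symmetric] using dom_open[OF c(1)] openin_trans_full by blast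
    have "continuous_map (subtopology M U') M ?s"
      by (rule continuous_map_from_subtopology_mono[OF sc]) (auto simp: U'_def)
    then have "continuous_map (subtopology M U') (subtopology M U) ?s"
      by (auto simp: continuous_map_in_subtopology U'_def)
    from continuous_map_compose[OF this U(3)] have "continuous_map (subtopology M U') X ?k" by (simp add: o_def)
    moreover have "y' \<in> U'" using y' U dc by (simp add: U'_def)
    ultimately show ?thesis using U'o by blast
  qed
  show "\<exists>S. openin X S \<and> w\<^sub>0 \<in> S \<and> continuous_map (subtopology X S) M ?G"
  proof -
    obtain S where S: "openin X S" "w\<^sub>0 \<in> S" "continuous_map (subtopology X S) M G"
      using g by (auto simp: transverse_germ_def)
    define S' where "S' = {s \<in> S. G s \<in> fc_dom c}"
    have t: "topspace (subtopology X S) = S" using openin_subset[OF S(1)] by auto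
    have "openin (subtopology X S) {s \<in> topspace (subtopology X S). G s \<in> fc_dom c}"
      by (rule openin_continuous_map_preimage[OF S(3) dom_open[OF c(1)]])
    then have S'o: "openin X S'" unfolding t S'_def[symmetric] using S(1) openin_trans_full by blast
    have "continuous_map (subtopology X S') M G"
      by (rule continuous_map_from_subtopology_mono[OF S(3)]) (auto simp: S'_def)
    then have "continuous_map (subtopology X S') (subtopology M (fc_dom c)) G"
      by (auto simp: continuous_map_in_subtopology S'_def)
    from continuous_map_compose[OF this coord_cont(2)[OF c(1)]]
    have "continuous_map (subtopology X S') X (\<lambda>s. tcoord c (G s))" by (simp add: o_def)
    then have "continuous_map (subtopology X S') M ?G"
      by (intro chart_pt_cont[OF c(1)]) (use dc' dom_coords[OF c(1)] in \<open>auto simp: S'_def\<close>)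
    moreover have "w\<^sub>0 \<in> S'" using S c g by (simp add: S'_def transverse_germ_def)
    ultimately show ?thesis using S'o by blast
  qed
  have kc: "\<forall>\<^sub>F q in nhdsin M y. k q = ?k q"
    using g by (intro leafwise_constD[OF _ c]) (simp add: transverse_germ_def)
  show "\<forall>\<^sub>F s in nhdsin X w\<^sub>0. ?k (?G s) = s"
  proof -
    have 1: "\<forall>\<^sub>F s in nhdsin X w\<^sub>0. k (G s) = s" using g by (simp add: transverse_germ_def)
    have 2: "\<forall>\<^sub>F s in nhdsin X w\<^sub>0. k (G s) = ?k (G s)"
      by (rule limitin_eventually_nhdsin[OF transverse_germ_limits(2)[OF g] kc])
    have 3: "\<forall>\<^sub>F s in nhdsin X w\<^sub>0. G s \<in> fc_dom c"
      by (rule limitin_eventually_nhdsin[OF transverse_germ_limits(2)[OF g] eventually_dom[OF c]])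
    show ?thesis using 1 2 3 by eventually_elim (use c dc' dom_coords[OF c(1)] in simp)
  qed
  show "leafwise_const ?k y'"
    using leafwise_const_trans[OF c(1) y'(1), of "\<lambda>s. k (chart_pt c (lcoord c y) s)"] .
  have "\<forall>\<^sub>F q in nhdsin M y'. tcoord c (?G (?k q)) = tcoord c q"
  proof -
    have "\<forall>\<^sub>F q in nhdsin M y. tcoord c (G (k q)) = tcoord c q \<and> G (k q) \<in> fc_dom c"
      using transverse_germ_section[OF g c]
        limitin_eventually_nhdsin[OF transverse_germ_limits(3)[OF g] eventually_dom[OF c]]
      by (rule eventually_conj)
    from limitin_eventually_nhdsin[OF slide this] eventually_dom[OF c(1) y'(1)]
    show ?thesis by eventually_elim (use c dc dc' dom_coords[OF c(1)] in simp)
  qed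
  then show "\<exists>ca\<in>A. y' \<in> fc_dom ca \<and> (\<forall>\<^sub>F q in nhdsin M y'. tcoord ca (?G (?k q)) = tcoord ca q)"
    using c(1) y'(1) by blast
qed

text \<open>\<open>G' (k' q)\<close> lies on the local plaque of \<open>q\<close>, and
  \<open>k\<close> is constant there. So \<open>k\<close> arises from \<open>k'\<close> by the
  change of parameter \<open>\<lambda>s. k (G' s)\<close>.\<close>

lemma transverse_germ_factor:
  assumes g: "leafwise_const k y" and g': "transverse_germ w\<^sub>0 k' G' y"
  shows "\<forall>\<^sub>F q in nhdsin M y. k q = k (G' (k' q))"
proof -
  obtain c where c: "c \<in> A" "y \<in> fc_dom c" using g' by (auto simp: transverse_germ_def)
  have kc: "\<forall>\<^sub>F q in nhdsin M y. k q = k (chart_pt c (lcoord c y) (tcoord c q))"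
    by (rule leafwise_constD[OF g c])
  show ?thesis
    using kc limitin_eventually_nhdsin[OF transverse_germ_limits(3)[OF g'] kc] transverse_germ_section[OF g' c]
    by eventually_elim simp
qed

end

section \<open>Continuation of germs over the holonomy covering\<close>

locale holonomy_cover = matchbox_atlas M X A
  for M :: "'m topology" and X :: "'x topology" and A :: "('m, 'n::finite, 'x) fchart set" +
  fixes \<nu> :: nat and \<phi> :: "nat \<Rightarrow> ('m, 'n, 'x) fchart" and x :: 'm and E :: "'e topology" and e :: 'e
    and p :: "'e \<Rightarrow> 'm" and i\<^sub>0 :: nat
  assumes charts: "i \<in> {1..\<nu>} \<Longrightarrow> \<phi> i \<in> A"
    and i\<^sub>0: "i\<^sub>0 \<in> {1..\<nu>}" "x \<in> fc_dom (\<phi> i\<^sub>0)"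
    and cover: "holonomy_covering M X A \<nu> \<phi> x E e p"
begin

abbreviation "c\<^sub>0 \<equiv> \<phi> i\<^sub>0"
abbreviation "w\<^sub>0 \<equiv> tcoord (\<phi> i\<^sub>0) x"

lemma c\<^sub>0: "c\<^sub>0 \<in> A" "x \<in> fc_dom c\<^sub>0"
  using charts i\<^sub>0 by auto

lemma x_topspace: "x \<in> topspace M"
  using dom_topspace c\<^sub>0 by blast

lemma p_leaf: "continuous_map E (leaf_topology M A x) p"
  using cover by (auto simp: holonomy_covering_def covering_projection_def)

lemma p_fine: "continuous_map E (fine_topology M A) p"
  using p_leaf by (auto simp: leaf_topology_def continuous_map_in_subtopology)

lemma p_cont: "continuous_map E M p"
  using continuous_map_compose[OF p_fine continuous_map_fine_id] by (simp add: o_def)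

lemma e: "e \<in> topspace E" "p e = x"
  using cover by (auto simp: holonomy_covering_def)

text \<open>Continuation, in the sense of analytic continuation, of the germ
  \<open>tcoord c\<^sub>0\<close> along the projection of a path of \<open>E\<close>. The path lives
  upstairs because loops of \<open>E\<close> at \<open>e\<close> project to loops with trivial
  holonomy.\<close>

definition reach :: "'e \<Rightarrow> ('m \<Rightarrow> 'x) \<Rightarrow> bool" where
  "reach e' k \<longleftrightarrow> (\<exists>\<delta> \<Sigma>. pathin E \<delta> \<and> \<delta> 0 = e \<and> \<delta> 1 = e' \<and> flat_along (p \<circ> \<delta>) \<Sigma> 0 1 \<and>
     \<Sigma> 0 = tcoord c\<^sub>0 \<and> \<Sigma> 1 = k)"

text \<open>The inverse transversal \<open>G\<close> is carried along because
  \<open>reach_unique\<close> needs it to express one continuation through another.\<close>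

definition reach_germ :: "'e \<Rightarrow> ('m \<Rightarrow> 'x) \<Rightarrow> bool" where
  "reach_germ e' k \<longleftrightarrow> reach e' k \<and> (\<exists>G. transverse_germ w\<^sub>0 k G (p e'))"

lemma flat_along_const:
  assumes "continuous_map (top_of_set {a..b}) M \<gamma>" "\<And>t. t \<in> {a..b} \<Longrightarrow> leafwise_const k (\<gamma> t)"
  shows "flat_along \<gamma> (\<lambda>_. k) a b"
  using assms by (auto simp: flat_along_def intro: exI[of _ 1])

lemma reach_base: "reach e (tcoord c\<^sub>0)"
proof -
  have "flat_along (p \<circ> (\<lambda>_. e)) (\<lambda>_. tcoord c\<^sub>0) 0 1"
    by (rule flat_along_const) (use x_topspace e leafwise_const_trans[OF c\<^sub>0, of "\<lambda>z. z"] in auto)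
  then show ?thesis unfolding reach_def using e by (intro exI[of _ "\<lambda>_. e"] exI[of _ "\<lambda>_. tcoord c\<^sub>0"]) simp
qed

text \<open>Two flat sections along paths with the same end point fit together, after a change of the
  transverse parameter, to a flat section along a loop in the kernel of the holonomy; so that
  change of parameter is trivial.\<close>

lemma reach_unique:
  assumes rg: "reach_germ e' k" and rg': "reach_germ e' k'"
  shows "\<forall>\<^sub>F q in nhdsin M (p e'). k q = k' q"
proof -
  obtain G where r: "reach e' k" and g: "transverse_germ w\<^sub>0 k G (p e')"
    using rg by (auto simp: reach_germ_def)
  obtain G' where r': "reach e' k'" and g': "transverse_germ w\<^sub>0 k' G' (p e')"
    using rg' by (auto simp: reach_germ_def)
  obtain \<delta> \<Sigma> where d: "pathin E \<delta>" "\<delta> 0 = e" "\<delta> 1 = e'" and s: "flat_along (p \<circ> \<delta>) \<Sigma> 0 1"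
    "\<Sigma> 0 = tcoord c\<^sub>0" "\<Sigma> 1 = k" using r unfolding reach_def by blast
  obtain \<delta>' \<Sigma>' where d': "pathin E \<delta>'" "\<delta>' 0 = e" "\<delta>' 1 = e'" and s': "flat_along (p \<circ> \<delta>') \<Sigma>' 0 1"
    "\<Sigma>' 0 = tcoord c\<^sub>0" "\<Sigma>' 1 = k'" using r' unfolding reach_def by blast
  \<comment> \<open>The change of parameter between the two germs at \<open>p e'\<close>; it has to
    be shown to be the identity near \<open>w\<^sub>0\<close>.\<close>
  define \<theta> where "\<theta> s = k (G' s)" for s
  have kk': "\<forall>\<^sub>F q in nhdsin M (p e'). k q = \<theta> (k' q)"
    unfolding \<theta>_def by (rule transverse_germ_factor[OF _ g']) (use g in \<open>simp add: transverse_germ_def\<close>)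
  define lp where "lp = concat_path \<delta> (\<lambda>t. \<delta>' (1 - t))"
  \<comment> \<open>Out along \<open>\<delta>\<close> with \<open>\<Sigma>\<close>, back along
    \<open>\<delta>'\<close> with \<open>\<theta>\<close> applied to \<open>\<Sigma>'\<close>: the
    correction makes the germs match at the turning point, and the section arrives at
    \<open>x\<close> as \<open>\<theta>\<close> composed with the initial germ.\<close>
  define S where "S = concat_path \<Sigma> (\<lambda>t q. \<theta> (\<Sigma>' (1 - t) q))"
  have pl: "pathin E lp" unfolding lp_def
    by (rule pathin_concat_path[OF d(1) pathin_reverse[OF d'(1)]]) (use d d' in simp)
  have loopE: "loop_at E e lp" using pl d d' by (simp add: loop_at_def lp_def)
  have loopL: "loop_at (leaf_topology M A x) x (p \<circ> lp)"
    using continuous_map_compose[OF pl[unfolded pathin_def] p_leaf] d d' e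
    by (simp add: loop_at_def pathin_def lp_def)
  have "homotopic_loops_at (leaf_topology M A x) x (p \<circ> lp) (p \<circ> lp)"
    using loopL by (simp add: homotopic_loops_at_def loop_at_def pathin_def)
  then have "in_holonomy_kernel X \<nu> \<phi> x (p \<circ> lp)"
    using cover loopE loopL unfolding holonomy_covering_def by blast
  then obtain i h W where i: "i \<in> {1..\<nu>}" "x \<in> fc_dom (\<phi> i)" and h: "holonomy \<nu> \<phi> (p \<circ> lp) 0 1 i i h"
    and W: "openin (subtopology X (fc_mod (\<phi> i))) W" "tcoord (\<phi> i) x \<in> W" "\<And>w. w \<in> W \<Longrightarrow> h w = w"
    unfolding in_holonomy_kernel_def by blast
  have ci: "\<phi> i \<in> A" using charts i by blast
  have Wo: "openin X W" using W(1) mod_open[OF ci] openin_trans_full by blast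
  have flat: "flat_along (p \<circ> lp) S 0 1"
    unfolding lp_def S_def comp_concat_path
  proof (rule flat_along_concat[OF s(1)])
    show "flat_along (p \<circ> (\<lambda>t. \<delta>' (1 - t))) (\<lambda>t q. \<theta> (\<Sigma>' (1 - t) q)) 0 1"
      using flat_along_comp[OF flat_along_reverse[OF s'(1)], of \<theta>] by (simp add: o_def)
    show "\<forall>\<^sub>F q in nhdsin M ((p \<circ> \<delta>) 1). \<theta> (\<Sigma>' (1 - 0) q) = \<Sigma> 1 q"
      using kk' d s s' by (simp add: eq_commute)
  qed (use d d' in simp)
  \<comment> \<open>Kernel membership is witnessed in some chart \<open>i\<close>, possibly other
    than \<open>i\<^sub>0\<close>; \<open>f\<close> expresses the final germ through the coordinate
    of that chart.\<close>
  define f where "f \<omega> = \<theta> (tcoord c\<^sub>0 (chart_pt (\<phi> i) (lcoord (\<phi> i) x) \<omega>))" for \<omega>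
  have ev_f: "\<forall>\<^sub>F q in nhdsin M x. \<theta> (tcoord c\<^sub>0 q) = f (tcoord (\<phi> i) q)"
    using tcoord_slide[OF ci i(2) c\<^sub>0] by eventually_elim (simp add: f_def)
  have end0: "(p \<circ> lp) 0 = x" and end1: "(p \<circ> lp) 1 = x" using loopL by (auto simp: loop_at_def)
  have S0: "S 0 = tcoord c\<^sub>0" and S1: "S 1 = (\<lambda>q. \<theta> (tcoord c\<^sub>0 q))"
    using s s' by (simp_all add: S_def)
  have "\<forall>\<^sub>F q in nhdsin M ((p \<circ> lp) 0). S 0 q = f (h (tcoord (\<phi> i) q))"
    by (rule holonomy_flat[OF h charts flat]) (use ev_f end1 S1 in simp_all)
  then have "\<forall>\<^sub>F q in nhdsin M x. tcoord c\<^sub>0 q = f (h (tcoord (\<phi> i) q))"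
    using end0 S0 by simp
  moreover have "\<forall>\<^sub>F q in nhdsin M x. tcoord (\<phi> i) q \<in> W"
    using limitin_tcoord[OF ci i(2)] Wo W(2) by (simp add: limitin_def)
  ultimately have "\<forall>\<^sub>F q in nhdsin M x. tcoord c\<^sub>0 q = \<theta> (tcoord c\<^sub>0 q)"
    using ev_f by eventually_elim (simp add: W(3))
  then have id: "\<forall>\<^sub>F s in nhdsin X w\<^sub>0. s = \<theta> s"
    using eventually_tcoord[OF c\<^sub>0, of "\<lambda>s. s = \<theta> s"] by simp
  show ?thesis using limitin_eventually_nhdsin[OF transverse_germ_limits(1)[OF g'] id] kk'
    by eventually_elim simp
qed

text \<open>A sheet over a small piece of the plaque of \<open>p e0\<close> is path connected, by
  lifts of straight segments in the chart. A germ present at one point \<open>e1\<close> is slid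
  along the plaque (\<open>transverse_germ_slide\<close>), and the resulting function
  \<open>k'\<close> serves all points of the sheet at once.\<close>

lemma reach_local:
  assumes "e0 \<in> topspace E"
  shows "\<exists>U. openin E U \<and> e0 \<in> U \<and> 
    ((\<exists>e1\<in>U. \<exists>k1. reach_germ e1 k1) \<longrightarrow> (\<exists>k'. \<forall>e2\<in>U. reach_germ e2 k'))"
proof -
  let ?L = "leaf_topology M A x"
  have "p e0 \<in> topspace ?L" using p_leaf assms by (auto simp: continuous_map_def)
  then obtain U V where U: "openin ?L U" "p e0 \<in> U" and V: "openin E V" "e0 \<in> V"
    and hom: "homeomorphic_map (subtopology E V) (subtopology ?L U) p"
    using cover assms unfolding holonomy_covering_def covering_projection_def
    by (smt (verit, ccfv_threshold) UnionE mem_Collect_eq)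
  have pM: "p e0 \<in> topspace M" using p_cont assms by (auto simp: continuous_map_def)
  then obtain c where c: "c \<in> A" "p e0 \<in> fc_dom c" using covered by blast
  define w where "w = tcoord c (p e0)"
  have w: "w \<in> fc_mod c" using dom_coords[OF c] by (simp add: w_def)
  obtain U' where U': "openin (fine_topology M A) U'" "U = U' \<inter> leaf M A x"
    using U(1) by (auto simp: leaf_topology_def openin_subtopology)
  have "openin (top_of_set (ocube 1)) {v \<in> topspace (top_of_set (ocube 1)). chart_pt c v w \<in> U'}"
    by (rule openin_continuous_map_preimage[OF fine_slice_cont[OF c(1) w] U'(1)])
  then have "open {v \<in> ocube 1. chart_pt c v w \<in> U'}" by (intro openin_open_trans[OF _ open_ocube]) simp
  moreover have "lcoord c (p e0) \<in> {v \<in> ocube 1. chart_pt c v w \<in> U'}"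
    using U(2) U'(2) dom_coords[OF c] by (simp add: w_def)
  ultimately obtain r where r: "r > 0" "ball (lcoord c (p e0)) r \<subseteq> {v \<in> ocube 1. chart_pt c v w \<in> U'}"
    using open_contains_ball by blast
  define B where "B = ball (lcoord c (p e0)) r"
  have Bo: "open B" "B \<subseteq> ocube 1" "convex B" "lcoord c (p e0) \<in> B" using r by (auto simp: B_def)
  \<comment> \<open>An open piece of a plaque: being connected it stays in the leaf, and by the
    choice of \<open>r\<close> it lies in the evenly covered set \<open>U\<close>.\<close>
  define D where "D = {q \<in> fc_dom c. lcoord c q \<in> B \<and> tcoord c q = w}"
  have D_fine: "openin (fine_topology M A) D" unfolding D_def by (rule fine_open_plaque[OF c(1) Bo(1,2) w])
  have D_eq: "D = (\<lambda>v. chart_pt c v w) ` B"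
  proof
    show "D \<subseteq> (\<lambda>v. chart_pt c v w) ` B"
      using dom_coords(3)[OF c(1)] by (force simp: D_def)
    show "(\<lambda>v. chart_pt c v w) ` B \<subseteq> D" using Bo c w chart_pt_dom by (auto simp: D_def subset_iff)
  qed
  have B_fine: "continuous_map (top_of_set B) (fine_topology M A) (\<lambda>v. chart_pt c v w)"
    by (rule continuous_map_from_subtopology_mono[OF fine_slice_cont[OF c(1) w] Bo(2)])
  have "connectedin (fine_topology M A) D" unfolding D_eq
    by (rule connectedin_continuous_map_image[OF B_fine]) (use Bo in \<open>simp add: connectedin_subtopology convex_connected\<close>)
  moreover have e0D: "p e0 \<in> D" using c Bo by (simp add: D_def w_def)
  moreover have "p e0 \<in> leaf M A x" using U U' by blast
  ultimately have D_leaf: "D \<subseteq> leaf M A x"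
    unfolding leaf_def by (smt (verit, ccfv_threshold) connected_component_of_equiv connected_component_of_maximal mem_Collect_eq subset_eq)
  have DU: "D \<subseteq> U" using D_leaf r U'(2) unfolding D_eq by (auto simp: B_def)
  have D_open: "openin ?L D" using D_fine D_leaf by (metis inf.absorb1 leaf_topology_def openin_subtopology)
  obtain s where s: "homeomorphic_maps (subtopology E V) (subtopology ?L U) p s"
    using hom by (auto simp: homeomorphic_map_maps)
  have VE: "V \<subseteq> topspace E" using V openin_subset by blast
  define N where "N = {e' \<in> V. p e' \<in> D}"
  have N: "openin E N"
  proof -
    have "openin E {e' \<in> topspace E. p e' \<in> D}" by (rule openin_continuous_map_preimage[OF p_leaf D_open])
    then have "openin E (V \<inter> {e' \<in> topspace E. p e' \<in> D})" using V by blast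
    moreover have "V \<inter> {e' \<in> topspace E. p e' \<in> D} = N" using VE by (auto simp: N_def)
    ultimately show ?thesis by simp
  qed
  have UL: "U \<subseteq> topspace ?L" using U openin_subset by blast
  have sU: "continuous_map (subtopology ?L U) E s" using s by (auto simp: homeomorphic_maps_def continuous_map_in_subtopology)
  have ps: "p (s q) = q" if "q \<in> U" for q using s that UL by (auto simp: homeomorphic_maps_def)
  have sp: "s (p e') = e'" if "e' \<in> V" for e' using s that VE by (auto simp: homeomorphic_maps_def)
  have main: "reach e2 k' \<and> (\<exists>G2. transverse_germ w\<^sub>0 k' G2 (p e2))"
    if e1: "e1 \<in> N" and r1: "reach e1 k1" and g1: "transverse_germ w\<^sub>0 k1 G1 (p e1)" and e2: "e2 \<in> N"
      and k': "k' = (\<lambda>q. k1 (chart_pt c (lcoord c (p e1)) (tcoord c q)))" for e1 e2 k1 G1 k'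
  proof
    have d1: "p e1 \<in> fc_dom c" "tcoord c (p e1) = w" and b1: "lcoord c (p e1) \<in> B" using e1 by (auto simp: N_def D_def)
    have d2: "p e2 \<in> fc_dom c" "tcoord c (p e2) = w" and b2: "lcoord c (p e2) \<in> B" using e2 by (auto simp: N_def D_def)
    show "\<exists>G2. transverse_germ w\<^sub>0 k' G2 (p e2)"
      using transverse_germ_slide[OF g1 c(1) d1(1) d2(1)] d1 d2 unfolding k' by auto
    \<comment> \<open>A straight segment in the convex coordinate ball; \<open>\<delta>2\<close> is
      its lift by the local inverse \<open>s\<close> of \<open>p\<close>.\<close>
    define v where "v t = (1 - t) *\<^sub>R lcoord c (p e1) + t *\<^sub>R lcoord c (p e2)" for t
    have vB: "v t \<in> B" if "t \<in> {0..1}" for t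
      using convexD_alt[OF Bo(3) b1 b2] that by (simp add: v_def)
    define \<delta>2 where "\<delta>2 t = s (chart_pt c (v t) w)" for t
    have "continuous_map (top_of_set {0..1}) (top_of_set B) v"
      using vB by (auto simp: continuous_map_in_subtopology v_def intro!: continuous_intros)
    from continuous_map_compose[OF this B_fine]
    have "continuous_map (top_of_set {0..1}) (fine_topology M A) (\<lambda>t. chart_pt c (v t) w)" by (simp add: o_def)
    moreover have vD: "chart_pt c (v t) w \<in> D" if "t \<in> {0..1}" for t using vB[OF that] D_eq by blast
    ultimately have "continuous_map (top_of_set {0..1}) (subtopology ?L U) (\<lambda>t. chart_pt c (v t) w)"
      using D_leaf DU by (auto simp: leaf_topology_def continuous_map_in_subtopology)
    from continuous_map_compose[OF this sU] have \<delta>2: "pathin E \<delta>2" by (simp add: o_def pathin_def \<delta>2_def[abs_def])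
    have ends: "\<delta>2 0 = e1" "\<delta>2 1 = e2"
      using sp e1 e2 dom_coords(3)[OF c(1) d1(1)] dom_coords(3)[OF c(1) d2(1)] d1 d2
      by (auto simp: \<delta>2_def v_def N_def)
    have p\<delta>2: "p (\<delta>2 t) = chart_pt c (v t) w" if "t \<in> {0..1}" for t
      unfolding \<delta>2_def using ps vD[OF that] DU by blast
    have flat2: "flat_along (p \<circ> \<delta>2) (\<lambda>_. k') 0 1"
    proof (rule flat_along_const)
      show "continuous_map (top_of_set {0..1}) M (p \<circ> \<delta>2)"
        by (rule continuous_map_compose[OF \<delta>2[unfolded pathin_def] p_cont])
      fix t :: real assume t: "t \<in> {0..1}"
      have "(p \<circ> \<delta>2) t \<in> fc_dom c" using vD[OF t] p\<delta>2[OF t] by (simp add: D_def)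
      then show "leafwise_const k' ((p \<circ> \<delta>2) t)" unfolding k'
        using leafwise_const_trans[OF c(1), of _ "\<lambda>s. k1 (chart_pt c (lcoord c (p e1)) s)"] by blast
    qed
    obtain \<delta>1 \<Sigma>1 where 1: "pathin E \<delta>1" "\<delta>1 0 = e" "\<delta>1 1 = e1" "flat_along (p \<circ> \<delta>1) \<Sigma>1 0 1"
      "\<Sigma>1 0 = tcoord c\<^sub>0" "\<Sigma>1 1 = k1" using r1 unfolding reach_def by blast
    have lc: "leafwise_const k1 (p e1)" using g1 by (simp add: transverse_germ_def)
    have "\<forall>\<^sub>F q in nhdsin M (p e1). k' q = k1 q"
      using leafwise_constD[OF lc c(1) d1(1)] unfolding k' by eventually_elim simp
    then have "flat_along (concat_path (p \<circ> \<delta>1) (p \<circ> \<delta>2)) (concat_path \<Sigma>1 (\<lambda>_. k')) 0 1"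
      by (intro flat_along_concat[OF 1(4) flat2]) (simp_all add: 1 ends)
    then show "reach e2 k'" unfolding reach_def
      by (intro exI[of _ "concat_path \<delta>1 \<delta>2"] exI[of _ "concat_path \<Sigma>1 (\<lambda>_. k')"])
        (simp add: comp_concat_path 1 ends pathin_concat_path \<delta>2)
  qed
  have "e0 \<in> N" using V e0D by (simp add: N_def)
  moreover have "\<exists>k'. \<forall>e2\<in>N. reach_germ e2 k'" if e1: "e1 \<in> N" "reach_germ e1 k1" for e1 k1
  proof -
    obtain G1 where "reach e1 k1" "transverse_germ w\<^sub>0 k1 G1 (p e1)" using e1 by (auto simp: reach_germ_def)
    from main[OF e1(1) this _ refl] show ?thesis unfolding reach_germ_def by blast
  qed
  ultimately show ?thesis using N by (intro exI[of _ N]) (simp, blast)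
qed

text \<open>\<open>reach_local\<close> is a dichotomy: around any point of \<open>E\<close> there is
  a neighbourhood on which either all points or none are reached. So the set of reached points is
  clopen in the connected space \<open>E\<close>.\<close>

lemma reach_all:
  assumes "e' \<in> topspace E"
  shows "\<exists>k. reach_germ e' k"
proof -
  define R where "R = {e' \<in> topspace E. \<exists>k. reach_germ e' k}"
  have loc: "\<exists>U. openin E U \<and> a \<in> U \<and> (U \<subseteq> R \<or> U \<inter> R = {})" if a: "a \<in> topspace E" for a
  proof -
    obtain U where U: "openin E U" "a \<in> U" "(\<exists>e1\<in>U. \<exists>k1. reach_germ e1 k1) \<longrightarrow> (\<exists>k'. \<forall>e2\<in>U. reach_germ e2 k')"
      using reach_local[OF a] by (elim exE conjE) (rule that)
    have "U \<subseteq> R" if ne: "U \<inter> R \<noteq> {}"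
    proof -
      obtain k' where "\<forall>e2\<in>U. reach_germ e2 k'" using ne U(3) by (auto simp: R_def)
      then show ?thesis unfolding R_def using openin_subset[OF U(1)] by blast
    qed
    then show ?thesis using U by blast
  qed
  have "openin E R"
    by (subst openin_subopen) (use loc in \<open>fastforce simp: R_def\<close>)
  moreover have "openin E (topspace E - R)"
  proof (subst openin_subopen, safe)
    fix a assume a: "a \<in> topspace E" "a \<notin> R"
    obtain U where U: "openin E U" "a \<in> U" "U \<subseteq> R \<or> U \<inter> R = {}" using loc[OF a(1)] by blast
    then show "\<exists>T. openin E T \<and> a \<in> T \<and> T \<subseteq> topspace E - R" using a openin_subset[OF U(1)] by blast
  qed
  moreover have "connected_space E"
    using cover path_connected_imp_connected_space unfolding holonomy_covering_def by blast
  moreover have "e \<in> R" using reach_base transverse_germ_chart[OF c\<^sub>0] e by (auto simp: R_def reach_germ_def)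
  moreover have "R \<subseteq> topspace E" by (auto simp: R_def)
  ultimately have "R = topspace E"
    unfolding connected_space_clopen_in closedin_def by blast
  then show ?thesis using assms unfolding R_def by blast
qed

end

section \<open>Gluing germs along a compact set\<close>

lemma regular_space_nbhd:
  assumes "regular_space Z" "openin Z U" "y \<in> U"
  obtains V W where "openin Z V" "openin Z W" "y \<in> V" "disjnt V W" "topspace Z - U \<subseteq> W"
proof -
  have "closedin Z (topspace Z - U)" "y \<in> topspace Z - (topspace Z - U)"
    using assms openin_subset by (auto simp: closedin_diff)
  then show ?thesis using assms(1) that unfolding regular_space_def by blast
qed

text \<open>A section of the sheaf of germs of functions over a compact set extends to a neighbourhood.\<close>

lemma germs_glue:
  assumes reg: "regular_space Z" and K: "compactin Z K"
    and loc: "\<And>y. y \<in> K \<Longrightarrow> \<exists>U k. openin Z U \<and> y \<in> U \<and> (\<forall>y'\<in>K \<inter> U. \<forall>\<^sub>F q in nhdsin Z y'. \<kappa> y' q = k q)"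
  shows "\<exists>k. \<forall>y\<in>K. \<forall>\<^sub>F q in nhdsin Z y. \<kappa> y q = k q"
proof -
  have "\<forall>y\<in>K. \<exists>U k V W. openin Z U \<and> y \<in> U \<and> (\<forall>y'\<in>K \<inter> U. \<forall>\<^sub>F q in nhdsin Z y'. \<kappa> y' q = k q) \<and>
    openin Z V \<and> openin Z W \<and> y \<in> V \<and> disjnt V W \<and> topspace Z - U \<subseteq> W"
  proof
    fix y assume "y \<in> K"
    then obtain U k where U: "openin Z U" "y \<in> U" "\<forall>y'\<in>K \<inter> U. \<forall>\<^sub>F q in nhdsin Z y'. \<kappa> y' q = k q"
      using loc by blast
    obtain V W where "openin Z V" "openin Z W" "y \<in> V" "disjnt V W" "topspace Z - U \<subseteq> W"
      by (rule regular_space_nbhd[OF reg U(1,2)]) (rule that)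
    with U show "\<exists>U k V W. openin Z U \<and> y \<in> U \<and> (\<forall>y'\<in>K \<inter> U. \<forall>\<^sub>F q in nhdsin Z y'. \<kappa> y' q = k q) \<and>
    openin Z V \<and> openin Z W \<and> y \<in> V \<and> disjnt V W \<and> topspace Z - U \<subseteq> W" by blast
  qed
  then obtain U k V W where UV: "\<forall>y\<in>K. openin Z (U y) \<and> y \<in> U y \<and>
    (\<forall>y'\<in>K \<inter> U y. \<forall>\<^sub>F q in nhdsin Z y'. \<kappa> y' q = k y q) \<and>
    openin Z (V y) \<and> openin Z (W y) \<and> y \<in> V y \<and> disjnt (V y) (W y) \<and> topspace Z - U y \<subseteq> W y"
    by (subst (asm) bchoice_iff, elim exE, subst (asm) bchoice_iff, elim exE, subst (asm) bchoice_iff, elim exE,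
        subst (asm) bchoice_iff, elim exE) (rule that)
  have "\<exists>\<F>. finite \<F> \<and> \<F> \<subseteq> V ` K \<and> K \<subseteq> \<Union>\<F>"
    using K UV unfolding compactin_def by (metis (no_types, lifting) UN_I imageE subsetI)
  then obtain J where J: "finite J" "J \<subseteq> K" "K \<subseteq> (\<Union>j\<in>J. V j)" by (metis finite_subset_image)
  \<comment> \<open>For \<open>q\<close> an arbitrary member of the finite cover containing it is
    chosen. Near \<open>y\<close> only indices \<open>i\<close> with \<open>y \<in> U i\<close> can
    occur: for the others \<open>W i\<close> is a neighbourhood of \<open>y\<close> disjoint from
    \<open>V i\<close>.\<close>
  define j where "j q = (SOME j. j \<in> J \<and> q \<in> V j)" for q
  define k' where "k' q = k (j q) q" for q
  have "\<forall>\<^sub>F q in nhdsin Z y. \<kappa> y q = k' q" if y: "y \<in> K" for y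
  proof -
    have yZ: "y \<in> topspace Z" using K y by (auto simp: compactin_def)
    have "\<forall>i\<in>J. \<forall>\<^sub>F q in nhdsin Z y. q \<in> V i \<longrightarrow> \<kappa> y q = k i q"
    proof
      fix i assume i: "i \<in> J"
      then have iK: "i \<in> K" using J by blast
      show "\<forall>\<^sub>F q in nhdsin Z y. q \<in> V i \<longrightarrow> \<kappa> y q = k i q"
      proof (cases "y \<in> U i")
        case True
        then have "\<forall>\<^sub>F q in nhdsin Z y. \<kappa> y q = k i q" using UV iK y by blast
        then show ?thesis by eventually_elim simp
      next
        case False
        then have "openin Z (W i)" "y \<in> W i" "disjnt (V i) (W i)" using UV iK yZ by auto
        then show ?thesis by (intro eventually_nhdsinI[of Z "W i"]) (auto simp: disjnt_iff)
      qed
    qed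
    then have "\<forall>\<^sub>F q in nhdsin Z y. \<forall>i\<in>J. q \<in> V i \<longrightarrow> \<kappa> y q = k i q"
      using J(1) by (simp add: eventually_ball_finite)
    moreover obtain i where i: "i \<in> J" "y \<in> V i" using J y by blast
    have "\<forall>\<^sub>F q in nhdsin Z y. q \<in> V i"
      by (rule eventually_nhdsinI[of Z "V i"]) (use UV J i in auto)
    ultimately show ?thesis
    proof eventually_elim
      case (elim q)
      with i have "j q \<in> J \<and> q \<in> V (j q)" unfolding j_def by (metis (mono_tags, lifting) someI_ex)
      then show ?case using elim by (simp add: k'_def)
    qed
  qed
  then show ?thesis by blast
qed

context holonomy_cover
begin

text \<open>Injectivity of \<open>p\<close> on \<open>K'\<close> lets every point of the image
  inherit the germ at its unique lift. Compactness of \<open>K'\<close> makes these germs locally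
  coherent: the image of \<open>K' - U\<close> is closed, so points of the image near
  \<open>y\<close> have their lifts in \<open>U\<close>.\<close>

lemma transverse_projection_exists:
  assumes K': "compactin E K'" and inj: "inj_on p K'"
  shows "\<exists>k. \<forall>y\<in>p ` K'. \<exists>G. transverse_germ w\<^sub>0 k G y"
proof -
  have K'E: "K' \<subseteq> topspace E" using K' by (simp add: compactin_def)
  have "\<forall>e'\<in>topspace E. \<exists>k. reach_germ e' k" using reach_all by blast
  then obtain \<kappa> where \<kappa>: "\<And>e'. e' \<in> topspace E \<Longrightarrow> reach_germ e' (\<kappa> e')"
    by (subst (asm) bchoice_iff) blast
  define lft where "lft y = the_inv_into K' p y" for y
  have lft: "lft (p e') = e'" if "e' \<in> K'" for e' using inj that by (simp add: lft_def the_inv_into_f_f)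
  have KM: "compactin M (p ` K')" using image_compactin[OF K' p_cont] .
  have "\<exists>k. \<forall>y\<in>p ` K'. \<forall>\<^sub>F q in nhdsin M y. \<kappa> (lft y) q = k q"
  proof (rule germs_glue[OF _ KM])
    show "regular_space M" using metrM metrizable_imp_regular_space by blast
    fix y assume "y \<in> p ` K'"
    then obtain e0 where e0: "e0 \<in> K'" "y = p e0" by blast
    then have e0E: "e0 \<in> topspace E" using K'E by blast
    obtain U where U: "openin E U" "e0 \<in> U" "(\<exists>e1\<in>U. \<exists>k1. reach_germ e1 k1) \<longrightarrow> (\<exists>k'. \<forall>e2\<in>U. reach_germ e2 k')"
      using reach_local[OF e0E] by (elim exE conjE) (rule that)
    obtain k' where k': "\<forall>e2\<in>U. reach_germ e2 k'" using U(3) U(2) \<kappa>[OF e0E] by blast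
    have "compactin E (K' - U)"
    proof -
      have "K' - U = K' \<inter> (topspace E - U)" using K'E by blast
      then show ?thesis using compact_Int_closedin[OF K', of "topspace E - U"] U(1) by (simp add: closedin_diff)
    qed
    then have "closedin M (p ` (K' - U))" using image_compactin[OF _ p_cont] compactin_imp_closedin hausM by blast
    then have O: "openin M (topspace M - p ` (K' - U))" by blast
    have yO: "y \<in> topspace M - p ` (K' - U)"
      using e0 KM U(2) inj by (auto simp: compactin_def dest: inj_onD)
    have "\<forall>\<^sub>F q in nhdsin M y'. \<kappa> (lft y') q = k' q" if y': "y' \<in> p ` K' \<inter> (topspace M - p ` (K' - U))" for y'
    proof -
      obtain e2 where e2: "e2 \<in> K'" "y' = p e2" "e2 \<in> U" using y' by blast
      have "e2 \<in> topspace E" using e2 K'E by blast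
      then have "\<forall>\<^sub>F q in nhdsin M (p e2). \<kappa> e2 q = k' q" using reach_unique[of e2 "\<kappa> e2" k'] \<kappa> e2 k' by blast
      then show ?thesis using e2 lft by simp
    qed
    then show "\<exists>U k. openin M U \<and> y \<in> U \<and> (\<forall>y'\<in>p ` K' \<inter> U. \<forall>\<^sub>F q in nhdsin M y'. \<kappa> (lft y') q = k q)"
      using O yO by (intro exI[of _ "topspace M - p ` (K' - U)"] exI[of _ k']) blast
  qed
  then obtain k where k: "\<And>y. y \<in> p ` K' \<Longrightarrow> \<forall>\<^sub>F q in nhdsin M y. \<kappa> (lft y) q = k q" by blast
  show ?thesis
  proof (intro exI[of _ k] ballI)
    fix y assume "y \<in> p ` K'"
    then obtain e' where e': "e' \<in> K'" "y = p e'" by blast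
    obtain G where g: "transverse_germ w\<^sub>0 (\<kappa> e') G (p e')" using \<kappa>[of e'] e' K'E by (auto simp: reach_germ_def)
    have ev: "\<forall>\<^sub>F q in nhdsin M (p e'). \<kappa> e' q = k q" using k[of "p e'"] e' lft by simp
    from transverse_germ_cong[OF g ev] show "\<exists>G. transverse_germ w\<^sub>0 k G y" using e' by blast
  qed
qed

end

section \<open>Strict differentiability of the leafwise transition maps\<close>

lemma linear_sum_axis:
  fixes f :: "real ^ 'n::finite \<Rightarrow> 'b::real_vector"
  assumes "linear f"
  shows "f u = (\<Sum>i\<in>UNIV. u $ i *\<^sub>R f (axis i 1))"
proof -
  have "f u = f (\<Sum>i\<in>UNIV. u $ i *\<^sub>R axis i 1)"
    by (simp add: basis_expansion flip: scalar_mult_eq_scaleR)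
  then show ?thesis by (simp add: linear_sum[OF assms] linear_cmul[OF assms])
qed

lemma onorm_le_axis:
  fixes f :: "real ^ 'n::finite \<Rightarrow> 'b::real_normed_vector"
  assumes "linear f" "\<And>i. norm (f (axis i 1)) \<le> \<eta>"
  shows "onorm f \<le> real CARD('n) * \<eta>"
proof (rule onorm_le)
  fix u :: "real ^ 'n"
  have "norm (f u) \<le> (\<Sum>i\<in>UNIV. norm (u $ i *\<^sub>R f (axis i 1)))"
    unfolding linear_sum_axis[OF assms(1), of u] by (rule norm_sum)
  also have "\<dots> \<le> (\<Sum>i\<in>(UNIV :: 'n set). norm u * \<eta>)"
    by (rule sum_mono) (simp add: mult_mono assms(2) component_le_norm_cart)
  finally show "norm (f u) \<le> real CARD('n) * \<eta> * norm u" by (simp add: algebra_simps)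
qed

text \<open>The mean value inequality for \<open>F w' - A\<close> on a ball. The derivative is small
  there: the first partials of \<open>F w'\<close> are uniformly close to those of
  \<open>F w\<close> by smooth dependence on the parameter, and those of \<open>F w\<close> are
  continuous at \<open>v0\<close>. One linear map \<open>A\<close> thus serves all nearby
  parameters.\<close>

lemma smooth_family_strict:
  fixes F :: "'x \<Rightarrow> real ^ 'n::finite \<Rightarrow> 'b::real_normed_vector"
  assumes sf: "smooth_family T D F" and w: "w \<in> topspace T" and r0: "r0 > 0" "cball v0 r0 \<subseteq> D w"
  obtains A where "bounded_linear A"
    "\<And>\<epsilon>. \<epsilon> > 0 \<Longrightarrow> \<exists>r>0. \<exists>W. openin T W \<and> w \<in> W \<and> (\<forall>w'\<in>W. \<forall>v\<in>ball v0 r. \<forall>v'\<in>ball v0 r.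
       norm (F w' v - F w' v' - A (v - v')) \<le> \<epsilon> * norm (v - v'))"
proof -
  have smo: "smooth_on (D w') (F w')" if "w' \<in> topspace T" for w' using sf that by (simp add: smooth_family_def)
  define A where "A = frechet_derivative (F w) (at v0)"
  have v0: "v0 \<in> D w" using r0 by auto
  have dif: "F w' differentiable (at v)" if "w' \<in> topspace T" "v \<in> D w'" for w' v
  proof -
    have "iter_partial [] (F w') differentiable (at v)" using smo[OF that(1)] that(2) unfolding smooth_on_def by blast
    then show ?thesis by simp
  qed
  have linA: "bounded_linear A" unfolding A_def
    using dif[OF w v0] frechet_derivative_works has_derivative_bounded_linear by blast
  show ?thesis
  proof (rule that[OF linA])
    fix \<epsilon> :: real assume "\<epsilon> > 0"
    \<comment> \<open>Each partial derivative contributes two errors below \<open>\<eta>\<close>,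
      one from the parameter and one from the point; \<open>onorm_le_axis\<close> multiplies by the
      number of axes, which gives \<open>\<epsilon>\<close>.\<close>
    define \<eta> where "\<eta> = \<epsilon> / (2 * real CARD('n))"
    have \<eta>: "\<eta> > 0" using \<open>\<epsilon> > 0\<close> by (simp add: \<eta>_def)
    let ?P = "\<lambda>i w' v. iter_partial [i] (F w') v"
    have "\<forall>i. \<exists>\<delta>>0. \<forall>v. dist v v0 < \<delta> \<longrightarrow> dist (?P i w v) (?P i w v0) < \<eta>"
    proof
      fix i
      have "?P i w differentiable (at v0)" using smo[OF w] v0 unfolding smooth_on_def by blast
      then have "continuous (at v0) (?P i w)" by (rule differentiable_imp_continuous_within)
      then show "\<exists>\<delta>>0. \<forall>v. dist v v0 < \<delta> \<longrightarrow> dist (?P i w v) (?P i w v0) < \<eta>"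
        using \<eta> unfolding continuous_at_eps_delta by blast
    qed
    then obtain \<delta> where \<delta>: "\<And>i. \<delta> i > 0" "\<And>i v. dist v v0 < \<delta> i \<Longrightarrow> dist (?P i w v) (?P i w v0) < \<eta>" by metis
    define r where "r = min r0 (Min (range \<delta>) / 2)"
    have "Min (range \<delta>) > 0" using \<delta>(1) by (subst Min_gr_iff) auto
    then have r: "r > 0" "r \<le> r0" using r0 by (auto simp: r_def)
    have r\<delta>: "r < \<delta> i" for i
    proof -
      have "Min (range \<delta>) \<le> \<delta> i" by (rule Min_le) auto
      moreover have "r \<le> Min (range \<delta>) / 2" unfolding r_def by (rule min.cobounded2)
      ultimately show ?thesis using \<open>Min (range \<delta>) > 0\<close> by linarith
    qed
    have C: "cball v0 r \<subseteq> D w" using r r0 by auto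
    have "\<forall>i. \<exists>W. openin T W \<and> w \<in> W \<and> (\<forall>w'\<in>W. cball v0 r \<subseteq> D w' \<and>
        (\<forall>v\<in>cball v0 r. norm (?P i w' v - ?P i w v) < \<eta>))"
      using sf w C \<eta> compact_cball unfolding smooth_family_def by blast
    then obtain W where W: "\<And>i. openin T (W i)" "\<And>i. w \<in> W i" "\<And>i w'. w' \<in> W i \<Longrightarrow> cball v0 r \<subseteq> D w'"
      "\<And>i w' v. \<lbrakk>w' \<in> W i; v \<in> cball v0 r\<rbrakk> \<Longrightarrow> norm (?P i w' v - ?P i w v) < \<eta>" by metis
    define W' where "W' = (\<Inter>i. W i)"
    have W'o: "openin T W'" unfolding W'_def by (rule openin_Inter) (use W in auto)
    have "norm (F w' v - F w' v' - A (v - v')) \<le> \<epsilon> * norm (v - v')"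
      if w': "w' \<in> W'" and vv: "v \<in> ball v0 r" "v' \<in> ball v0 r" for w' v v'
    proof -
      have w'T: "w' \<in> topspace T" using w' W'o openin_subset by blast
      define g where "g v = F w' v - A v" for v
      define g' where "g' v u = frechet_derivative (F w') (at v) u - A u" for v u
      have Dw: "u \<in> D w'" if u: "u \<in> ball v0 r" for u
      proof -
        \<comment> \<open>Any index will do: each \<open>W i\<close> guarantees that the closed ball
          lies in \<open>D w'\<close>.\<close>
        have "w' \<in> W undefined" using w' unfolding W'_def by blast
        then show ?thesis using W(3) u ball_subset_cball by blast
      qed
      have der: "(F w' has_derivative frechet_derivative (F w') (at u)) (at u)" if u: "u \<in> ball v0 r" for u
        using dif[OF w'T Dw[OF u]] frechet_derivative_works by blast
      have lin: "bounded_linear (g' u)" if u: "u \<in> ball v0 r" for u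
        unfolding g'_def by (intro bounded_linear_sub has_derivative_bounded_linear[OF der[OF u]] linA)
      have "norm (g v - g v') \<le> \<epsilon> * norm (v - v')"
      proof (rule differentiable_bound[OF convex_ball[of v0 r] _ _ vv])
        fix u assume u: "u \<in> ball v0 r"
        show "(g has_derivative g' u) (at u within ball v0 r)"
          unfolding g_def g'_def
          by (intro has_derivative_diff has_derivative_at_withinI[OF der[OF u]] bounded_linear_imp_has_derivative linA)
        have "norm (g' u (axis i 1)) \<le> 2 * \<eta>" for i
        proof -
          have "w' \<in> W i" using w' unfolding W'_def by blast
          moreover have "u \<in> cball v0 r" using u by auto
          ultimately have 1: "norm (?P i w' u - ?P i w u) < \<eta>" using W(4) by blast
          have 2: "norm (?P i w u - ?P i w v0) < \<eta>"
            using \<delta>(2)[of u i] u r\<delta>[of i] by (simp add: dist_norm norm_minus_commute)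
          have "g' u (axis i 1) = (?P i w' u - ?P i w u) + (?P i w u - ?P i w v0)"
            by (simp add: g'_def A_def)
          then have "norm (g' u (axis i 1)) \<le> norm (?P i w' u - ?P i w u) + norm (?P i w u - ?P i w v0)"
            by (metis norm_triangle_ineq)
          then show ?thesis using 1 2 by linarith
        qed
        then have "onorm (g' u) \<le> real CARD('n) * (2 * \<eta>)"
          by (intro onorm_le_axis bounded_linear.linear[OF lin[OF u]])
        then show "onorm (g' u) \<le> \<epsilon>" by (simp add: \<eta>_def)
      qed
      moreover have "g v - g v' = F w' v - F w' v' - A (v - v')"
        by (simp add: g_def linear_diff[OF bounded_linear.linear[OF linA]])
      ultimately show ?thesis by simp
    qed
    then show "\<exists>r>0. \<exists>W. openin T W \<and> w \<in> W \<and> (\<forall>w'\<in>W. \<forall>v\<in>ball v0 r. \<forall>v'\<in>ball v0 r.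
       norm (F w' v - F w' v' - A (v - v')) \<le> \<epsilon> * norm (v - v'))"
      using r W'o W(2) by (intro exI[of _ r] conjI exI[of _ W']) (auto simp: W'_def)
  qed
qed

text \<open>The function is constant on whole \<open>\<rho>\<close>-neighbourhoods of
  \<open>F\<close> and of \<open>G\<close>, since the values 1 and 0 are needed as germs and not
  only at the points of the two sets.\<close>

lemma lipschitz_cutoff:
  fixes F G :: "('a::heine_borel) set"
  assumes "compact F" "compact G" "F \<inter> G = {}"
  obtains \<beta> :: "'a \<Rightarrow> real" and L \<rho> where "L \<ge> 0" "\<rho> > 0" "\<And>v. 0 \<le> \<beta> v \<and> \<beta> v \<le> 1"
    "\<And>v v'. \<bar>\<beta> v - \<beta> v'\<bar> \<le> L * dist v v'"
    "\<And>v u. \<lbrakk>u \<in> F; dist v u < \<rho>\<rbrakk> \<Longrightarrow> \<beta> v = 1" "\<And>v u. \<lbrakk>u \<in> G; dist v u < \<rho>\<rbrakk> \<Longrightarrow> \<beta> v = 0"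
proof (cases "F = {} \<or> G = {}")
  case True
  \<comment> \<open>For empty \<open>F\<close>, \<open>infdist v F\<close> is 0 by convention and
    the formula of the other case would yield 1 on \<open>G\<close>; a constant works
    instead.\<close>
  define \<beta> :: "'a \<Rightarrow> real" where "\<beta> v = (if F = {} then 0 else 1)" for v
  show ?thesis by (rule that[of 0 1 \<beta>]) (use True in \<open>auto simp: \<beta>_def\<close>)
next
  case False
  have "\<exists>d>0. \<forall>u\<in>F. \<forall>v\<in>G. d \<le> dist u v"
    using separate_compact_closed[of F G] assms compact_imp_closed by blast
  then obtain d where d: "d > 0" "\<And>u v. \<lbrakk>u \<in> F; v \<in> G\<rbrakk> \<Longrightarrow> d \<le> dist u v" by blast
  \<comment> \<open>Equal to 1 up to distance \<open>d/3\<close> from \<open>F\<close> and to 0 from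
    distance \<open>2*d/3\<close> on; points within \<open>d/3\<close> of \<open>G\<close> fall in
    the latter range. The slope is \<open>3/d\<close>.\<close>
  define \<beta> where "\<beta> v = max 0 (min 1 (2 - 3 * infdist v F / d))" for v
  show ?thesis
  proof (rule that[of "3/d" "d/3" \<beta>])
    fix v v' :: 'a
    have "\<bar>\<beta> v - \<beta> v'\<bar> \<le> \<bar>(2 - 3 * infdist v F / d) - (2 - 3 * infdist v' F / d)\<bar>"
      unfolding \<beta>_def by (auto simp: max_def min_def)
    also have "\<dots> = 3 / d * \<bar>infdist v F - infdist v' F\<bar>"
    proof -
      have "(2 - 3 * infdist v F / d) - (2 - 3 * infdist v' F / d) = - (3 / d * (infdist v F - infdist v' F))"
        by (simp add: right_diff_distrib)
      then show ?thesis using d(1) by (simp only: abs_minus_cancel abs_mult) simp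
    qed
    also have "\<dots> \<le> 3 / d * dist v v'"
      using d(1) infdist_triangle_abs[of v F v'] by (intro mult_left_mono) auto
    finally show "\<bar>\<beta> v - \<beta> v'\<bar> \<le> 3 / d * dist v v'" .
  next
    fix v u assume u: "u \<in> F" "dist v u < d / 3"
    have "infdist v F \<le> dist v u" using u by (intro infdist_le)
    then have "3 * infdist v F / d \<le> 1" using u d by (simp add: field_simps)
    then show "\<beta> v = 1" by (simp add: \<beta>_def)
  next
    fix v u assume u: "u \<in> G" "dist v u < d / 3"
    have "d \<le> infdist u F"
      using False d(2) u by (auto simp: infdist_def dist_commute intro!: cINF_greatest)
    then have "2 * d / 3 \<le> infdist v F" using infdist_triangle[of u F v] u by (simp add: dist_commute)
    then have "2 \<le> 3 * infdist v F / d" using d by (simp add: field_simps)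
    then show "\<beta> v = 0" by (simp add: \<beta>_def)
  qed (use d in \<open>auto simp: \<beta>_def\<close>)
qed

locale smooth_matchbox_atlas = matchbox_atlas M X A
  for M :: "'m topology" and X :: "'x topology" and A :: "('m, 'n::finite, 'x) fchart set" +
  assumes smooth: "\<lbrakk>c \<in> A; d \<in> A\<rbrakk> \<Longrightarrow>
    smooth_family (subtopology X (fc_mod c)) (transition_dom c d) (transition c d)"
begin

abbreviation almost_linear :: "('m, 'n, 'x) fchart \<Rightarrow> ('m, 'n, 'x) fchart \<Rightarrow> (real ^ 'n \<Rightarrow> real ^ 'n) \<Rightarrow> real \<Rightarrow> 'm \<Rightarrow> 'm \<Rightarrow> bool" where
  "almost_linear c d T \<epsilon> q q' \<equiv> norm (lcoord d q - lcoord d q' - T (lcoord c q - lcoord c q'))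
    \<le> \<epsilon> * norm (lcoord c q - lcoord c q')"

text \<open>\<open>smooth_family_strict\<close> restated for points of \<open>M\<close>. The map
  \<open>T\<close> comes from the plaque of \<open>y\<close>, yet the estimate holds with the same
  \<open>T\<close> for pairs on any common nearby plaque: this is the use made of the transverse
  continuity of derivatives.\<close>

lemma transition_strict:
  assumes c: "c \<in> A" "y \<in> fc_dom c" and d: "d \<in> A" "y \<in> fc_dom d"
  obtains T where "bounded_linear T"
    "\<And>\<epsilon>. \<epsilon> > 0 \<Longrightarrow> \<exists>U. openin M U \<and> y \<in> U \<and> U \<subseteq> fc_dom c \<inter> fc_dom d \<and>
      (\<forall>q\<in>U. \<forall>q'\<in>U. tcoord c q = tcoord c q' \<longrightarrow>
        almost_linear c d T \<epsilon> q q')"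
proof -
  let ?v = "lcoord c y" and ?w = "tcoord c y"
  obtain r W where rW: "r > 0" "ball ?v r \<subseteq> ocube 1" "openin X W" "?w \<in> W" "W \<subseteq> fc_mod c"
    "\<And>v w. \<lbrakk>v \<in> ball ?v r; w \<in> W\<rbrakk> \<Longrightarrow> chart_pt c v w \<in> fc_dom d"
    by (rule chart_box[OF c eventually_dom[OF d]]) (rule that)
  have wT: "?w \<in> topspace (subtopology X (fc_mod c))"
    using dom_coords(2)[OF c] mod_topspace[OF c(1)] by simp
  \<comment> \<open>Half the radius, so that the closed ball stays in the open box.\<close>
  have cb: "cball ?v (r/2) \<subseteq> transition_dom c d ?w"
  proof
    fix v assume "v \<in> cball ?v (r/2)"
    then have v: "v \<in> ball ?v r" using rW(1) by auto
    then have "chart_pt c v ?w \<in> fc_dom c \<inter> fc_dom d" "fc_map c (chart_pt c v ?w) = (v, ?w)"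
      using rW c dom_coords(2)[OF c] chart_pt_dom[OF c(1), of v ?w] by auto
    then show "v \<in> transition_dom c d ?w" unfolding transition_dom_def by blast
  qed
  have r2: "r / 2 > 0" using rW by simp
  obtain T where T: "bounded_linear T" "\<And>\<epsilon>. \<epsilon> > 0 \<Longrightarrow> \<exists>r>0. \<exists>W. openin (subtopology X (fc_mod c)) W \<and> ?w \<in> W \<and>
      (\<forall>w'\<in>W. \<forall>v\<in>ball ?v r. \<forall>v'\<in>ball ?v r.
       norm (transition c d w' v - transition c d w' v' - T (v - v')) \<le> \<epsilon> * norm (v - v'))"
    by (rule smooth_family_strict[OF smooth[OF c(1) d(1)] wT r2 cb]) (rule that)
  show ?thesis
  proof (rule that[OF T(1)])
    fix \<epsilon> :: real assume "\<epsilon> > 0"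
    then obtain r' W' where rW': "r' > 0" "openin (subtopology X (fc_mod c)) W'" "?w \<in> W'"
      "\<And>w' v v'. \<lbrakk>w' \<in> W'; v \<in> ball ?v r'; v' \<in> ball ?v r'\<rbrakk> \<Longrightarrow>
        norm (transition c d w' v - transition c d w' v' - T (v - v')) \<le> \<epsilon> * norm (v - v')"
      using T(2) by meson
    have W'o: "openin X W'" using rW'(2) mod_open[OF c(1)] openin_trans_full by blast
    define U where "U = {q \<in> fc_dom c. lcoord c q \<in> ball ?v (min r r') \<and> tcoord c q \<in> W \<inter> W'}"
    have Uo: "openin M U" unfolding U_def
      by (rule chart_open[OF c(1) open_ball]) (use rW W'o in blast)
    have "U \<subseteq> fc_dom c \<inter> fc_dom d"
    proof
      fix q assume q: "q \<in> U"
      then have "chart_pt c (lcoord c q) (tcoord c q) \<in> fc_dom d"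
        by (intro rW(6)) (auto simp: U_def)
      then show "q \<in> fc_dom c \<inter> fc_dom d" using q dom_coords(3)[OF c(1), of q] by (simp add: U_def)
    qed
    moreover have "almost_linear c d T \<epsilon> q q'"
      if q: "q \<in> U" "q' \<in> U" "tcoord c q = tcoord c q'" for q q'
    proof -
      have tq: "transition c d (tcoord c u) (lcoord c u) = lcoord d u" if u: "u \<in> U" for u
        using dom_coords(3)[OF c(1), of u] u by (simp add: transition_def U_def)
      have "norm (transition c d (tcoord c q) (lcoord c q) - transition c d (tcoord c q) (lcoord c q')
          - T (lcoord c q - lcoord c q')) \<le> \<epsilon> * norm (lcoord c q - lcoord c q')"
        by (rule rW'(4)) (use q in \<open>auto simp: U_def\<close>)
      moreover have "transition c d (tcoord c q) (lcoord c q') = lcoord d q'"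
        using tq[OF q(2)] q(3) by simp
      ultimately show ?thesis using tq[OF q(1)] by simp
    qed
    moreover have "y \<in> U" using c rW rW' by (simp add: U_def)
    ultimately show "\<exists>U. openin M U \<and> y \<in> U \<and> U \<subseteq> fc_dom c \<inter> fc_dom d \<and>
      (\<forall>q\<in>U. \<forall>q'\<in>U. tcoord c q = tcoord c q' \<longrightarrow>
        almost_linear c d T \<epsilon> q q')"
      using Uo by (intro exI[of _ U]) blast
  qed
qed

end

section \<open>Extending the base transversally\<close>

context matchbox_atlas
begin

lemma limitin_chart_pt:
  assumes c: "c \<in> A" and g: "(g \<longlongrightarrow> v) F" "v \<in> ocube 1" and f: "limitin X f w F" "w \<in> fc_mod c"
  shows "limitin M (\<lambda>z. chart_pt c (g z) (f z)) (chart_pt c v w) F"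
  unfolding limitin_def
proof (intro conjI allI impI)
  have y: "chart_pt c v w \<in> fc_dom c" using chart_pt_dom assms by blast
  have cy: "lcoord c (chart_pt c v w) = v" "tcoord c (chart_pt c v w) = w" using assms by simp_all
  show "chart_pt c v w \<in> topspace M" using dom_topspace c y by blast
  fix U assume U: "openin M U \<and> chart_pt c v w \<in> U"
  then have ev: "\<forall>\<^sub>F q in nhdsin M (chart_pt c v w). q \<in> U"
    by (auto simp: eventually_nhdsin)
  obtain r W where rW: "r > 0" "ball (lcoord c (chart_pt c v w)) r \<subseteq> ocube 1" "openin X W"
    "tcoord c (chart_pt c v w) \<in> W" "W \<subseteq> fc_mod c"
    "\<And>v' w'. \<lbrakk>v' \<in> ball (lcoord c (chart_pt c v w)) r; w' \<in> W\<rbrakk> \<Longrightarrow> chart_pt c v' w' \<in> U"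
    by (rule chart_box[OF c y ev]) (rule that)
  have "\<forall>\<^sub>F z in F. g z \<in> ball v r" using tendstoD[OF g(1) rW(1)] by eventually_elim (simp add: dist_commute)
  moreover have "\<forall>\<^sub>F z in F. f z \<in> W" using f rW cy by (auto simp: limitin_def)
  ultimately show "\<forall>\<^sub>F z in F. chart_pt c (g z) (f z) \<in> U"
    by eventually_elim (use rW(6) cy in simp)
qed

lemma limitin_lcoord:
  assumes "limitin M f y F" "c \<in> A" "y \<in> fc_dom c"
  shows "((\<lambda>z. lcoord c (f z)) \<longlongrightarrow> lcoord c y) F"
proof (rule topological_tendstoI)
  fix B assume B: "open B" "lcoord c y \<in> B"
  have "openin M {q \<in> fc_dom c. lcoord c q \<in> B \<and> tcoord c q \<in> topspace X}"
    by (rule chart_open[OF assms(2) B(1) openin_topspace])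
  moreover have "y \<in> {q \<in> fc_dom c. lcoord c q \<in> B \<and> tcoord c q \<in> topspace X}"
    using assms B dom_coords(2) mod_topspace by blast
  ultimately have "\<forall>\<^sub>F z in F. f z \<in> {q \<in> fc_dom c. lcoord c q \<in> B \<and> tcoord c q \<in> topspace X}"
    using assms(1) unfolding limitin_def by blast
  then show "\<forall>\<^sub>F z in F. lcoord c (f z) \<in> B" by eventually_elim simp
qed

end

text \<open>Of the holonomy covering only \<open>k\<close> is retained, with an inverse transversal
  at every point of \<open>K\<close> and the common base value \<open>w\<^sub>0\<close>.\<close>

locale transverse_projection = smooth_matchbox_atlas M X A
  for M :: "'m topology" and X :: "'x topology" and A :: "('m, 'n::finite, 'x) fchart set" +
  fixes K :: "'m set" and k :: "'m \<Rightarrow> 'x" and w\<^sub>0 :: 'x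
  assumes K: "compactin M K" and w\<^sub>0: "w\<^sub>0 \<in> topspace X"
    and germ: "y \<in> K \<Longrightarrow> \<exists>G. transverse_germ w\<^sub>0 k G y"
begin

abbreviation "KX \<equiv> prod_topology (subtopology M K) X"

text \<open>The parameter \<open>s\<close> lives in one common space for all \<open>y\<close>, near
  \<open>w\<^sub>0\<close> in \<open>X\<close>; transverse coordinates of individual charts are
  reached through maps \<open>\<tau>\<close>.\<close>

definition near :: "'m \<Rightarrow> ('m \<Rightarrow> 'x \<Rightarrow> bool) \<Rightarrow> bool" where
  "near y R \<longleftrightarrow> (\<forall>\<^sub>F z in nhdsin KX (y, w\<^sub>0). R (fst z) (snd z))"

lemma K_topspace [simp]: "y \<in> K \<Longrightarrow> y \<in> topspace M"
  using K by (auto simp: compactin_def)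

lemma k_K: "y \<in> K \<Longrightarrow> k y = w\<^sub>0"
  using germ by (auto simp: transverse_germ_def)

lemma limitin_fst:
  assumes "(b, s) \<in> topspace KX" shows "limitin M fst b (nhdsin KX (b, s))"
  unfolding limitin_def
proof (intro conjI allI impI)
  show "b \<in> topspace M" using assms K_topspace by auto
  fix U assume U: "openin M U \<and> b \<in> U"
  have "openin KX ((K \<inter> U) \<times> topspace X)"
    unfolding openin_prod_Times_iff using U by (auto simp: openin_subtopology_Int2)
  then show "\<forall>\<^sub>F z in nhdsin KX (b, s). fst z \<in> U"
    by (rule eventually_nhdsinI) (use assms U in auto)
qed

lemma limitin_snd:
  assumes "(b, s) \<in> topspace KX" shows "limitin X snd s (nhdsin KX (b, s))"
  unfolding limitin_def
proof (intro conjI allI impI)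
  show "s \<in> topspace X" using assms by auto
  fix U assume U: "openin X U \<and> s \<in> U"
  have "openin KX (K \<times> U)"
    unfolding openin_prod_Times_iff using U K openin_topspace[of "subtopology M K"]
    by (auto simp: compactin_def Int_absorb1)
  then show "\<forall>\<^sub>F z in nhdsin KX (b, s). snd z \<in> U"
    by (rule eventually_nhdsinI) (use assms U in auto)
qed

lemma near_conj: "near y P \<Longrightarrow> near y Q \<Longrightarrow> near y (\<lambda>b s. P b s \<and> Q b s)"
  unfolding near_def by (rule eventually_conj)

lemma near_mono: "near y P \<Longrightarrow> (\<And>b s. P b s \<Longrightarrow> Q b s) \<Longrightarrow> near y Q"
  unfolding near_def by (erule eventually_mono) blast

lemma near_base:
  assumes "y \<in> K" "eventually P (nhdsin M y)" shows "near y (\<lambda>b s. P b)"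
  unfolding near_def
  by (rule limitin_eventually_nhdsin[OF limitin_fst assms(2)]) (use assms(1) w\<^sub>0 K_topspace in simp)

lemma near_trans:
  assumes "y \<in> K" "eventually P (nhdsin X w\<^sub>0)" shows "near y (\<lambda>b s. P s)"
  unfolding near_def
  by (rule limitin_eventually_nhdsin[OF limitin_snd assms(2)]) (use assms(1) w\<^sub>0 K_topspace in simp)

lemma near_K: "y \<in> K \<Longrightarrow> near y (\<lambda>b s. b \<in> K \<and> s \<in> topspace X)"
  unfolding near_def by (rule eventually_nhdsinI[OF openin_topspace]) (use w\<^sub>0 in auto)

lemma near_self: "near y R \<Longrightarrow> y \<in> K \<Longrightarrow> R y w\<^sub>0"
  unfolding near_def using eventually_nhdsin_self[of "\<lambda>z. R (fst z) (snd z)" KX "(y, w\<^sub>0)"] w\<^sub>0 by simp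

lemma near_rect:
  assumes y: "y \<in> K"
  shows "near y R \<longleftrightarrow> (\<exists>U S. openin M U \<and> y \<in> U \<and> openin X S \<and> w\<^sub>0 \<in> S \<and> (\<forall>b\<in>K \<inter> U. \<forall>s\<in>S. R b s))"
proof
  assume "near y R"
  then obtain N where N: "openin KX N" "(y, w\<^sub>0) \<in> N" "\<And>z. z \<in> N \<Longrightarrow> R (fst z) (snd z)"
    unfolding near_def by (rule eventually_nhdsin_obtain) (use y w\<^sub>0 in simp, rule that)
  have "\<exists>U S. openin (subtopology M K) U \<and> openin X S \<and> y \<in> U \<and> w\<^sub>0 \<in> S \<and> U \<times> S \<subseteq> N"
    using N(1,2) by (simp only: openin_prod_topology_alt)
  then obtain U' S where US: "openin (subtopology M K) U'" "openin X S" "y \<in> U'" "w\<^sub>0 \<in> S" "U' \<times> S \<subseteq> N"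
    by (elim exE conjE) (rule that)
  obtain U where U: "openin M U" "U' = K \<inter> U" using US(1) by (auto simp: openin_subtopology Int_commute)
  have "\<forall>b\<in>K \<inter> U. \<forall>s\<in>S. R b s"
  proof (intro ballI)
    fix b s assume "b \<in> K \<inter> U" "s \<in> S"
    then have "(b, s) \<in> N" using US(5) U(2) by blast
    from N(3)[OF this] show "R b s" by simp
  qed
  then show "\<exists>U S. openin M U \<and> y \<in> U \<and> openin X S \<and> w\<^sub>0 \<in> S \<and> (\<forall>b\<in>K \<inter> U. \<forall>s\<in>S. R b s)"
    using US U by (intro exI[of _ U] exI[of _ S]) blast
next
  assume "\<exists>U S. openin M U \<and> y \<in> U \<and> openin X S \<and> w\<^sub>0 \<in> S \<and> (\<forall>b\<in>K \<inter> U. \<forall>s\<in>S. R b s)"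
  then obtain U S where US: "openin M U" "y \<in> U" "openin X S" "w\<^sub>0 \<in> S" "\<forall>b\<in>K \<inter> U. \<forall>s\<in>S. R b s" by blast
  have "near y (\<lambda>b s. b \<in> U)" by (rule near_base[OF y eventually_nhdsinI[OF US(1,2)]])
  moreover have "near y (\<lambda>b s. s \<in> S)" by (rule near_trans[OF y eventually_nhdsinI[OF US(3,4)]])
  moreover note near_K[OF y]
  ultimately show "near y R" unfolding near_def by eventually_elim (use US in auto)
qed

lemma near_w\<^sub>0:
  assumes "near y R" "y \<in> K" shows "near y (\<lambda>b s. R b w\<^sub>0)"
  using assms(1) unfolding near_rect[OF assms(2)] by meson

section \<open>Local extensions of the inclusion\<close>

definition cont_at :: "('m \<Rightarrow> 'x \<Rightarrow> 'm) \<Rightarrow> 'm \<Rightarrow> 'x \<Rightarrow> bool" where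
  "cont_at \<Phi> b s \<longleftrightarrow> limitin M (\<lambda>z. \<Phi> (fst z) (snd z)) (\<Phi> b s) (nhdsin KX (b, s))"

abbreviation almost_id :: "('m, 'n, 'x) fchart \<Rightarrow> real \<Rightarrow> ('m \<Rightarrow> 'x \<Rightarrow> 'm) \<Rightarrow> 'x \<Rightarrow> 'm \<Rightarrow> 'm \<Rightarrow> bool" where
  "almost_id c \<epsilon> \<Phi> s b b' \<equiv> norm (lcoord c (\<Phi> b s) - lcoord c (\<Phi> b' s) - (lcoord c b - lcoord c b'))
    \<le> \<epsilon> * norm (lcoord c b - lcoord c b')"

text \<open>Uniformly in the transverse parameter, \<open>\<Phi>\<close> is strictly differentiable along \<open>K\<close> at \<open>y\<close>
  with derivative the identity.\<close>

definition strict_at :: "('m, 'n, 'x) fchart \<Rightarrow> ('m \<Rightarrow> 'x \<Rightarrow> 'm) \<Rightarrow> 'm \<Rightarrow> bool" where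
  "strict_at c \<Phi> y \<longleftrightarrow> (\<forall>\<epsilon>>0. \<exists>Q. near y Q \<and> (\<forall>b b' s. Q b s \<longrightarrow> Q b' s \<longrightarrow>
     almost_id c \<epsilon> \<Phi> s b b'))"

text \<open>The local conditions from which the properties of the final map follow. They depend only
  on the germ of \<open>\<Phi>\<close> at \<open>(y, w\<^sub>0)\<close>
  (\<open>ext_at_cong\<close>), so \<open>\<Phi>\<close> may be changed elsewhere; one chart
  suffices for strictness by \<open>strict_at_change_chart\<close>.\<close>

definition ext_at :: "('m \<Rightarrow> 'x \<Rightarrow> 'm) \<Rightarrow> 'm \<Rightarrow> bool" where
  "ext_at \<Phi> y \<longleftrightarrow> near y (\<lambda>b s. \<Phi> b w\<^sub>0 = b \<and> k (\<Phi> b s) = s \<and> cont_at \<Phi> b s) \<and>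
     (\<exists>c\<in>A. y \<in> fc_dom c \<and> strict_at c \<Phi> y)"

lemma ext_at_limit:
  assumes "ext_at \<Phi> y" "y \<in> K"
  shows "limitin M (\<lambda>z. \<Phi> (fst z) (snd z)) y (nhdsin KX (y, w\<^sub>0))"
proof -
  have "near y (\<lambda>b s. \<Phi> b w\<^sub>0 = b \<and> k (\<Phi> b s) = s \<and> cont_at \<Phi> b s)"
    using assms(1) by (simp add: ext_at_def)
  from near_self[OF this assms(2)] have "\<Phi> y w\<^sub>0 = y" "cont_at \<Phi> y w\<^sub>0" by auto
  then show ?thesis by (simp add: cont_at_def)
qed

lemma ext_at_near:
  assumes "ext_at \<Phi> y" "y \<in> K" "eventually P (nhdsin M y)"
  shows "near y (\<lambda>b s. P (\<Phi> b s))"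
  unfolding near_def by (rule limitin_eventually_nhdsin[OF ext_at_limit[OF assms(1,2)] assms(3)])

text \<open>Continuity at points near \<open>y\<close> requires equality of the two maps near those
  points as well, hence \<open>eventually_eventually_nhdsin\<close>.\<close>

lemma cont_at_cong:
  assumes "near y (\<lambda>b s. \<Phi> b s = \<Phi>' b s)" "y \<in> K"
  shows "near y (\<lambda>b s. cont_at \<Phi> b s \<longrightarrow> cont_at \<Phi>' b s)"
proof -
  have "\<forall>\<^sub>F z in nhdsin KX (y, w\<^sub>0). \<forall>\<^sub>F z' in nhdsin KX z. \<Phi> (fst z') (snd z') = \<Phi>' (fst z') (snd z')"
    using assms(1) unfolding near_def by (rule eventually_eventually_nhdsin)
  then show ?thesis
    unfolding near_def using near_K[OF assms(2)] assms(1) unfolding near_def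
  proof eventually_elim
    case (elim z)
    show ?case
    proof
      assume "cont_at \<Phi> (fst z) (snd z)"
      then show "cont_at \<Phi>' (fst z) (snd z)"
        unfolding cont_at_def using limitin_transform_eventually[OF elim(1)] elim(3) by simp
    qed
  qed
qed

lemma strict_at_cong:
  assumes "strict_at c \<Phi> y" "near y (\<lambda>b s. \<Phi> b s = \<Phi>' b s)"
  shows "strict_at c \<Phi>' y"
  unfolding strict_at_def
proof (intro allI impI)
  fix \<epsilon> :: real assume "\<epsilon> > 0"
  then obtain Q where Q: "near y Q" "\<And>b b' s. \<lbrakk>Q b s; Q b' s\<rbrakk> \<Longrightarrow>
     almost_id c \<epsilon> \<Phi> s b b'" using assms(1) unfolding strict_at_def by meson
  have *: "almost_id c \<epsilon> \<Phi>' s b b'"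
    if "Q b s \<and> \<Phi> b s = \<Phi>' b s" "Q b' s \<and> \<Phi> b' s = \<Phi>' b' s" for b b' s
    using Q(2)[of b s b'] that by simp
  then show "\<exists>Q. near y Q \<and> (\<forall>b b' s. Q b s \<longrightarrow> Q b' s \<longrightarrow>
     almost_id c \<epsilon> \<Phi>' s b b')"
    by (intro exI[of _ "\<lambda>b s. Q b s \<and> \<Phi> b s = \<Phi>' b s"] conjI near_conj[OF Q(1) assms(2)]) blast
qed

lemma ext_at_cong:
  assumes "ext_at \<Phi> y" "near y (\<lambda>b s. \<Phi> b s = \<Phi>' b s)" "y \<in> K"
  shows "ext_at \<Phi>' y"
proof -
  have "near y (\<lambda>b s. \<Phi> b w\<^sub>0 = b \<and> k (\<Phi> b s) = s \<and> cont_at \<Phi> b s)"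
    using assms(1) by (simp add: ext_at_def)
  then have "near y (\<lambda>b s. \<Phi>' b w\<^sub>0 = b \<and> k (\<Phi>' b s) = s \<and> cont_at \<Phi>' b s)"
    using assms(2) near_w\<^sub>0[OF assms(2,3)] cont_at_cong[OF assms(2,3)]
    unfolding near_def by eventually_elim simp
  then show ?thesis using assms(1) strict_at_cong[OF _ assms(2)] by (auto simp: ext_at_def)
qed

text \<open>Since \<open>k (\<Phi> b s) = s\<close>, the point lies on the local plaque of
  \<open>G s\<close>. So its \<open>c\<close>-coordinate depends on \<open>s\<close> only, with
  \<open>\<tau> s = tcoord c (G s)\<close>; the estimates in charts compare points of one plaque and
  need this.\<close>

lemma near_tcoord:
  assumes y: "y \<in> K" and c: "c \<in> A" "y \<in> fc_dom c" and \<Phi>: "ext_at \<Phi> y"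
  obtains \<tau> where "near y (\<lambda>b s. tcoord c (\<Phi> b s) = \<tau> s \<and> tcoord c b = \<tau> w\<^sub>0)"
proof -
  obtain G where G: "transverse_germ w\<^sub>0 k G y" using germ[OF y] by blast
  have ks: "near y (\<lambda>b s. \<Phi> b w\<^sub>0 = b \<and> k (\<Phi> b s) = s \<and> cont_at \<Phi> b s)"
    using \<Phi> by (simp add: ext_at_def)
  have 1: "near y (\<lambda>b s. tcoord c (G (k (\<Phi> b s))) = tcoord c (\<Phi> b s))"
    by (rule ext_at_near[OF \<Phi> y transverse_germ_section[OF G c]])
  have 2: "near y (\<lambda>b s. tcoord c (G (k b)) = tcoord c b)"
    by (rule near_base[OF y transverse_germ_section[OF G c]])
  have "near y (\<lambda>b s. tcoord c (\<Phi> b s) = tcoord c (G s) \<and> tcoord c b = tcoord c (G w\<^sub>0))"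
    using ks 1 2 near_K[OF y] unfolding near_def by eventually_elim (simp add: k_K)
  then show ?thesis by (rule that)
qed

text \<open>Let \<open>D\<close>, \<open>D'\<close> be the differences of
  \<open>d\<close>-coordinates before and after \<open>\<Phi>\<close>, and \<open>Z\<close>,
  \<open>Z'\<close> those of \<open>c\<close>-coordinates. Then \<open>Z' - Z\<close> splits into
  \<open>(Z' - T1 D') + T1 (D' - D) - (Z - T1 D)\<close>. The same \<open>T1\<close> approximates
  the transition on the plaque of \<open>K\<close> and on that of \<open>\<Phi>(\<cdot>, s)\<close>,
  so every term is small relative to \<open>D\<close>.\<close>

lemma strict_at_change_chart:
  assumes y: "y \<in> K" and \<Phi>: "ext_at \<Phi> y" and c: "c \<in> A" "y \<in> fc_dom c"
  shows "strict_at c \<Phi> y"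
proof -
  obtain d where d: "d \<in> A" "y \<in> fc_dom d" and sd: "strict_at d \<Phi> y" using \<Phi> by (auto simp: ext_at_def)
  obtain T1 where T1: "bounded_linear T1" "\<And>\<epsilon>. \<epsilon> > 0 \<Longrightarrow> \<exists>U. openin M U \<and> y \<in> U \<and> U \<subseteq> fc_dom d \<inter> fc_dom c \<and>
      (\<forall>q\<in>U. \<forall>q'\<in>U. tcoord d q = tcoord d q' \<longrightarrow>
        almost_linear d c T1 \<epsilon> q q')"
    by (rule transition_strict[OF d c]) (rule that)
  obtain T2 where T2: "bounded_linear T2" "\<And>\<epsilon>. \<epsilon> > 0 \<Longrightarrow> \<exists>U. openin M U \<and> y \<in> U \<and> U \<subseteq> fc_dom c \<inter> fc_dom d \<and>
      (\<forall>q\<in>U. \<forall>q'\<in>U. tcoord c q = tcoord c q' \<longrightarrow>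
        almost_linear c d T2 \<epsilon> q q')"
    by (rule transition_strict[OF c d]) (rule that)
  obtain \<tau> where \<tau>: "near y (\<lambda>b s. tcoord d (\<Phi> b s) = \<tau> s \<and> tcoord d b = \<tau> w\<^sub>0)"
    by (rule near_tcoord[OF y d \<Phi>])
  obtain \<tau>' where \<tau>': "near y (\<lambda>b s. tcoord c (\<Phi> b s) = \<tau>' s \<and> tcoord c b = \<tau>' w\<^sub>0)"
    by (rule near_tcoord[OF y c \<Phi>])
  define B1 where "B1 = onorm T1"
  define B2 where "B2 = onorm T2"
  have B: "B1 \<ge> 0" "B2 \<ge> 0" using T1(1) T2(1) onorm_pos_le by (auto simp: B1_def B2_def)
  \<comment> \<open>From \<open>c\<close> back to \<open>d\<close> the error 1 is enough: only the
    bound \<open>norm D \<le> (B2 + 1) * norm Z\<close> is wanted.\<close>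
  obtain U2 where U2: "openin M U2" "y \<in> U2" "\<And>q q'. \<lbrakk>q \<in> U2; q' \<in> U2; tcoord c q = tcoord c q'\<rbrakk> \<Longrightarrow>
    almost_linear c d T2 1 q q'"
    using T2(2)[OF zero_less_one] by (elim exE conjE) (rule that, auto)
  show ?thesis unfolding strict_at_def
  proof (intro allI impI)
    fix \<epsilon> :: real assume \<epsilon>: "\<epsilon> > 0"
    \<comment> \<open>The three terms are at most \<open>2 * \<eta>\<close>,
      \<open>B1 * \<eta>\<close> and \<open>\<eta>\<close> times \<open>norm D\<close>, whence
      \<open>3 + B1\<close>; the factor \<open>B2 + 1\<close> converts \<open>norm D\<close> to
      \<open>norm Z\<close>. The bound \<open>\<eta> \<le> 1\<close> gives
      \<open>norm D' \<le> 2 * norm D\<close>.\<close>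
    define \<eta> where "\<eta> = min 1 (\<epsilon> / ((3 + B1) * (B2 + 1)))"
    have \<eta>: "\<eta> > 0" "\<eta> \<le> 1" using \<epsilon> B by (auto simp: \<eta>_def)
    have \<eta>\<epsilon>: "\<eta> * ((3 + B1) * (B2 + 1)) \<le> \<epsilon>"
    proof -
      have "\<eta> \<le> \<epsilon> / ((3 + B1) * (B2 + 1))" by (simp add: \<eta>_def)
      moreover have "(3 + B1) * (B2 + 1) > 0" using B by (intro mult_pos_pos) auto
      ultimately show ?thesis by (simp add: pos_le_divide_eq)
    qed
    obtain U1 where U1: "openin M U1" "y \<in> U1" "\<And>q q'. \<lbrakk>q \<in> U1; q' \<in> U1; tcoord d q = tcoord d q'\<rbrakk> \<Longrightarrow>
      almost_linear d c T1 \<eta> q q'"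
      using T1(2)[OF \<eta>(1)] by (elim exE conjE) (rule that, auto)
    obtain Q where Q: "near y Q" "\<And>b b' s. \<lbrakk>Q b s; Q b' s\<rbrakk> \<Longrightarrow>
     almost_id d \<eta> \<Phi> s b b'" using sd \<eta>(1) unfolding strict_at_def by meson
    define R where "R b s \<longleftrightarrow> Q b s \<and> b \<in> U1 \<and> b \<in> U2 \<and> \<Phi> b s \<in> U1 \<and>
      (tcoord d (\<Phi> b s) = \<tau> s \<and> tcoord d b = \<tau> w\<^sub>0) \<and>
      (tcoord c (\<Phi> b s) = \<tau>' s \<and> tcoord c b = \<tau>' w\<^sub>0)" for b s
    have R: "near y R" unfolding R_def
      by (intro near_conj Q(1) \<tau> \<tau>' near_base[OF y] ext_at_near[OF \<Phi> y] eventually_nhdsinI[OF U1(1,2)]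
          eventually_nhdsinI[OF U2(1,2)])
    have "almost_id c \<epsilon> \<Phi> s b b'" if Rb: "R b s" "R b' s" for b b' s
    proof -
      define D where "D = lcoord d b - lcoord d b'"
      define D' where "D' = lcoord d (\<Phi> b s) - lcoord d (\<Phi> b' s)"
      define Z where "Z = lcoord c b - lcoord c b'"
      define Z' where "Z' = lcoord c (\<Phi> b s) - lcoord c (\<Phi> b' s)"
      have 1: "norm (D' - D) \<le> \<eta> * norm D" unfolding D_def D'_def by (rule Q(2)) (use Rb in \<open>auto simp: R_def\<close>)
      have 2: "norm (Z' - T1 D') \<le> \<eta> * norm D'" unfolding Z'_def D'_def by (rule U1(3)) (use Rb in \<open>auto simp: R_def\<close>)
      have 3: "norm (Z - T1 D) \<le> \<eta> * norm D" unfolding Z_def D_def by (rule U1(3)) (use Rb in \<open>auto simp: R_def\<close>)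
      have 4: "norm (D - T2 Z) \<le> 1 * norm Z" unfolding Z_def D_def by (rule U2(3)) (use Rb in \<open>auto simp: R_def\<close>)
      have T1D: "norm (T1 (D' - D)) \<le> B1 * norm (D' - D)" unfolding B1_def by (rule onorm[OF T1(1)])
      have T2Z: "norm (T2 Z) \<le> B2 * norm Z" unfolding B2_def by (rule onorm[OF T2(1)])
      have nD: "norm D \<le> (B2 + 1) * norm Z"
      proof -
        have "norm D \<le> norm (D - T2 Z) + norm (T2 Z)" by (metis diff_add_cancel norm_triangle_ineq)
        then show ?thesis using 4 T2Z by (simp add: algebra_simps)
      qed
      have "norm D' \<le> norm (D' - D) + norm D" by (metis diff_add_cancel norm_triangle_ineq)
      also have "\<dots> \<le> 1 * norm D + norm D"
        using 1 mult_right_mono[OF \<eta>(2) norm_ge_zero[of D]] by linarith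
      finally have nD': "norm D' \<le> 2 * norm D" by simp
      have "norm (Z' - Z) = norm ((Z' - T1 D') + T1 (D' - D) - (Z - T1 D))"
        by (simp add: linear_diff[OF bounded_linear.linear[OF T1(1)]])
      then have "norm (Z' - Z) \<le> norm (Z' - T1 D') + norm (T1 (D' - D)) + norm (Z - T1 D)"
        using norm_triangle_ineq4[of "(Z' - T1 D') + T1 (D' - D)" "Z - T1 D"]
          norm_triangle_ineq[of "Z' - T1 D'" "T1 (D' - D)"] by linarith
      also have "\<dots> \<le> \<eta> * (2 * norm D) + B1 * (\<eta> * norm D) + \<eta> * norm D"
      proof (intro add_mono)
        show "norm (Z' - T1 D') \<le> \<eta> * (2 * norm D)" using 2 mult_left_mono[OF nD', of \<eta>] \<eta> by linarith
        show "norm (T1 (D' - D)) \<le> B1 * (\<eta> * norm D)" using T1D mult_left_mono[OF 1 B(1)] by linarith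
      qed (rule 3)
      also have "\<dots> = \<eta> * (3 + B1) * norm D" by (simp add: algebra_simps)
      also have "\<dots> \<le> \<eta> * (3 + B1) * ((B2 + 1) * norm Z)"
        using nD \<eta> B by (intro mult_left_mono) auto
      also have "\<dots> = \<eta> * ((3 + B1) * (B2 + 1)) * norm Z" by (simp add: algebra_simps)
      also have "\<dots> \<le> \<epsilon> * norm Z" using \<eta>\<epsilon> by (rule mult_right_mono) simp
      finally show ?thesis by (simp add: Z_def Z'_def)
    qed
    then show "\<exists>Q. near y Q \<and> (\<forall>b b' s. Q b s \<longrightarrow> Q b' s \<longrightarrow>
     almost_id c \<epsilon> \<Phi> s b b')" using R by (intro exI[of _ R]) blast
  qed
qed

text \<open>In the coordinates of the chart \<open>c\<close>, the set \<open>{q. k q = s}\<close> is the plaque over \<open>\<tau> s\<close>.\<close>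

definition adapted :: "('m, 'n, 'x) fchart \<Rightarrow> (real ^ 'n) set \<Rightarrow> 'x set \<Rightarrow> 'x set \<Rightarrow> ('x \<Rightarrow> 'x) \<Rightarrow> bool" where
  "adapted c B W S \<tau> \<longleftrightarrow> c \<in> A \<and> open B \<and> B \<subseteq> ocube 1 \<and> openin X W \<and> W \<subseteq> fc_mod c \<and> openin X S \<and> w\<^sub>0 \<in> S \<and>
     continuous_map (subtopology X S) X \<tau> \<and> \<tau> ` S \<subseteq> W \<and>
     (\<forall>v\<in>B. \<forall>s\<in>S. k (chart_pt c v (\<tau> s)) = s) \<and> (\<forall>v\<in>B. \<forall>w\<in>W. \<tau> (k (chart_pt c v w)) = w)"

definition cell :: "('m, 'n, 'x) fchart \<Rightarrow> (real ^ 'n) set \<Rightarrow> 'x set \<Rightarrow> 'm set" where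
  "cell c B W = {q \<in> fc_dom c. lcoord c q \<in> B \<and> tcoord c q \<in> W}"

text \<open>\<open>\<tau>\<close> is the inverse transversal \<open>G\<close> read in the chart. On
  the transversal through \<open>y\<close>, \<open>k\<close> and \<open>\<tau>\<close> invert each
  other; as \<open>k\<close> is constant along the plaques of a small box, the relation holds at
  every leafwise coordinate \<open>v\<close> of the box.\<close>

lemma adapted_exists:
  assumes y: "y \<in> K"
  obtains c B W S \<tau> where "adapted c B W S \<tau>" "y \<in> cell c B W"
proof -
  obtain G where G: "transverse_germ w\<^sub>0 k G y" using germ[OF y] by blast
  obtain c where c: "c \<in> A" "y \<in> fc_dom c" using covered K_topspace[OF y] by blast
  let ?v = "lcoord c y"
  define P where "P q \<longleftrightarrow> k q = k (chart_pt c ?v (tcoord c q)) \<and> tcoord c (G (k q)) = tcoord c q" for q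
  have P: "eventually P (nhdsin M y)"
  proof -
    have "leafwise_const k y" using G by (simp add: transverse_germ_def)
    from leafwise_constD[OF this c] transverse_germ_section[OF G c] show ?thesis
      unfolding P_def by (rule eventually_conj)
  qed
  obtain r W where rW: "r > 0" "ball ?v r \<subseteq> ocube 1" "openin X W" "tcoord c y \<in> W" "W \<subseteq> fc_mod c"
    "\<And>v w. \<lbrakk>v \<in> ball ?v r; w \<in> W\<rbrakk> \<Longrightarrow> P (chart_pt c v w)"
    by (rule chart_box[OF c P]) (rule that)
  obtain S0 where S0: "openin X S0" "w\<^sub>0 \<in> S0" "continuous_map (subtopology X S0) M G"
    using G by (auto simp: transverse_germ_def)
  have "\<forall>\<^sub>F s in nhdsin X w\<^sub>0. s \<in> S0 \<and> k (G s) = s \<and> G s \<in> cell c (ball ?v r) W \<and> P (G s)"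
  proof (intro eventually_conj)
    show "\<forall>\<^sub>F s in nhdsin X w\<^sub>0. s \<in> S0" by (rule eventually_nhdsinI[OF S0(1,2)])
    show "\<forall>\<^sub>F s in nhdsin X w\<^sub>0. k (G s) = s" using G by (simp add: transverse_germ_def)
    show "\<forall>\<^sub>F s in nhdsin X w\<^sub>0. P (G s)" by (rule limitin_eventually_nhdsin[OF transverse_germ_limits(2)[OF G] P])
    have "openin M (cell c (ball ?v r) W)" unfolding cell_def by (rule chart_open[OF c(1) open_ball rW(3)])
    moreover have "y \<in> cell c (ball ?v r) W" using c rW by (simp add: cell_def)
    ultimately show "\<forall>\<^sub>F s in nhdsin X w\<^sub>0. G s \<in> cell c (ball ?v r) W"
      using transverse_germ_limits(2)[OF G] by (simp add: limitin_def)
  qed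
  then obtain S where S: "openin X S" "w\<^sub>0 \<in> S" "\<And>s. s \<in> S \<Longrightarrow> s \<in> S0 \<and> k (G s) = s \<and> G s \<in> cell c (ball ?v r) W \<and> P (G s)"
    by (rule eventually_nhdsin_obtain[OF _ w\<^sub>0]) (rule that)
  let ?\<tau> = "\<lambda>s. tcoord c (G s)"
  have "adapted c (ball ?v r) W S ?\<tau>"
    unfolding adapted_def
  proof (intro conjI ballI)
    have "continuous_map (subtopology X S) M G"
      by (rule continuous_map_from_subtopology_mono[OF S0(3)]) (use S in blast)
    then have "continuous_map (subtopology X S) (subtopology M (fc_dom c)) G"
      using S(3) by (auto simp: continuous_map_in_subtopology cell_def)
    from continuous_map_compose[OF this coord_cont(2)[OF c(1)]]
    show "continuous_map (subtopology X S) X ?\<tau>" by (simp add: o_def)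
    show \<tau>W: "?\<tau> ` S \<subseteq> W" using S(3) by (auto simp: cell_def)
    have kP: "k (chart_pt c v w) = k (chart_pt c ?v w)" "tcoord c (G (k (chart_pt c v w))) = w"
      if "v \<in> ball ?v r" "w \<in> W" for v w
    proof -
      have "v \<in> ocube 1" "w \<in> fc_mod c" using that rW by auto
      then have "tcoord c (chart_pt c v w) = w" using c by simp
      then show "k (chart_pt c v w) = k (chart_pt c ?v w)" "tcoord c (G (k (chart_pt c v w))) = w"
        using rW(6)[OF that] by (auto simp: P_def)
    qed
    show "k (chart_pt c v (?\<tau> s)) = s" if "v \<in> ball ?v r" "s \<in> S" for v s
    proof -
      have "?\<tau> s \<in> W" using \<tau>W that by blast
      then have "k (chart_pt c v (?\<tau> s)) = k (chart_pt c ?v (?\<tau> s))" using kP(1) that by blast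
      also have "\<dots> = k (G s)" using S(3)[OF that(2)] by (auto simp: P_def)
      finally show ?thesis using S(3)[OF that(2)] by simp
    qed
    show "?\<tau> (k (chart_pt c v w)) = w" if "v \<in> ball ?v r" "w \<in> W" for v w using kP(2)[OF that] .
  qed (use c rW S in auto)
  moreover have "y \<in> cell c (ball ?v r) W" using c rW by (simp add: cell_def)
  ultimately show ?thesis by (rule that)
qed


lemma adapted_simps:
  assumes "adapted c B W S \<tau>"
  shows "c \<in> A" "open B" "B \<subseteq> ocube 1" "openin X W" "W \<subseteq> fc_mod c" "openin X S" "w\<^sub>0 \<in> S"
    "continuous_map (subtopology X S) X \<tau>" "\<And>s. s \<in> S \<Longrightarrow> \<tau> s \<in> W"
    "\<And>v s. \<lbrakk>v \<in> B; s \<in> S\<rbrakk> \<Longrightarrow> k (chart_pt c v (\<tau> s)) = s"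
    "\<And>v w. \<lbrakk>v \<in> B; w \<in> W\<rbrakk> \<Longrightarrow> \<tau> (k (chart_pt c v w)) = w"
  using assms unfolding adapted_def by blast+

lemma cell_open: "adapted c B W S \<tau> \<Longrightarrow> openin M (cell c B W)"
  unfolding cell_def by (intro chart_open) (auto dest: adapted_simps)

lemma cell_k:
  assumes "adapted c B W S \<tau>" "q \<in> cell c B W"
  shows "\<tau> (k q) = tcoord c q" "chart_pt c (lcoord c q) (\<tau> (k q)) = q"
proof -
  have q: "q \<in> fc_dom c" "lcoord c q \<in> B" "tcoord c q \<in> W" using assms by (auto simp: cell_def)
  have e: "chart_pt c (lcoord c q) (tcoord c q) = q" by (rule dom_coords(3)[OF adapted_simps(1)[OF assms(1)] q(1)])
  show 1: "\<tau> (k q) = tcoord c q" using adapted_simps(11)[OF assms(1) q(2,3)] e by simp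
  show "chart_pt c (lcoord c q) (\<tau> (k q)) = q" using 1 e by simp
qed

text \<open>\<open>k\<close> equals \<open>w\<^sub>0\<close> on all of \<open>K\<close>, so
  \<open>K\<close> meets a cell in a single plaque, and there \<open>lcoord c\<close> alone
  determines a point.\<close>

lemma cell_tcoord: "\<lbrakk>adapted c B W S \<tau>; q \<in> cell c B W; q \<in> K\<rbrakk> \<Longrightarrow> tcoord c q = \<tau> w\<^sub>0"
  using cell_k(1) k_K by metis

text \<open>The common form of all local constructions: shift the leafwise coordinate by
  \<open>P b s\<close>, then move vertically to the plaque over \<open>\<tau> s\<close>. Adaptedness
  yields \<open>k (\<Phi> b s) = s\<close> for any shift that stays in \<open>B\<close>, so what
  remains are conditions on \<open>P\<close> in a vector space.\<close>

lemma ext_at_perturb: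
  fixes P :: "'m \<Rightarrow> 'x \<Rightarrow> real ^ 'n"
  assumes y: "y \<in> K" and ad: "adapted c B W S \<tau>" and yc: "y \<in> cell c B W"
    and cont: "near y (\<lambda>b s. ((\<lambda>z. P (fst z) (snd z)) \<longlongrightarrow> P b s) (nhdsin KX (b, s)))"
    and zero: "near y (\<lambda>b s. P b w\<^sub>0 = 0)"
    and small: "\<And>\<epsilon>. \<epsilon> > 0 \<Longrightarrow> \<exists>Q. near y Q \<and> (\<forall>b b' s. Q b s \<longrightarrow> Q b' s \<longrightarrow>
      norm (P b s - P b' s) \<le> \<epsilon> * norm (lcoord c b - lcoord c b'))"
    and eq: "near y (\<lambda>b s. \<Phi> b s = chart_pt c (lcoord c b + P b s) (\<tau> s))"
  shows "ext_at \<Phi> y"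
proof -
  note a = adapted_simps[OF ad]
  have dom: "near y (\<lambda>b s. b \<in> cell c B W)"
    by (rule near_base[OF y eventually_nhdsinI[OF cell_open[OF ad] yc]])
  have sS: "near y (\<lambda>b s. s \<in> S)" by (rule near_trans[OF y eventually_nhdsinI[OF a(6,7)]])
  have yd: "y \<in> fc_dom c" "lcoord c y \<in> B" using yc by (auto simp: cell_def)
  have inB: "near y (\<lambda>b s. lcoord c b + P b s \<in> B)"
  proof -
    have 1: "((\<lambda>z. P (fst z) (snd z)) \<longlongrightarrow> 0) (nhdsin KX (y, w\<^sub>0))"
      using near_self[OF cont y] near_self[OF zero y] by simp
    have "((\<lambda>z. lcoord c (fst z)) \<longlongrightarrow> lcoord c y) (nhdsin KX (y, w\<^sub>0))"
      by (rule limitin_lcoord[OF limitin_fst a(1) yd(1)]) (use y w\<^sub>0 in simp)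
    from tendsto_add[OF this 1] have "((\<lambda>z. lcoord c (fst z) + P (fst z) (snd z)) \<longlongrightarrow> lcoord c y) (nhdsin KX (y, w\<^sub>0))" by simp
    from topological_tendstoD[OF this a(2) yd(2)] show ?thesis unfolding near_def .
  qed
  have kk: "near y (\<lambda>b s. k (\<Phi> b s) = s)"
    using eq inB sS unfolding near_def by eventually_elim (simp add: a(10))
  \<comment> \<open>On \<open>K\<close> the parameter \<open>w\<^sub>0\<close> is
    \<open>k b\<close>, so with zero shift the formula rebuilds \<open>b\<close> from its own
    coordinates.\<close>
  have base: "near y (\<lambda>b s. \<Phi> b w\<^sub>0 = b)"
    using near_w\<^sub>0[OF eq y] zero dom near_K[OF y] unfolding near_def
  proof eventually_elim
    case (elim z)
    then have "\<Phi> (fst z) w\<^sub>0 = chart_pt c (lcoord c (fst z)) (\<tau> (k (fst z)))"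
      by (simp add: k_K)
    then show ?case using cell_k(2)[OF ad elim(3)] by simp
  qed
  have contA: "near y (\<lambda>b s. cont_at \<Phi> b s)"
  proof -
    have "\<forall>\<^sub>F z in nhdsin KX (y, w\<^sub>0). \<forall>\<^sub>F z' in nhdsin KX z.
        \<Phi> (fst z') (snd z') = chart_pt c (lcoord c (fst z') + P (fst z') (snd z')) (\<tau> (snd z'))"
      using eq unfolding near_def by (rule eventually_eventually_nhdsin)
    then show ?thesis unfolding near_def
      using cont inB sS dom eq near_K[OF y] unfolding near_def
    proof eventually_elim
      case (elim z)
      obtain b s where z: "z = (b, s)" by force
      have bs: "b \<in> K" "s \<in> topspace X" and ss: "s \<in> S" "b \<in> cell c B W" using elim z by auto
      have zt: "(b, s) \<in> topspace KX" using bs by simp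
      have 1: "((\<lambda>z. lcoord c (fst z) + P (fst z) (snd z)) \<longlongrightarrow> lcoord c b + P b s) (nhdsin KX (b, s))"
        by (intro tendsto_add limitin_lcoord[OF limitin_fst[OF zt] a(1)])
          (use elim z ss in \<open>auto simp: cell_def\<close>)
      have 2: "limitin X (\<lambda>z. \<tau> (snd z)) (\<tau> s) (nhdsin KX (b, s))"
      proof -
        have "limitin (subtopology X S) snd s (nhdsin KX (b, s))"
          using limitin_snd[OF zt] limitinD[OF limitin_snd[OF zt] a(6) ss(1)] ss(1)
          by (simp add: limitin_subtopology)
        from continuous_map_limit[OF a(8) this] show ?thesis by (simp add: o_def)
      qed
      have "limitin M (\<lambda>z'. chart_pt c (lcoord c (fst z') + P (fst z') (snd z')) (\<tau> (snd z')))
          (chart_pt c (lcoord c b + P b s) (\<tau> s)) (nhdsin KX (b, s))"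
        by (rule limitin_chart_pt[OF a(1) 1 _ 2]) (use elim z ss a(3,5) a(9)[OF ss(1)] in auto)
      then have "limitin M (\<lambda>z'. chart_pt c (lcoord c (fst z') + P (fst z') (snd z')) (\<tau> (snd z')))
          (\<Phi> b s) (nhdsin KX (b, s))" using elim z by simp
      then have "limitin M (\<lambda>z. \<Phi> (fst z) (snd z)) (\<Phi> b s) (nhdsin KX (b, s))"
      proof (rule limitin_transform_eventually[rotated])
        show "\<forall>\<^sub>F z' in nhdsin KX (b, s). chart_pt c (lcoord c (fst z') + P (fst z') (snd z')) (\<tau> (snd z'))
            = \<Phi> (fst z') (snd z')" using elim(1) z by (simp add: eq_commute)
      qed
      then show "cont_at \<Phi> (fst z) (snd z)" unfolding cont_at_def z by simp
    qed
  qed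
  have str: "strict_at c \<Phi> y" unfolding strict_at_def
  proof (intro allI impI)
    fix \<epsilon> :: real assume "\<epsilon> > 0"
    from small[OF this] obtain Q where Q: "near y Q" "\<And>b b' s. \<lbrakk>Q b s; Q b' s\<rbrakk> \<Longrightarrow>
      norm (P b s - P b' s) \<le> \<epsilon> * norm (lcoord c b - lcoord c b')" by (elim exE conjE) (rule that, assumption, blast)
    define R where "R b s \<longleftrightarrow> Q b s \<and> \<Phi> b s = chart_pt c (lcoord c b + P b s) (\<tau> s) \<and>
      lcoord c b + P b s \<in> B \<and> s \<in> S" for b s
    have R: "near y R" unfolding R_def by (intro near_conj Q(1) eq inB sS)
    have "lcoord c (\<Phi> b s) = lcoord c b + P b s" if r: "R b s" for b s
    proof -
      have "lcoord c b + P b s \<in> ocube 1" "\<tau> s \<in> fc_mod c" using r a(3,5) a(9)[of s] by (auto simp: R_def)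
      then show ?thesis using r a(1) by (simp add: R_def)
    qed
    then have "almost_id c \<epsilon> \<Phi> s b b'" if r: "R b s" "R b' s" for b b' s
      using Q(2)[of b s b'] r by (simp add: R_def algebra_simps)
    then show "\<exists>Q. near y Q \<and> (\<forall>b b' s. Q b s \<longrightarrow> Q b' s \<longrightarrow>
     almost_id c \<epsilon> \<Phi> s b b')" using R by (intro exI[of _ R]) blast
  qed
  have "near y (\<lambda>b s. \<Phi> b w\<^sub>0 = b \<and> k (\<Phi> b s) = s \<and> cont_at \<Phi> b s)"
    by (intro near_conj base kk contA)
  then show ?thesis using str a(1) yd(1) by (auto simp: ext_at_def)
qed

text \<open>The displacement \<open>lcoord c (\<Phi> b s) - lcoord c b\<close> vanishes for \<open>s = w\<^sub>0\<close> and has a small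
  Lipschitz constant nearby, hence so has its product with a Lipschitz cutoff function.\<close>

lemma ext_at_cutoff:
  assumes y: "y \<in> K" and ad: "adapted c B W S \<tau>" and yc: "y \<in> cell c B W" and \<Phi>: "ext_at \<Phi> y"
    and L: "L \<ge> 0" "\<And>v. 0 \<le> \<beta> v \<and> \<beta> v \<le> (1::real)" "\<And>v v'. \<bar>\<beta> v - \<beta> v'\<bar> \<le> L * dist v v'"
    and eq: "near y (\<lambda>b s. \<Phi>' b s = chart_pt c (lcoord c b + \<beta> (lcoord c b) *\<^sub>R (lcoord c (\<Phi> b s) - lcoord c b)) (\<tau> s))"
  shows "ext_at \<Phi>' y"
proof (rule ext_at_perturb[OF y ad yc _ _ _ eq])
  note a = adapted_simps[OF ad]
  have yd: "y \<in> fc_dom c" using yc by (auto simp: cell_def)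
  define D where "D b s = lcoord c (\<Phi> b s) - lcoord c b" for b s
  have \<Phi>0: "near y (\<lambda>b s. \<Phi> b w\<^sub>0 = b \<and> k (\<Phi> b s) = s \<and> cont_at \<Phi> b s)" using \<Phi> by (simp add: ext_at_def)
  have dom: "near y (\<lambda>b s. b \<in> fc_dom c)" by (rule near_base[OF y eventually_dom[OF a(1) yd]])
  have dom': "near y (\<lambda>b s. \<Phi> b s \<in> fc_dom c)" by (rule ext_at_near[OF \<Phi> y eventually_dom[OF a(1) yd]])
  have cont\<beta>: "continuous_on UNIV \<beta>"
  proof -
    have "L-lipschitz_on UNIV \<beta>" using L by (auto simp: lipschitz_on_def dist_real_def)
    then show ?thesis by (rule lipschitz_on_continuous_on)
  qed
  have contD: "near y (\<lambda>b s. ((\<lambda>z. D (fst z) (snd z)) \<longlongrightarrow> D b s) (nhdsin KX (b, s))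
      \<and> ((\<lambda>z. lcoord c (fst z)) \<longlongrightarrow> lcoord c b) (nhdsin KX (b, s)))"
    unfolding near_def using \<Phi>0 dom dom' near_K[OF y] unfolding near_def
  proof eventually_elim
    case (elim z)
    obtain b s where z: "z = (b, s)" by force
    have zt: "(b, s) \<in> topspace KX" using elim z by simp
    have "((\<lambda>z. lcoord c (\<Phi> (fst z) (snd z))) \<longlongrightarrow> lcoord c (\<Phi> b s)) (nhdsin KX (b, s))"
      by (rule limitin_lcoord[OF _ a(1)]) (use elim z in \<open>auto simp: cont_at_def\<close>)
    moreover have "((\<lambda>z. lcoord c (fst z)) \<longlongrightarrow> lcoord c b) (nhdsin KX (b, s))"
      by (rule limitin_lcoord[OF limitin_fst[OF zt] a(1)]) (use elim z in auto)
    ultimately show ?case unfolding z D_def by (auto intro: tendsto_diff)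
  qed
  show "near y (\<lambda>b s. ((\<lambda>z. \<beta> (lcoord c (fst z)) *\<^sub>R (lcoord c (\<Phi> (fst z) (snd z)) - lcoord c (fst z)))
      \<longlongrightarrow> \<beta> (lcoord c b) *\<^sub>R (lcoord c (\<Phi> b s) - lcoord c b)) (nhdsin KX (b, s)))"
  proof (rule near_mono[OF contD])
    fix b s assume h: "((\<lambda>z. D (fst z) (snd z)) \<longlongrightarrow> D b s) (nhdsin KX (b, s))
      \<and> ((\<lambda>z. lcoord c (fst z)) \<longlongrightarrow> lcoord c b) (nhdsin KX (b, s))"
    have "isCont \<beta> (lcoord c b)" using cont\<beta> by (simp add: continuous_on_eq_continuous_at)
    from isCont_tendsto_compose[OF this] h
    have "((\<lambda>z. \<beta> (lcoord c (fst z))) \<longlongrightarrow> \<beta> (lcoord c b)) (nhdsin KX (b, s))" by blast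
    from tendsto_scaleR[OF this conjunct1[OF h]]
    show "((\<lambda>z. \<beta> (lcoord c (fst z)) *\<^sub>R (lcoord c (\<Phi> (fst z) (snd z)) - lcoord c (fst z)))
      \<longlongrightarrow> \<beta> (lcoord c b) *\<^sub>R (lcoord c (\<Phi> b s) - lcoord c b)) (nhdsin KX (b, s))"
      by (simp add: D_def)
  qed
  show "near y (\<lambda>b s. \<beta> (lcoord c b) *\<^sub>R (lcoord c (\<Phi> b w\<^sub>0) - lcoord c b) = 0)"
    by (rule near_mono[OF \<Phi>0]) auto
  fix \<epsilon> :: real assume \<epsilon>: "\<epsilon> > 0"
  \<comment> \<open>Product rule for the cutoff times the displacement \<open>D\<close>: the cutoff
    is at most 1 and \<open>D\<close> varies with factor \<open>\<eta>\<close>; the cutoff varies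
    with factor \<open>L\<close> while \<open>D\<close> itself is below \<open>\<eta>\<close>. In
    total \<open>(1 + L) * \<eta>\<close>.\<close>
  define \<eta> where "\<eta> = \<epsilon> / (1 + L)"
  have \<eta>: "\<eta> > 0" using \<epsilon> L(1) by (simp add: \<eta>_def)
  have "strict_at c \<Phi> y" by (rule strict_at_change_chart[OF y \<Phi> a(1) yd])
  then obtain Q where Q: "near y Q" "\<And>b b' s. \<lbrakk>Q b s; Q b' s\<rbrakk> \<Longrightarrow>
     almost_id c \<eta> \<Phi> s b b'" using \<eta> unfolding strict_at_def by meson
  have small: "near y (\<lambda>b s. norm (D b s) < \<eta>)"
  proof -
    have "((\<lambda>z. D (fst z) (snd z)) \<longlongrightarrow> D y w\<^sub>0) (nhdsin KX (y, w\<^sub>0))" "D y w\<^sub>0 = 0"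
      using near_self[OF contD y] near_self[OF \<Phi>0 y] by (auto simp: D_def)
    then have "((\<lambda>z. D (fst z) (snd z)) \<longlongrightarrow> 0) (nhdsin KX (y, w\<^sub>0))" by simp
    from tendstoD[OF this \<eta>] show ?thesis unfolding near_def by simp
  qed
  have "norm (\<beta> (lcoord c b) *\<^sub>R D b s - \<beta> (lcoord c b') *\<^sub>R D b' s)
      \<le> \<epsilon> * norm (lcoord c b - lcoord c b')"
    if Qb: "Q b s \<and> norm (D b s) < \<eta>" "Q b' s \<and> norm (D b' s) < \<eta>" for b b' s
  proof -
    let ?n = "norm (lcoord c b - lcoord c b')"
    have "\<beta> (lcoord c b) *\<^sub>R D b s - \<beta> (lcoord c b') *\<^sub>R D b' s
      = \<beta> (lcoord c b) *\<^sub>R (D b s - D b' s) + (\<beta> (lcoord c b) - \<beta> (lcoord c b')) *\<^sub>R D b' s"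
      by (simp add: algebra_simps)
    then have "norm (\<beta> (lcoord c b) *\<^sub>R D b s - \<beta> (lcoord c b') *\<^sub>R D b' s)
      \<le> norm (\<beta> (lcoord c b) *\<^sub>R (D b s - D b' s)) + norm ((\<beta> (lcoord c b) - \<beta> (lcoord c b')) *\<^sub>R D b' s)"
      by (simp only: norm_triangle_ineq)
    also have "\<dots> = \<bar>\<beta> (lcoord c b)\<bar> * norm (D b s - D b' s) + \<bar>\<beta> (lcoord c b) - \<beta> (lcoord c b')\<bar> * norm (D b' s)"
      by simp
    also have "\<dots> \<le> 1 * (\<eta> * ?n) + (L * ?n) * \<eta>"
    proof (intro add_mono mult_mono)
      show "\<bar>\<beta> (lcoord c b)\<bar> \<le> 1" using L(2)[of "lcoord c b"] by simp
      show "norm (D b s - D b' s) \<le> \<eta> * ?n" using Q(2)[of b s b'] Qb by (simp add: D_def algebra_simps)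
      show "\<bar>\<beta> (lcoord c b) - \<beta> (lcoord c b')\<bar> \<le> L * ?n" using L(3) by (simp add: dist_norm)
    qed (use Qb L(1) in auto)
    also have "\<dots> = (\<eta> * (1 + L)) * ?n" by (simp add: algebra_simps)
    also have "\<eta> * (1 + L) = \<epsilon>" using L(1) by (simp add: \<eta>_def)
    finally show ?thesis .
  qed
  then show "\<exists>Q. near y Q \<and> (\<forall>b b' s. Q b s \<longrightarrow> Q b' s \<longrightarrow>
      norm (\<beta> (lcoord c b) *\<^sub>R (lcoord c (\<Phi> b s) - lcoord c b)
        - \<beta> (lcoord c b') *\<^sub>R (lcoord c (\<Phi> b' s) - lcoord c b'))
      \<le> \<epsilon> * norm (lcoord c b - lcoord c b'))"
    by (intro exI[of _ "\<lambda>b s. Q b s \<and> norm (D b s) < \<eta>"] conjI near_conj[OF Q(1) small]) (simp add: D_def)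
qed

section \<open>Patching over a finite cover by cells\<close>

lemma cell_compact:
  assumes ad: "adapted c B W S \<tau>" and r: "cball v r \<subseteq> B"
  shows "compactin M (K \<inter> cell c (cball v r) W)"
proof -
  note a = adapted_simps[OF ad]
  let ?D = "(\<lambda>u. chart_pt c u (\<tau> w\<^sub>0)) ` cball v r"
  have \<tau>0: "\<tau> w\<^sub>0 \<in> W" "\<tau> w\<^sub>0 \<in> fc_mod c" using a(5,7) a(9) by auto
  have rB: "cball v r \<subseteq> ocube 1" using r a(3) by blast
  have "compactin M ?D"
  proof (rule image_compactin[of "top_of_set (ocube 2)"])
    show "continuous_map (top_of_set (ocube 2)) M (\<lambda>u. chart_pt c u (\<tau> w\<^sub>0))"
      by (rule chart_inv_slice_cont[OF a(1) \<tau>0(2)])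
    show "compactin (top_of_set (ocube 2)) (cball v r)"
      by (simp add: compactin_subtopology subset_trans[OF rB ocube_1_subset_2])
  qed
  then have "compactin M (?D \<inter> K)" using K hausM compactin_imp_closedin compact_Int_closedin by blast
  \<comment> \<open>\<open>W\<close> is only open, so compactness cannot come from the cell itself;
    but on \<open>K\<close> just the plaque over \<open>\<tau> w\<^sub>0\<close> matters, and its
    closed coordinate ball is compact.\<close>
  moreover have "K \<inter> cell c (cball v r) W = ?D \<inter> K"
  proof (intro subset_antisym subsetI)
    fix q assume q: "q \<in> K \<inter> cell c (cball v r) W"
    then have "q \<in> cell c B W" using r by (auto simp: cell_def)
    then have "tcoord c q = \<tau> w\<^sub>0" using cell_tcoord[OF ad] q by blast
    then have "q = chart_pt c (lcoord c q) (\<tau> w\<^sub>0)" using dom_coords(3)[OF a(1), of q] q by (simp add: cell_def)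
    then show "q \<in> ?D \<inter> K" using q by (auto simp: cell_def)
  next
    fix q assume "q \<in> ?D \<inter> K"
    then obtain u where u: "u \<in> cball v r" "q = chart_pt c u (\<tau> w\<^sub>0)" "q \<in> K" by blast
    then have "u \<in> ocube 1" using rB by blast
    then show "q \<in> K \<inter> cell c (cball v r) W" using u \<tau>0 a(1) chart_pt_dom[OF a(1), of u "\<tau> w\<^sub>0"] by (simp add: cell_def)
  qed
  ultimately show ?thesis by simp
qed

text \<open>\<open>\<Phi>\<close> must not change near the finished part \<open>C\<close>, while
  outside \<open>Q\<close> nothing is known of it. In the new cell it is therefore blended with the
  vertical translation, by a cutoff that is 1 near \<open>C\<close> and 0 near the complement of
  \<open>Q\<close>.\<close>

lemma ext_at_step:
  assumes ad: "adapted c B W S \<tau>" and r: "r > 0" "cball v\<^sub>0 r \<subseteq> B"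
    and C: "closedin M C" "C \<subseteq> K" "C \<subseteq> Q" and Q: "openin M Q" "\<forall>y\<in>K \<inter> Q. ext_at \<Phi> y"
  shows "\<exists>\<Phi>' Q'. openin M Q' \<and> C \<union> cell c (ball v\<^sub>0 r) W \<subseteq> Q' \<and> (\<forall>y\<in>K \<inter> Q'. ext_at \<Phi>' y)"
proof -
  note a = adapted_simps[OF ad]
  define \<Delta> where "\<Delta> = K \<inter> cell c (cball v\<^sub>0 r) W"
  have \<Delta>1: "q \<in> K \<and> q \<in> fc_dom c \<and> q \<in> cell c B W" if "q \<in> \<Delta>" for q
    using that r(2) by (auto simp: \<Delta>_def cell_def)
  \<comment> \<open>Because of this, the disjointness of \<open>C\<close> and the complement of
    \<open>Q\<close> passes to their coordinate images, where the cutoff is constructed.\<close>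
  have inj\<Delta>: "q = q'" if "q \<in> \<Delta>" "q' \<in> \<Delta>" "lcoord c q = lcoord c q'" for q q'
    using \<Delta>1[OF that(1)] \<Delta>1[OF that(2)] that(3) cell_tcoord[OF ad] dom_eqI[OF a(1)] by metis
  have \<Delta>comp: "compactin M \<Delta>" unfolding \<Delta>_def by (rule cell_compact[OF ad r(2)])
  have img: "compact (lcoord c ` (\<Delta> \<inter> Z))" if Z: "closedin M Z" for Z
  proof -
    have "compactin (subtopology M (fc_dom c)) (\<Delta> \<inter> Z)"
      using compact_Int_closedin[OF \<Delta>comp Z] \<Delta>1 by (auto simp: compactin_subtopology)
    from image_compactin[OF this coord_cont(1)[OF a(1)]] show ?thesis by simp
  qed
  define F where "F = lcoord c ` (\<Delta> \<inter> C)"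
  define G where "G = lcoord c ` (\<Delta> \<inter> (topspace M - Q))"
  have "compact F" unfolding F_def by (rule img[OF C(1)])
  moreover have "compact G" unfolding G_def by (rule img) (use Q(1) in \<open>simp add: closedin_diff\<close>)
  moreover have "F \<inter> G = {}"
  proof (rule ccontr)
    assume "F \<inter> G \<noteq> {}"
    then obtain q q' where "q \<in> \<Delta> \<inter> C" "q' \<in> \<Delta> \<inter> (topspace M - Q)" "lcoord c q = lcoord c q'"
      unfolding F_def G_def by blast
    then show False using inj\<Delta>[of q q'] C(3) by blast
  qed
  ultimately obtain \<beta> :: "real ^ 'n \<Rightarrow> real" and L \<rho> where L: "L \<ge> 0" and \<rho>: "\<rho> > 0"
    and \<beta>: "\<And>v. 0 \<le> \<beta> v \<and> \<beta> v \<le> 1" "\<And>v v'. \<bar>\<beta> v - \<beta> v'\<bar> \<le> L * dist v v'"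
    "\<And>v u. \<lbrakk>u \<in> F; dist v u < \<rho>\<rbrakk> \<Longrightarrow> \<beta> v = 1" "\<And>v u. \<lbrakk>u \<in> G; dist v u < \<rho>\<rbrakk> \<Longrightarrow> \<beta> v = 0"
    by (rule lipschitz_cutoff) (rule that)
  \<comment> \<open>\<open>\<beta> = 0\<close> is pure vertical translation;
    \<open>\<beta> = 1\<close> gives \<open>\<Phi>\<close> back where \<open>\<Phi> b s\<close>
    stays in the cell and \<open>k (\<Phi> b s) = s\<close>.\<close>
  define \<Psi> where "\<Psi> b s = chart_pt c (lcoord c b + \<beta> (lcoord c b) *\<^sub>R (lcoord c (\<Phi> b s) - lcoord c b)) (\<tau> s)" for b s
  define \<Phi>' where "\<Phi>' b s = (if b \<in> \<Delta> then \<Psi> b s else \<Phi> b s)" for b s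
  \<comment> \<open>The part of \<open>Q\<close> near which the modification is invisible. At the
    rim of \<open>\<Delta>\<close> the map \<open>\<Phi>'\<close> may jump; such points enter
    \<open>Q'\<close> only through \<open>Q\<^sub>1\<close>.\<close>
  define Q\<^sub>1 where "Q\<^sub>1 = \<Union>{U. openin M U \<and> U \<subseteq> Q \<and> (\<exists>S'. openin X S' \<and> w\<^sub>0 \<in> S' \<and> (\<forall>b\<in>K \<inter> U. \<forall>s\<in>S'. \<Phi> b s = \<Phi>' b s))}"
  define Q' where "Q' = Q\<^sub>1 \<union> cell c (ball v\<^sub>0 r) W"
  have co: "openin M (cell c (ball v\<^sub>0 r) W)" unfolding cell_def by (rule chart_open[OF a(1) open_ball a(4)])
  have Q\<^sub>1o: "openin M Q\<^sub>1" unfolding Q\<^sub>1_def by (rule openin_Union) blast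
  have near_ball: "near y (\<lambda>b s. dist (lcoord c b) (lcoord c y) < \<rho>)" if y: "y \<in> K" "y \<in> fc_dom c" for y
  proof -
    have "((\<lambda>q. lcoord c q) \<longlongrightarrow> lcoord c y) (nhdsin M y)"
    proof (rule limitin_lcoord[OF _ a(1) y(2)])
      show "limitin M (\<lambda>q. q) y (nhdsin M y)"
        unfolding limitin_def using y by (auto intro: eventually_nhdsinI)
    qed
    from tendstoD[OF this \<rho>] show ?thesis by (rule near_base[OF y(1)])
  qed
  have near_cell: "near y (\<lambda>b s. b \<in> \<Delta>)" if y: "y \<in> K" "y \<in> cell c (ball v\<^sub>0 r) W" for y
  proof -
    have "near y (\<lambda>b s. b \<in> cell c (ball v\<^sub>0 r) W)" by (rule near_base[OF y(1) eventually_nhdsinI[OF co y(2)]])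
    with near_K[OF y(1)] show ?thesis unfolding near_def
      by eventually_elim (auto simp: \<Delta>_def cell_def)
  qed
  have "C \<subseteq> Q\<^sub>1"
  proof
    fix y assume yC: "y \<in> C"
    then have yK: "y \<in> K" and yQ: "y \<in> Q" using C by auto
    have e: "ext_at \<Phi> y" using Q yK yQ by blast
    have "near y (\<lambda>b s. b \<in> \<Delta> \<longrightarrow> \<Phi> b s = \<Phi>' b s)"
    proof (cases "y \<in> \<Delta>")
      case False
      have "openin M (topspace M - \<Delta>)" using \<Delta>comp hausM compactin_imp_closedin by blast
      then have "near y (\<lambda>b s. b \<in> topspace M - \<Delta>)"
        by (intro near_base[OF yK] eventually_nhdsinI[of M "topspace M - \<Delta>"]) (use yK False in auto)
      then show ?thesis by (rule near_mono) blast
    next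
      case True
      then have yd: "y \<in> fc_dom c" "y \<in> cell c B W" using \<Delta>1 by auto
      have mem: "lcoord c y \<in> F" using True yC by (auto simp: F_def)
      have "near y (\<lambda>b s. \<beta> (lcoord c b) = 1)"
        by (rule near_mono[OF near_ball[OF yK yd(1)]]) (rule \<beta>(3)[OF mem])
      moreover have "near y (\<lambda>b s. \<Phi> b s \<in> cell c B W)"
        by (rule ext_at_near[OF e yK eventually_nhdsinI[OF cell_open[OF ad] yd(2)]])
      moreover have "near y (\<lambda>b s. \<Phi> b w\<^sub>0 = b \<and> k (\<Phi> b s) = s \<and> cont_at \<Phi> b s)" using e by (simp add: ext_at_def)
      ultimately show ?thesis unfolding near_def
      proof eventually_elim
        case (elim z)
        show ?case
        proof
          assume "fst z \<in> \<Delta>"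
          \<comment> \<open>Here \<open>\<beta> = 1\<close> and \<open>s = k (\<Phi> b s)\<close>,
            so \<open>\<Psi>\<close> rebuilds \<open>\<Phi> b s\<close> from its own
            coordinates.\<close>
          then have "\<Phi>' (fst z) (snd z) = chart_pt c (lcoord c (\<Phi> (fst z) (snd z))) (\<tau> (k (\<Phi> (fst z) (snd z))))"
            using elim by (simp add: \<Phi>'_def \<Psi>_def)
          then show "\<Phi> (fst z) (snd z) = \<Phi>' (fst z) (snd z)" using cell_k(2)[OF ad elim(2)] by simp
        qed
      qed
    qed
    then have "near y (\<lambda>b s. \<Phi> b s = \<Phi>' b s)" by (rule near_mono) (auto simp: \<Phi>'_def)
    then obtain U S' where US: "openin M U" "y \<in> U" "openin X S'" "w\<^sub>0 \<in> S'" "\<forall>b\<in>K \<inter> U. \<forall>s\<in>S'. \<Phi> b s = \<Phi>' b s"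
      unfolding near_rect[OF yK] by blast
    have "openin M (U \<inter> Q)" "U \<inter> Q \<subseteq> Q" "\<forall>b\<in>K \<inter> (U \<inter> Q). \<forall>s\<in>S'. \<Phi> b s = \<Phi>' b s" using US Q(1) by auto
    then show "y \<in> Q\<^sub>1" unfolding Q\<^sub>1_def using US yQ by blast
  qed
  moreover have "ext_at \<Phi>' y" if y: "y \<in> K \<inter> Q'" for y
  proof (cases "y \<in> Q\<^sub>1")
    case True
    then obtain U S' where US: "openin M U" "y \<in> U" "U \<subseteq> Q" "openin X S'" "w\<^sub>0 \<in> S'" "\<forall>b\<in>K \<inter> U. \<forall>s\<in>S'. \<Phi> b s = \<Phi>' b s"
      unfolding Q\<^sub>1_def by blast
    have yK: "y \<in> K" using y by blast
    have "near y (\<lambda>b s. \<Phi> b s = \<Phi>' b s)" unfolding near_rect[OF yK] using US by blast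
    moreover have "ext_at \<Phi> y" using Q(2) US yK by blast
    ultimately show ?thesis using ext_at_cong yK by blast
  next
    case False
    then have yc: "y \<in> cell c (ball v\<^sub>0 r) W" and yK: "y \<in> K" using y by (auto simp: Q'_def)
    have y\<Delta>: "y \<in> \<Delta>" using yK yc by (auto simp: \<Delta>_def cell_def)
    have yB: "y \<in> cell c B W" "y \<in> fc_dom c" using \<Delta>1[OF y\<Delta>] by auto
    have eq: "near y (\<lambda>b s. \<Phi>' b s = \<Psi> b s)"
      by (rule near_mono[OF near_cell[OF yK yc]]) (simp add: \<Phi>'_def)
    show ?thesis
    proof (cases "y \<in> Q")
      case True
      then have "ext_at \<Phi> y" using Q yK by blast
      from ext_at_cutoff[OF yK ad yB(1) this L \<beta>(1,2) eq[unfolded \<Psi>_def]] show ?thesis .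
    next
      case False
      then have mem: "lcoord c y \<in> G" using y\<Delta> yK by (auto simp: G_def)
      \<comment> \<open>Nothing is known about \<open>\<Phi>\<close> at this point, but the cutoff
        removes it: the vertical translation remains, the case of shift 0.\<close>
      have "near y (\<lambda>b s. \<beta> (lcoord c b) = 0)"
        by (rule near_mono[OF near_ball[OF yK yB(2)]]) (rule \<beta>(4)[OF mem])
      with eq have eq0: "near y (\<lambda>b s. \<Phi>' b s = chart_pt c (lcoord c b + (\<lambda>_ _. 0) b s) (\<tau> s))"
        unfolding near_def by eventually_elim (simp add: \<Psi>_def)
      show ?thesis
      proof (rule ext_at_perturb[OF yK ad yB(1) _ _ _ eq0])
        show "near y (\<lambda>b s. ((\<lambda>z. 0) \<longlongrightarrow> (0 :: real ^ 'n)) (nhdsin KX (b, s)))" by (simp add: near_def)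
        show "\<exists>Q. near y Q \<and> (\<forall>b b' s. Q b s \<longrightarrow> Q b' s \<longrightarrow>
          norm ((0 :: real ^ 'n) - 0) \<le> \<epsilon> * norm (lcoord c b - lcoord c b'))" if "\<epsilon> > 0" for \<epsilon>
          using that by (intro exI[of _ "\<lambda>b s. True"]) (simp add: near_def)
      qed (simp add: near_def)
    qed
  qed
  ultimately show ?thesis using Q\<^sub>1o co by (intro exI[of _ \<Phi>'] exI[of _ Q']) (auto simp: Q'_def)
qed

lemma extension_exists: "\<exists>\<Phi>. \<forall>y\<in>K. ext_at \<Phi> y"
proof -
  \<comment> \<open>Two radii: cells of radius \<open>r/2\<close> form the cover, while a step makes
    the map good on the cell of radius \<open>r\<close>. The margin allows the closed half cell to
    join the finished set \<open>C\<close> with a neighbourhood in \<open>Q'\<close>.\<close>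
  define good where "good y c v r W \<longleftrightarrow> (\<exists>B S \<tau>. adapted c B W S \<tau> \<and> r > 0 \<and> cball v r \<subseteq> B)
    \<and> y \<in> cell c (ball v (r/2)) W" for y c v and r :: real and W
  define \<U> where "\<U> = {U. \<exists>y c v r W. y \<in> K \<and> good y c v r W \<and> U = cell c (ball v (r/2)) W}"
  have good: "\<exists>c v r W. good y c v r W" if y: "y \<in> K" for y
  proof -
    obtain c B W S \<tau> where ad: "adapted c B W S \<tau>" "y \<in> cell c B W" by (rule adapted_exists[OF y])
    obtain r where r: "r > 0" "cball (lcoord c y) r \<subseteq> B"
      using adapted_simps(2)[OF ad(1)] ad(2) open_contains_cball unfolding cell_def by blast
    have "good y c (lcoord c y) r W" unfolding good_def using ad r by (auto simp: cell_def)
    then show ?thesis by blast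
  qed
  have "\<forall>U\<in>\<U>. openin M U"
  proof
    fix U assume "U \<in> \<U>"
    then obtain c v r W B S \<tau> where ad: "adapted c B W S \<tau>" and U: "U = cell c (ball v (r/2)) W"
      unfolding \<U>_def good_def by blast
    show "openin M U" unfolding U cell_def
      by (rule chart_open[OF adapted_simps(1)[OF ad] open_ball adapted_simps(4)[OF ad]])
  qed
  moreover have "K \<subseteq> \<Union>\<U>"
  proof
    fix y assume y: "y \<in> K"
    then obtain c v r W where g: "good y c v r W" using good by blast
    then have "cell c (ball v (r/2)) W \<in> \<U>" using y unfolding \<U>_def by blast
    moreover have "y \<in> cell c (ball v (r/2)) W" using g unfolding good_def by blast
    ultimately show "y \<in> \<Union>\<U>" by blast
  qed
  ultimately obtain \<F> where F: "finite \<F>" "\<F> \<subseteq> \<U>" "K \<subseteq> \<Union>\<F>" using K unfolding compactin_def by meson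
  \<comment> \<open>The invariant: \<open>C\<close> is closed and contains the part of
    \<open>K\<close> treated so far, and \<open>\<Phi>\<close> is good on an open neighbourhood
    \<open>Q\<close> of it. Both \<open>\<Phi>\<close> and \<open>Q\<close> are replaced at each
    step.\<close>
  have "\<exists>C \<Phi> Q. closedin M C \<and> C \<subseteq> K \<and> K \<inter> \<Union>\<F> \<subseteq> C \<and> C \<subseteq> Q \<and> openin M Q \<and> (\<forall>y\<in>K \<inter> Q. ext_at \<Phi> y)"
    using F(1,2)
  proof (induction \<F> rule: finite_induct)
    case empty
    show ?case by (intro exI[of _ "{}"]) auto
  next
    case (insert U \<F>)
    have "\<exists>C \<Phi> Q. closedin M C \<and> C \<subseteq> K \<and> K \<inter> \<Union>\<F> \<subseteq> C \<and> C \<subseteq> Q \<and> openin M Q \<and> (\<forall>y\<in>K \<inter> Q. ext_at \<Phi> y)"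
      by (rule insert.IH) (use insert.prems in blast)
    then obtain C \<Phi> Q where C: "closedin M C" "C \<subseteq> K" "K \<inter> \<Union>\<F> \<subseteq> C" "C \<subseteq> Q" "openin M Q" "\<forall>y\<in>K \<inter> Q. ext_at \<Phi> y"
      by (elim exE conjE) (rule that)
    obtain y c v r W where g: "good y c v r W" "U = cell c (ball v (r/2)) W" using insert.prems unfolding \<U>_def by blast
    then obtain B S \<tau> where ad: "adapted c B W S \<tau>" and r: "r > 0" "cball v r \<subseteq> B" unfolding good_def by blast
    obtain \<Phi>' Q' where Q': "openin M Q'" "C \<union> cell c (ball v r) W \<subseteq> Q'" "\<forall>y\<in>K \<inter> Q'. ext_at \<Phi>' y"
      using ext_at_step[OF ad r C(1,2,4,5,6)] by (elim exE conjE) (rule that)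
    let ?D = "K \<inter> cell c (cball v (r/2)) W"
    have half: "cball v (r/2) \<subseteq> ball v r" using r(1) by auto
    have sub: "cball v (r/2) \<subseteq> B" using half r(2) ball_subset_cball[of v r] by blast
    have sub': "?D \<subseteq> cell c (ball v r) W" using half by (auto simp: cell_def)
    have "closedin M (C \<union> ?D)"
      using C(1) cell_compact[OF ad sub] hausM compactin_imp_closedin by blast
    moreover have "K \<inter> U \<subseteq> ?D" using ball_subset_cball[of v "r/2"] by (auto simp: g(2) cell_def)
    then have "K \<inter> \<Union>(insert U \<F>) \<subseteq> C \<union> ?D" using C(3) by blast
    moreover have "C \<union> ?D \<subseteq> Q'" using Q'(2) sub' by blast
    ultimately show ?case using C(2) Q'(1,3)
      by (intro exI[of _ "C \<union> ?D"] exI[of _ \<Phi>'] exI[of _ Q']) blast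
  qed
  then obtain C \<Phi> Q where "K \<inter> \<Union>\<F> \<subseteq> C" "C \<subseteq> Q" "\<forall>y\<in>K \<inter> Q. ext_at \<Phi> y"
    by (elim exE conjE) (rule that)
  then show ?thesis using F(3) by (intro exI[of _ \<Phi>]) blast
qed

end

section \<open>Unions of plaques\<close>

text \<open>A member that meets the path component of \<open>a\<close> lies in it. So the members
  inside and those outside split the union into two disjoint sets, closed by finiteness, and
  connectedness excludes the second.\<close>

lemma path_connectedin_finite_Union:
  assumes fin: "finite \<P>" and P: "\<And>P. P \<in> \<P> \<Longrightarrow> closedin Z P \<and> path_connectedin Z P"
    and con: "connectedin Z (\<Union>\<P>)"
  shows "path_connectedin Z (\<Union>\<P>)"
proof -
  let ?K = "subtopology Z (\<Union>\<P>)"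
  have sub: "\<Union>\<P> \<subseteq> topspace Z" using con connectedin_subset_topspace by blast
  have tK: "topspace ?K = \<Union>\<P>" using sub by auto
  have "path_component_of ?K a b" if ab: "a \<in> \<Union>\<P>" "b \<in> \<Union>\<P>" for a b
  proof -
    define C where "C = path_component_of_set ?K a"
    define \<P>1 where "\<P>1 = {P \<in> \<P>. P \<inter> C \<noteq> {}}"
    have aC: "a \<in> C" unfolding C_def using ab tK by (simp add: path_component_of_refl)
    have PC: "P \<subseteq> C" if PP: "P \<in> \<P>1" for P
    proof -
      obtain z where z: "z \<in> P" "z \<in> C" and P': "P \<in> \<P>" using PP unfolding \<P>1_def by blast
      have "path_connectedin ?K P" using P[OF P'] P' by (auto simp: path_connectedin_subtopology)
      then have "P \<subseteq> path_component_of_set ?K z" using z(1) by (rule path_component_of_maximal)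
      moreover have "path_component_of ?K a = path_component_of ?K z"
        using z(2) unfolding C_def mem_Collect_eq by (subst (asm) path_component_of_equiv) blast
      ultimately show ?thesis unfolding C_def by simp
    qed
    have Csub: "C \<subseteq> \<Union>\<P>" unfolding C_def using path_component_of_subset_topspace[of ?K a] tK by blast
    have "closedin Z (\<Union>\<P>1)" by (rule closedin_Union) (use fin P in \<open>auto simp: \<P>1_def\<close>)
    moreover have "closedin Z (\<Union>(\<P> - \<P>1))" by (rule closedin_Union) (use fin P in auto)
    moreover have "\<Union>\<P> \<subseteq> \<Union>\<P>1 \<union> \<Union>(\<P> - \<P>1)" by blast
    moreover have "\<Union>\<P>1 \<inter> \<Union>(\<P> - \<P>1) \<inter> \<Union>\<P> = {}" using PC unfolding \<P>1_def by blast
    moreover have "\<Union>\<P>1 \<inter> \<Union>\<P> \<noteq> {}" using aC Csub unfolding \<P>1_def by blast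
    ultimately have "\<Union>(\<P> - \<P>1) \<inter> \<Union>\<P> = {}" using con unfolding connectedin_closedin by blast
    then have "b \<in> \<Union>\<P>1" using ab(2) by blast
    then show ?thesis using PC unfolding C_def by blast
  qed
  then have "path_connected_space ?K" unfolding path_connected_space_iff_path_component tK by blast
  then show ?thesis using sub by (simp add: path_connectedin_def)
qed

context matchbox_atlas
begin

lemma plaque_eq:
  assumes "c \<in> A" "w \<in> fc_mod c"
  shows "plaque M c w = (\<lambda>v. chart_pt c v w) ` ccube 1"
proof
  show "plaque M c w \<subseteq> (\<lambda>v. chart_pt c v w) ` ccube 1"
  proof
    fix q assume "q \<in> plaque M c w"
    then have q: "q \<in> M closure_of fc_dom c" "lcoord c q \<in> ccube 1" "tcoord c q = w"
      by (auto simp: plaque_def mem_Times_iff)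
    then have "chart_pt c (lcoord c q) w = q"
      using chart_pt_inv[OF assms(1), of q] closure_subset_ext[OF assms(1)] by auto
    then show "q \<in> (\<lambda>v. chart_pt c v w) ` ccube 1" using q(2) by (intro image_eqI[of _ _ "lcoord c q"]) auto
  qed
  show "(\<lambda>v. chart_pt c v w) ` ccube 1 \<subseteq> plaque M c w"
  proof
    fix q assume "q \<in> (\<lambda>v. chart_pt c v w) ` ccube 1"
    then obtain v where v: "v \<in> ccube 1" "q = chart_pt c v w" by blast
    have "v \<in> ocube 2" using v(1) ccube_1_subset_ocube_2 by blast
    then show "q \<in> plaque M c w" using v assms chart_pt_closure[OF assms(1) v(1) assms(2)] map_chart_pt(1)[OF assms(1) _ assms(2)]
      by (simp add: plaque_def)
  qed
qed

lemma plaque_closed_path_connected: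
  assumes "c \<in> A" "w \<in> fc_mod c"
  shows "closedin M (plaque M c w)" "path_connectedin M (plaque M c w)"
proof -
  have cont: "continuous_map (top_of_set (ccube 1)) M (\<lambda>v. chart_pt c v w)"
    by (rule continuous_map_from_subtopology_mono[OF chart_inv_slice_cont[OF assms] ccube_1_subset_ocube_2])
  have "compactin M (plaque M c w)" unfolding plaque_eq[OF assms]
    by (rule image_compactin[OF _ cont]) (simp add: compactin_subtopology ccube_def)
  then show "closedin M (plaque M c w)" using hausM compactin_imp_closedin by blast
  show "path_connectedin M (plaque M c w)" unfolding plaque_eq[OF assms]
    by (rule path_connectedin_continuous_map_image[OF cont])
      (simp add: path_connectedin_subtopology ccube_def convex_imp_path_connected)
qed

text \<open>The centres of the plaques of one chart have no accumulation point in the fine topology.\<close>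

lemma finite_plaques:
  assumes c: "c \<in> A" and K: "compactin (fine_topology M A) K"
  shows "finite {w \<in> fc_mod c. plaque M c w \<subseteq> K}"
proof -
  let ?W = "{w \<in> fc_mod c. plaque M c w \<subseteq> K}"
  define D where "D = (\<lambda>w. chart_pt c 0 w) ` ?W"
  have z: "(0 :: real ^ 'n) \<in> ocube 1" by (rule zero_in_ocube_1)
  have "D \<subseteq> K" unfolding D_def using plaque_eq[OF c] z ocube_subset_ccube by blast
  have "finite D"
  proof (rule ccontr)
    assume "infinite D"
    then have "K \<inter> fine_topology M A derived_set_of D \<noteq> {}"
      using compactin_imp_Bolzano_Weierstrass[OF K] \<open>D \<subseteq> K\<close> by blast
    then obtain y where y0: "y \<in> fine_topology M A derived_set_of D" by blast
    then have y: "y \<in> topspace M" by (simp add: in_derived_set_of topspace_fine)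
    have der: "\<exists>q. q \<noteq> y \<and> q \<in> D \<and> q \<in> T" if T: "y \<in> T" "openin (fine_topology M A) T" for T
      using y0 T unfolding in_derived_set_of by blast
    have Dc: "q \<in> fc_dom c \<and> lcoord c q = 0" if "q \<in> D" for q
      using that chart_pt_dom[OF c z] c z unfolding D_def by auto
    show False
    proof (cases "y \<in> fc_dom c")
      case True
      note dc = dom_coords[OF c True]
      \<comment> \<open>Isolates \<open>y\<close> from the other centres: the plaque through
        \<open>y\<close> contains a single centre, which is either \<open>y\<close> itself or is
        removed.\<close>
      let ?B = "if lcoord c y = 0 then ocube 1 else ocube 1 - {0}"
      let ?T = "{p \<in> fc_dom c. lcoord c p \<in> ?B \<and> tcoord c p = tcoord c y}"
      have T1: "openin (fine_topology M A) ?T"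
        by (rule fine_open_plaque[OF c _ _ dc(2)]) (auto simp: open_ocube open_delete)
      have T2: "y \<in> ?T" using True dc z by simp
      obtain q where q: "q \<noteq> y" "q \<in> D" "q \<in> ?T" using der[OF T2 T1] by (elim exE conjE) (rule that)
      then have "lcoord c q = 0" "q \<in> fc_dom c" "tcoord c q = tcoord c y" using Dc by auto
      moreover have "lcoord c y = 0" using q(3) \<open>lcoord c q = 0\<close> by (auto split: if_splits)
      ultimately show False using dom_eqI[OF c, of q y] True q(1) by simp
    next
      case False
      \<comment> \<open>All centres together form a compact subset of \<open>M\<close>, as the model
        is closed in the compact \<open>X\<close>; it lies in \<open>fc_dom c\<close> and so misses
        \<open>y\<close>.\<close>
      let ?Z = "(\<lambda>w. chart_pt c 0 w) ` fc_mod c"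
      have cont: "continuous_map (subtopology X (fc_mod c)) M (\<lambda>w. chart_pt c 0 w)"
        by (rule chart_pt_cont[OF c]) (auto simp: z continuous_map_from_subtopology)
      have "compactin X (fc_mod c)" using closedin_compact_space[OF compX mod_closed[OF c]] .
      then have "compactin M ?Z" by (intro image_compactin[OF _ cont]) (simp add: compactin_subtopology)
      then have "openin M (topspace M - ?Z)" using hausM compactin_imp_closedin by blast
      then have T1: "openin (fine_topology M A) (topspace M - ?Z)" by (rule openin_fine)
      have T2: "y \<in> topspace M - ?Z" using y False chart_pt_dom[OF c z] by auto
      obtain q where "q \<in> D" "q \<in> topspace M - ?Z" using der[OF T2 T1] by blast
      then show False unfolding D_def by blast
    qed
  qed
  moreover have "inj_on (\<lambda>w. chart_pt c 0 w) ?W"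
  proof (rule inj_onI)
    fix w w' assume w: "w \<in> ?W" "w' \<in> ?W" "chart_pt c 0 w = chart_pt c 0 w'"
    have "fc_map c (chart_pt c 0 w) = (0, w)" using w(1) by (intro coords_chart_pt[OF c z]) simp
    moreover have "fc_map c (chart_pt c 0 w') = (0, w')" using w(2) by (intro coords_chart_pt[OF c z]) simp
    ultimately show "w = w'" unfolding w(3) by simp
  qed
  ultimately show ?thesis unfolding D_def using finite_imageD by blast
qed

text \<open>Restricted leaves are path components, whereas a proper base is given as the image of a
  connected set. Compactness in the fine topology leaves only finitely many plaques in the union, so
  that connectedness can be upgraded.\<close>

lemma plaques_path_connectedin:
  fixes \<nu> :: nat
  assumes \<phi>: "\<And>i. i \<in> {1..\<nu>} \<Longrightarrow> \<phi> i \<in> A"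
    and \<P>: "\<P> \<subseteq> {plaque M (\<phi> i) w | i w. i \<in> {1..\<nu>} \<and> w \<in> fc_mod (\<phi> i)}"
    and K: "compactin (fine_topology M A) (\<Union>\<P>)" "connectedin M (\<Union>\<P>)"
  shows "path_connectedin M (\<Union>\<P>)"
proof (rule path_connectedin_finite_Union[OF _ _ K(2)])
  have "finite (\<Union>i\<in>{1..\<nu>}. plaque M (\<phi> i) ` {w \<in> fc_mod (\<phi> i). plaque M (\<phi> i) w \<subseteq> \<Union>\<P>})"
    by (intro finite_UN_I finite_atLeastAtMost finite_imageI finite_plaques[OF \<phi> K(1)])
  moreover have "\<P> \<subseteq> (\<Union>i\<in>{1..\<nu>}. plaque M (\<phi> i) ` {w \<in> fc_mod (\<phi> i). plaque M (\<phi> i) w \<subseteq> \<Union>\<P>})"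
  proof
    fix P assume P: "P \<in> \<P>"
    then obtain i w where iw: "i \<in> {1..\<nu>}" "w \<in> fc_mod (\<phi> i)" "P = plaque M (\<phi> i) w" using \<P> by blast
    then show "P \<in> (\<Union>i\<in>{1..\<nu>}. plaque M (\<phi> i) ` {w \<in> fc_mod (\<phi> i). plaque M (\<phi> i) w \<subseteq> \<Union>\<P>})" using P by blast
  qed
  ultimately show "finite \<P>" using finite_subset by blast
  fix P assume "P \<in> \<P>"
  then obtain i w where iw: "i \<in> {1..\<nu>}" "w \<in> fc_mod (\<phi> i)" "P = plaque M (\<phi> i) w" using \<P> by blast
  then show "closedin M P \<and> path_connectedin M P"
    using plaque_closed_path_connected[OF \<phi>[OF iw(1)] iw(2)] by simp
qed

end

section \<open>Uniformity over the compact base\<close>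

lemma continuous_map_limitin:
  assumes "\<And>z. z \<in> topspace Z \<inter> T \<Longrightarrow> limitin Y f (f z) (nhdsin Z z)"
  shows "continuous_map (subtopology Z T) Y f"
  unfolding continuous_map_def
proof (intro conjI allI impI)
  show "f \<in> topspace (subtopology Z T) \<rightarrow> topspace Y" using assms limitin_topspace by fastforce
  fix U assume U: "openin Y U"
  show "openin (subtopology Z T) {z \<in> topspace (subtopology Z T). f z \<in> U}"
  proof (subst openin_subopen, safe)
    fix z assume z: "z \<in> topspace (subtopology Z T)" "f z \<in> U"
    then have zZ: "z \<in> topspace Z" "z \<in> T" by auto
    have "\<forall>\<^sub>F z' in nhdsin Z z. f z' \<in> U" using assms[of z] zZ U z(2) by (auto simp: limitin_def)
    then obtain N where N: "openin Z N" "z \<in> N" "\<And>z'. z' \<in> N \<Longrightarrow> f z' \<in> U"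
      by (rule eventually_nhdsin_obtain[OF _ zZ(1)]) (rule that)
    have "openin (subtopology Z T) (N \<inter> T)" using N(1) by (auto simp: openin_subtopology)
    moreover have "N \<inter> T \<subseteq> {z \<in> topspace (subtopology Z T). f z \<in> U}"
      using N(3) openin_subset[OF N(1)] by auto
    ultimately show "\<exists>V. openin (subtopology Z T) V \<and> z \<in> V \<and> V \<subseteq> {z \<in> topspace (subtopology Z T). f z \<in> U}"
      using N(2) zZ by blast
  qed
qed

lemma compactin_eventually:
  assumes K: "compactin Z K"
    and loc: "\<And>y. y \<in> K \<Longrightarrow> \<exists>U. openin Z U \<and> y \<in> U \<and> (\<forall>\<^sub>F s in F. \<forall>b\<in>K \<inter> U. R b s)"
  shows "\<forall>\<^sub>F s in F. \<forall>b\<in>K. R b s"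
proof -
  have "\<forall>y\<in>K. \<exists>U. openin Z U \<and> y \<in> U \<and> (\<forall>\<^sub>F s in F. \<forall>b\<in>K \<inter> U. R b s)" using loc by blast
  then obtain U where U: "\<forall>y\<in>K. openin Z (U y) \<and> y \<in> U y \<and> (\<forall>\<^sub>F s in F. \<forall>b\<in>K \<inter> U y. R b s)"
    unfolding bchoice_iff by (elim exE) (rule that)
  have "\<forall>V\<in>U ` K. openin Z V" "K \<subseteq> \<Union>(U ` K)" using U by blast+
  then obtain \<F> where "finite \<F>" "\<F> \<subseteq> U ` K" "K \<subseteq> \<Union>\<F>" using K unfolding compactin_def by meson
  then obtain J where J: "finite J" "J \<subseteq> K" "K \<subseteq> \<Union>(U ` J)" by (metis finite_subset_image)
  have "\<forall>\<^sub>F s in F. \<forall>y\<in>J. \<forall>b\<in>K \<inter> U y. R b s" by (rule eventually_ball_finite[OF J(1)]) (use J(2) U in blast)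
  then show ?thesis by (rule eventually_mono) (use J(3) in blast)
qed

context transverse_projection
begin

text \<open>A tube argument: finitely many of the rectangles of \<open>near_rect\<close> cover
  \<open>K\<close>.\<close>

lemma near_compact:
  assumes "\<And>y. y \<in> K \<Longrightarrow> near y R"
  shows "\<forall>\<^sub>F s in nhdsin X w\<^sub>0. \<forall>b\<in>K. R b s"
proof (rule compactin_eventually[OF K])
  fix y assume y: "y \<in> K"
  obtain U S where U: "openin M U" "y \<in> U" and S: "openin X S" "w\<^sub>0 \<in> S" "\<forall>b\<in>K \<inter> U. \<forall>s\<in>S. R b s"
    using assms[OF y] unfolding near_rect[OF y] by (elim exE conjE) (rule that)
  have "\<forall>\<^sub>F s in nhdsin X w\<^sub>0. \<forall>b\<in>K \<inter> U. R b s" by (rule eventually_nhdsinI[OF S(1,2)]) (use S(3) in blast)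
  then show "\<exists>U. openin M U \<and> y \<in> U \<and> (\<forall>\<^sub>F s in nhdsin X w\<^sub>0. \<forall>b\<in>K \<inter> U. R b s)" using U by blast
qed

text \<open>For distinct points the images are separated by disjoint neighbourhoods; near the
  diagonal strictness with factor 1/2 applies. \<open>y'\<close> keeps its own neighbourhood
  \<open>U\<close>, so that compactness can be used once more in the variable
  \<open>b'\<close>.\<close>

lemma near_injective_pair:
  assumes y: "y \<in> K" "y' \<in> K" and e: "ext_at \<Phi> y" "ext_at \<Phi> y'"
  shows "\<exists>U. openin M U \<and> y' \<in> U \<and> near y (\<lambda>b s. b \<in> K \<longrightarrow> (\<forall>b'\<in>K \<inter> U. \<Phi> b s = \<Phi> b' s \<longrightarrow> b = b'))"
proof (cases "y = y'")
  case False
  then obtain D D' where D: "openin M D" "openin M D'" "y \<in> D" "y' \<in> D'" "disjnt D D'"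
    using hausM y K_topspace unfolding Hausdorff_space_def by metis
  have "near y' (\<lambda>b s. \<Phi> b s \<in> D')" by (rule ext_at_near[OF e(2) y(2) eventually_nhdsinI[OF D(2,4)]])
  then obtain U S where US: "openin M U" "y' \<in> U" "openin X S" "w\<^sub>0 \<in> S" "\<forall>b\<in>K \<inter> U. \<forall>s\<in>S. \<Phi> b s \<in> D'"
    unfolding near_rect[OF y(2)] by (elim exE conjE) (rule that)
  have "near y (\<lambda>b s. \<Phi> b s \<in> D \<and> s \<in> S)"
    by (intro near_conj ext_at_near[OF e(1) y(1) eventually_nhdsinI[OF D(1,3)]]
        near_trans[OF y(1) eventually_nhdsinI[OF US(3,4)]])
  then have "near y (\<lambda>b s. b \<in> K \<longrightarrow> (\<forall>b'\<in>K \<inter> U. \<Phi> b s = \<Phi> b' s \<longrightarrow> b = b'))"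
    by (rule near_mono) (use US(5) D(5) in \<open>fastforce simp: disjnt_iff\<close>)
  then show ?thesis using US(1,2) by blast
next
  case True
  obtain c B W S0 \<tau> where ad: "adapted c B W S0 \<tau>" "y \<in> cell c B W" by (rule adapted_exists[OF y(1)])
  have c: "c \<in> A" "y \<in> fc_dom c" using adapted_simps(1)[OF ad(1)] ad(2) by (auto simp: cell_def)
  have "strict_at c \<Phi> y" by (rule strict_at_change_chart[OF y(1) e(1) c])
  then obtain Q where Q: "near y Q" "\<And>b b' s. \<lbrakk>Q b s; Q b' s\<rbrakk> \<Longrightarrow>
     almost_id c (1/2) \<Phi> s b b'" unfolding strict_at_def by (meson half_gt_zero zero_less_one)
  have "near y (\<lambda>b s. Q b s \<and> b \<in> cell c B W)"
    by (intro near_conj Q(1) near_base[OF y(1) eventually_nhdsinI[OF cell_open[OF ad(1)] ad(2)]])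
  then obtain U S where US: "openin M U" "y \<in> U" "openin X S" "w\<^sub>0 \<in> S" "\<forall>b\<in>K \<inter> U. \<forall>s\<in>S. Q b s \<and> b \<in> cell c B W"
    unfolding near_rect[OF y(1)] by (elim exE conjE) (rule that)
  have "b = b'" if b: "b \<in> K \<inter> U" "b' \<in> K \<inter> U" "s \<in> S" "\<Phi> b s = \<Phi> b' s" for b b' s
  proof -
    have q: "Q b s" "Q b' s" "b \<in> cell c B W" "b' \<in> cell c B W" using b(1-3) US(5) by auto
    \<comment> \<open>Equal images cancel in the strictness estimate, so this norm is at most half
      of itself.\<close>
    have "norm (lcoord c b - lcoord c b') \<le> 1/2 * norm (lcoord c b - lcoord c b')"
      using Q(2)[OF q(1,2)] b(4) by (simp add: norm_minus_commute)
    then have "norm (lcoord c b - lcoord c b') \<le> 0" by linarith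
    then have "lcoord c b = lcoord c b'" by simp
    moreover have "tcoord c b = tcoord c b'" using cell_tcoord[OF ad(1)] q b(1,2) by auto
    ultimately show ?thesis using dom_eqI[OF c(1), of b b'] q by (auto simp: cell_def)
  qed
  then have "near y (\<lambda>b s. b \<in> K \<longrightarrow> (\<forall>b'\<in>K \<inter> U. \<Phi> b s = \<Phi> b' s \<longrightarrow> b = b'))"
    unfolding near_rect[OF y(1)] using US(1-4) by blast
  then show ?thesis using US(1,2) True by blast
qed

lemma near_injective:
  assumes y: "y \<in> K" and e: "\<And>y. y \<in> K \<Longrightarrow> ext_at \<Phi> y"
  shows "near y (\<lambda>b s. \<forall>b'\<in>K. \<Phi> b s = \<Phi> b' s \<longrightarrow> b = b')"
proof -
  have "near y (\<lambda>b s. \<forall>b'\<in>K. b \<in> K \<longrightarrow> \<Phi> b s = \<Phi> b' s \<longrightarrow> b = b')"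
    unfolding near_def
  proof (rule compactin_eventually[OF K])
    fix y' assume y': "y' \<in> K"
    obtain U where U: "openin M U" "y' \<in> U" "near y (\<lambda>b s. b \<in> K \<longrightarrow> (\<forall>b'\<in>K \<inter> U. \<Phi> b s = \<Phi> b' s \<longrightarrow> b = b'))"
      using near_injective_pair[OF y y' e[OF y] e[OF y']] by (elim exE conjE) (rule that)
    have "\<forall>\<^sub>F z in nhdsin KX (y, w\<^sub>0). \<forall>b'\<in>K \<inter> U. fst z \<in> K \<longrightarrow> \<Phi> (fst z) (snd z) = \<Phi> b' (snd z) \<longrightarrow> fst z = b'"
      using U(3) unfolding near_def by eventually_elim blast
    then show "\<exists>U. openin M U \<and> y' \<in> U \<and> (\<forall>\<^sub>F z in nhdsin KX (y, w\<^sub>0). \<forall>b'\<in>K \<inter> U.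
        fst z \<in> K \<longrightarrow> \<Phi> (fst z) (snd z) = \<Phi> b' (snd z) \<longrightarrow> fst z = b')" using U(1,2) by blast
  qed
  with near_K[OF y] show ?thesis unfolding near_def by eventually_elim blast
qed

text \<open>Feeds \<open>continuous_map_fine\<close>: in an adapted cell
  \<open>k (\<Phi> b' s) = s\<close> forces \<open>\<Phi> b' s\<close> onto the plaque over
  \<open>\<tau> s\<close>, the same for all \<open>b'\<close>.\<close>

lemma near_plaque:
  assumes y: "y \<in> K" and e: "ext_at \<Phi> y"
  shows "near y (\<lambda>b s. \<exists>U c w. openin M U \<and> b \<in> U \<and> c \<in> A \<and>
    (\<forall>b'\<in>K \<inter> U. \<Phi> b' s \<in> fc_dom c \<and> tcoord c (\<Phi> b' s) = w))"
proof -
  obtain c B W S0 \<tau> where ad: "adapted c B W S0 \<tau>" "y \<in> cell c B W" by (rule adapted_exists[OF y])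
  have "near y (\<lambda>b s. \<Phi> b w\<^sub>0 = b \<and> k (\<Phi> b s) = s \<and> cont_at \<Phi> b s)" using e by (simp add: ext_at_def)
  moreover have "near y (\<lambda>b s. \<Phi> b s \<in> cell c B W)"
    by (rule ext_at_near[OF e y eventually_nhdsinI[OF cell_open[OF ad(1)] ad(2)]])
  ultimately have "near y (\<lambda>b s. k (\<Phi> b s) = s \<and> \<Phi> b s \<in> cell c B W)"
    unfolding near_def by eventually_elim blast
  then obtain U S where US: "openin M U" "y \<in> U" "openin X S" "w\<^sub>0 \<in> S" "\<forall>b\<in>K \<inter> U. \<forall>s\<in>S. k (\<Phi> b s) = s \<and> \<Phi> b s \<in> cell c B W"
    unfolding near_rect[OF y] by (elim exE conjE) (rule that)
  have "\<exists>U c w. openin M U \<and> b \<in> U \<and> c \<in> A \<and> (\<forall>b'\<in>K \<inter> U. \<Phi> b' s \<in> fc_dom c \<and> tcoord c (\<Phi> b' s) = w)"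
    if bs: "b \<in> K \<inter> U" "s \<in> S" for b s
  proof (intro exI conjI ballI)
    show "openin M U" "b \<in> U" "c \<in> A" using US bs adapted_simps(1)[OF ad(1)] by auto
    fix b' assume "b' \<in> K \<inter> U"
    then have b': "k (\<Phi> b' s) = s" "\<Phi> b' s \<in> cell c B W" using US(5) bs(2) by auto
    show "\<Phi> b' s \<in> fc_dom c" using b'(2) by (simp add: cell_def)
    show "tcoord c (\<Phi> b' s) = \<tau> s" using cell_k(1)[OF ad(1) b'(2)] b'(1) by simp
  qed
  then show ?thesis unfolding near_rect[OF y] using US(1-4) by (intro exI[of _ U] exI[of _ S]) blast
qed

text \<open>Injectivity falls into two parts: \<open>k\<close> recovers \<open>s\<close> from the
  image, and for fixed \<open>s\<close> the map is injective by \<open>near_injective\<close>. The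
  local properties are bundled in one \<open>R\<close>, so that a single use of
  \<open>near_compact\<close> yields a common \<open>S\<close>.\<close>

lemma big_box:
  obtains \<Phi> S where "openin X S" "w\<^sub>0 \<in> S" "\<And>b. b \<in> K \<Longrightarrow> \<Phi> b w\<^sub>0 = b"
    "\<And>b s. \<lbrakk>b \<in> K; s \<in> S\<rbrakk> \<Longrightarrow> k (\<Phi> b s) = s"
    "continuous_map (prod_topology (subtopology M K) (subtopology X S)) M (\<lambda>z. \<Phi> (fst z) (snd z))"
    "inj_on (\<lambda>z. \<Phi> (fst z) (snd z)) (K \<times> S)"
    "\<And>s. s \<in> S \<Longrightarrow> continuous_map (subtopology M K) (fine_topology M A) (\<lambda>b. \<Phi> b s)"
proof -
  obtain \<Phi> where \<Phi>: "\<And>y. y \<in> K \<Longrightarrow> ext_at \<Phi> y" using extension_exists by blast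
  define R where "R b s \<longleftrightarrow> (\<Phi> b w\<^sub>0 = b \<and> k (\<Phi> b s) = s \<and> cont_at \<Phi> b s) \<and>
    (\<forall>b'\<in>K. \<Phi> b s = \<Phi> b' s \<longrightarrow> b = b') \<and>
    (\<exists>U c w. openin M U \<and> b \<in> U \<and> c \<in> A \<and> (\<forall>b'\<in>K \<inter> U. \<Phi> b' s \<in> fc_dom c \<and> tcoord c (\<Phi> b' s) = w))" for b s
  have "near y R" if y: "y \<in> K" for y
  proof -
    have "near y (\<lambda>b s. \<Phi> b w\<^sub>0 = b \<and> k (\<Phi> b s) = s \<and> cont_at \<Phi> b s)" using \<Phi>[OF y] by (simp add: ext_at_def)
    from near_conj[OF this near_conj[OF near_injective[OF y \<Phi>] near_plaque[OF y \<Phi>[OF y]]]]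
    show ?thesis unfolding R_def by simp
  qed
  then have "\<forall>\<^sub>F s in nhdsin X w\<^sub>0. \<forall>b\<in>K. R b s" by (rule near_compact)
  then obtain S where S: "openin X S" "w\<^sub>0 \<in> S" and RS: "\<And>s. s \<in> S \<Longrightarrow> \<forall>b\<in>K. R b s"
    by (rule eventually_nhdsin_obtain[OF _ w\<^sub>0]) (rule that)
  have R: "R b s" if "b \<in> K" "s \<in> S" for b s using RS[OF that(2)] that(1) by (rule bspec)
  have cont: "continuous_map (prod_topology (subtopology M K) (subtopology X S)) M (\<lambda>z. \<Phi> (fst z) (snd z))"
  proof -
    have "continuous_map (subtopology KX (K \<times> S)) M (\<lambda>z. \<Phi> (fst z) (snd z))"
    proof (rule continuous_map_limitin)
      fix z assume z: "z \<in> topspace KX \<inter> K \<times> S"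
      then have "R (fst z) (snd z)" by (intro R) auto
      then show "limitin M (\<lambda>z. \<Phi> (fst z) (snd z)) (\<Phi> (fst z) (snd z)) (nhdsin KX z)"
        by (simp add: R_def cont_at_def)
    qed
    then show ?thesis by (simp add: subtopology_Times subtopology_subtopology)
  qed
  have slice: "continuous_map (subtopology M K) (fine_topology M A) (\<lambda>b. \<Phi> b s)" if s: "s \<in> S" for s
  proof (rule continuous_map_fine)
    have "continuous_map (subtopology M K) (prod_topology (subtopology M K) (subtopology X S)) (\<lambda>b. (b, s))"
      using s openin_subset[OF S(1)] by (auto simp: continuous_map_pairwise o_def)
    from continuous_map_compose[OF this cont] show "continuous_map (subtopology M K) M (\<lambda>b. \<Phi> b s)" by (simp add: o_def)
    fix b assume "b \<in> topspace (subtopology M K)"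
    then have b: "b \<in> K" by simp
    then have "R b s" using R s by blast
    then obtain U c w where U: "openin M U" "b \<in> U" "c \<in> A" "\<forall>b'\<in>K \<inter> U. \<Phi> b' s \<in> fc_dom c \<and> tcoord c (\<Phi> b' s) = w"
      unfolding R_def by (elim exE conjE) (rule that)
    have "openin (subtopology M K) (K \<inter> U)" using U(1) by (simp add: openin_subtopology_Int2)
    then show "\<exists>U c w. openin (subtopology M K) U \<and> b \<in> U \<and> c \<in> A \<and>
        (\<forall>b'\<in>U. \<Phi> b' s \<in> fc_dom c \<and> tcoord c (\<Phi> b' s) = w)"
      using U b by (intro exI[of _ "K \<inter> U"] exI[of _ c] exI[of _ w]) simp
  qed
  show ?thesis
  proof (rule that[OF S _ _ cont _ slice])
    show "\<Phi> b w\<^sub>0 = b" if "b \<in> K" for b using R[OF that S(2)] by (simp add: R_def)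
    show ks: "k (\<Phi> b s) = s" if "b \<in> K" "s \<in> S" for b s using R[OF that] by (simp add: R_def)
    show "inj_on (\<lambda>z. \<Phi> (fst z) (snd z)) (K \<times> S)"
    proof (rule inj_onI)
      fix z z' assume z: "z \<in> K \<times> S" "z' \<in> K \<times> S" "\<Phi> (fst z) (snd z) = \<Phi> (fst z') (snd z')"
      have "snd z = snd z'" using ks[of "fst z" "snd z"] ks[of "fst z'" "snd z'"] z by (metis mem_Times_iff)
      moreover have "fst z = fst z'"
      proof -
        have "R (fst z) (snd z)" "fst z' \<in> K" using z R by auto
        then show ?thesis using z(3) \<open>snd z = snd z'\<close> unfolding R_def by simp
      qed
      ultimately show "z = z'" by (simp add: prod_eq_iff)
    qed
  qed
qed

end

section \<open>Cantor spaces\<close>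

lemma cantor_space_homeomorphic:
  assumes C: "cantor_space Y" and h: "homeomorphic_map Y Z h"
  shows "cantor_space Z"
  unfolding cantor_space_def
proof (intro conjI)
  have hs: "Y homeomorphic_space Z" using homeomorphic_map_imp_homeomorphic_space[OF h] .
  have im: "h ` topspace Y = topspace Z" by (rule homeomorphic_imp_surjective_map[OF h])
  show "topspace Z \<noteq> {}" using C im by (auto simp: cantor_space_def)
  show "compact_space Z" using C homeomorphic_compact_space[OF hs] by (simp add: cantor_space_def)
  show "metrizable_space Z" using C homeomorphic_metrizable_space[OF hs] by (simp add: cantor_space_def)
  obtain g where g: "homeomorphic_maps Y Z h g" using h by (auto simp: homeomorphic_map_maps)
  show "totally_disconnected Z" unfolding totally_disconnected_def
  proof (intro allI impI)
    fix S assume S: "connectedin Z S"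
    have gc: "continuous_map Z Y g" and hg: "\<And>z. z \<in> topspace Z \<Longrightarrow> h (g z) = z"
      using g by (auto simp: homeomorphic_maps_def)
    have "connectedin Y (g ` S)" by (rule connectedin_continuous_map_image[OF gc S])
    then obtain a where a: "g ` S \<subseteq> {a}" using C unfolding cantor_space_def totally_disconnected_def by blast
    have "S \<subseteq> {h a}"
    proof
      fix z assume z: "z \<in> S"
      then have "h (g z) = z" using hg connectedin_subset_topspace[OF S] by blast
      moreover have "g z = a" using a z by blast
      ultimately show "z \<in> {h a}" by simp
    qed
    then show "\<exists>a. S \<subseteq> {a}" by blast
  qed
  show "Z derived_set_of topspace Z = topspace Z"
    using homeomorphic_map_derived_set_of[OF h subset_refl] im C by (simp add: cantor_space_def)
qed

text \<open>Perfectness is inherited because \<open>S\<close> is open: a neighbourhood in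
  \<open>S\<close> is also one in \<open>T\<close>. Closedness gives compactness.\<close>

lemma cantor_space_clopen_subset:
  assumes C: "cantor_space (subtopology X T)" and T: "openin X T" and S: "openin X S" "closedin X S" "S \<subseteq> T" "S \<noteq> {}"
  shows "cantor_space (subtopology X S)"
proof -
  have eq: "subtopology X S = subtopology (subtopology X T) S"
    using S(3) by (simp add: subtopology_subtopology Int_absorb1)
  have SX: "S \<subseteq> topspace X" "T \<subseteq> topspace X" using S T openin_subset by blast+
  show ?thesis unfolding cantor_space_def
  proof (intro conjI)
    show "topspace (subtopology X S) \<noteq> {}" using S(4) SX by auto
    have "closedin (subtopology X T) S"
      using S(2,3) by (metis closedin_subset_topspace)
    then show "compact_space (subtopology X S)"
      unfolding eq using C closedin_compact_space compact_space_subtopology unfolding cantor_space_def by blast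
    show "metrizable_space (subtopology X S)"
      unfolding eq using C metrizable_space_subtopology unfolding cantor_space_def by blast
    show "totally_disconnected (subtopology X S)" unfolding totally_disconnected_def
    proof (intro allI impI)
      fix R assume "connectedin (subtopology X S) R"
      then have "connectedin (subtopology X T) R" unfolding eq by (simp add: connectedin_subtopology)
      then show "\<exists>a. R \<subseteq> {a}" using C unfolding cantor_space_def totally_disconnected_def by blast
    qed
    have "s \<in> subtopology X S derived_set_of topspace (subtopology X S)" if s: "s \<in> S" for s
      unfolding in_derived_set_of
    proof (intro conjI allI impI)
      show "s \<in> topspace (subtopology X S)" using s SX by auto
      fix U assume U: "s \<in> U \<and> openin (subtopology X S) U"
      then have "openin X U" using S(1) openin_trans_full by blast
      then have oU: "openin (subtopology X T) U" using U S(3) openin_imp_subset[of X S U]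
        by (metis openin_subset_topspace_eq openin_subtopology_Int2 inf.absorb2 order_trans)
      have "s \<in> subtopology X T derived_set_of topspace (subtopology X T)"
        using C s S(3) SX unfolding cantor_space_def by auto
      then obtain y where y: "y \<noteq> s" "y \<in> U" unfolding in_derived_set_of using oU U by blast
      moreover have "y \<in> topspace (subtopology X S)" using U y openin_subset by blast
      ultimately show "\<exists>y. y \<noteq> s \<and> y \<in> topspace (subtopology X S) \<and> y \<in> U" by blast
    qed
    then show "subtopology X S derived_set_of topspace (subtopology X S) = topspace (subtopology X S)"
      using derived_set_of_subset_topspace[of "subtopology X S"] by auto
  qed
qed

lemma compact_continuous_inj_embedding:
  assumes "compact_space Y" "Hausdorff_space Z" "continuous_map Y Z f" "inj_on f (topspace Y)"
  shows "embedding_map Y Z f"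
  using assms by (simp add: injective_closed_imp_embedding_map T1_Spaces.continuous_imp_closed_map)

context matchbox_atlas
begin

text \<open>By \<open>slice\<close> each image of \<open>K\<close> is path connected in the fine
  topology. Conversely, along a path the second component of the inverse of \<open>F\<close> is
  continuous into the totally disconnected \<open>X\<close>, hence constant, and the path stays in
  its slice.\<close>

lemma restricted_leaves_box:
  assumes emb: "embedding_map (prod_topology (subtopology M K) (subtopology X S)) M F"
    and KM: "K \<subseteq> topspace M" and SX: "S \<subseteq> topspace X" and K: "path_connectedin M K" "K \<noteq> {}"
    and slice: "\<And>s. s \<in> S \<Longrightarrow> continuous_map (subtopology M K) (fine_topology M A) (\<lambda>b. F (b, s))"
  shows "restricted_leaves M A (F ` (K \<times> S)) = {F ` (K \<times> {s}) | s. s \<in> S}"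
proof -
  let ?Z = "prod_topology (subtopology M K) (subtopology X S)"
  let ?N = "F ` (K \<times> S)"
  let ?L = "subtopology (fine_topology M A) ?N"
  have tZ: "topspace ?Z = K \<times> S" using KM SX by auto
  have "homeomorphic_map ?Z (subtopology M ?N) F" using emb unfolding embedding_map_def tZ .
  then obtain G where G: "homeomorphic_maps ?Z (subtopology M ?N) F G" by (auto simp: homeomorphic_map_maps)
  have FG: "G (F z) = z" if "z \<in> K \<times> S" for z using G that tZ unfolding homeomorphic_maps_def by blast
  have "continuous_map ?Z M F" using G by (auto simp: homeomorphic_maps_def continuous_map_in_subtopology)
  then have NM: "?N \<subseteq> topspace M" using tZ by (auto simp: continuous_map_def Pi_iff)
  then have tL: "topspace ?L = ?N" by (auto simp: topspace_fine)
  have "continuous_map ?L (subtopology M ?N) (\<lambda>z. z)"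
    using continuous_map_from_subtopology[OF continuous_map_fine_id, of ?N] tL
    by (auto simp: continuous_map_in_subtopology)
  moreover have "continuous_map (subtopology M ?N) X (snd \<circ> G)"
  proof -
    have "continuous_map (subtopology M ?N) ?Z G" using G by (simp add: homeomorphic_maps_def)
    then show ?thesis using continuous_map_snd_of continuous_map_in_subtopology by blast
  qed
  ultimately have sG: "continuous_map ?L X (snd \<circ> G)" using continuous_map_compose by (fastforce simp: o_def)
  have comp: "path_component_of_set ?L (F (b, s)) = F ` (K \<times> {s})" if bs: "b \<in> K" "s \<in> S" for b s
  proof
    have "path_connectedin (fine_topology M A) ((\<lambda>b. F (b, s)) ` K)"
      by (rule path_connectedin_continuous_map_image[OF slice[OF bs(2)]]) (use K in \<open>simp add: path_connectedin_subtopology\<close>)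
    moreover have "(\<lambda>b. F (b, s)) ` K = F ` (K \<times> {s})" by force
    ultimately have "path_connectedin ?L (F ` (K \<times> {s}))" using bs(2) by (auto simp: path_connectedin_subtopology)
    then show "F ` (K \<times> {s}) \<subseteq> path_component_of_set ?L (F (b, s))"
      by (rule path_component_of_maximal) (use bs in blast)
    show "path_component_of_set ?L (F (b, s)) \<subseteq> F ` (K \<times> {s})"
    proof
      fix z assume "z \<in> path_component_of_set ?L (F (b, s))"
      then obtain \<gamma> where \<gamma>: "pathin ?L \<gamma>" "\<gamma> 0 = F (b, s)" "\<gamma> 1 = z"
        by (auto simp: path_component_of_def)
      have "z \<in> ?N" using path_finish_in_topspace[OF \<gamma>(1)] \<gamma>(3) tL by simp
      then obtain b' s' where z: "b' \<in> K" "s' \<in> S" "z = F (b', s')" by blast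
      have con: "connectedin X ((snd \<circ> G) ` (\<gamma> ` {0..1}))"
        by (rule connectedin_continuous_map_image[OF sG connectedin_path_image[OF \<gamma>(1)]])
      have "(snd \<circ> G) (\<gamma> 0) = (snd \<circ> G) (\<gamma> 1)"
        by (rule totally_disconnected_connected_eq[OF tdX con]; intro imageI) auto
      moreover have "(snd \<circ> G) (\<gamma> 0) = s" "(snd \<circ> G) (\<gamma> 1) = s'" using FG bs z \<gamma> by auto
      ultimately have "s = s'" by simp
      then show "z \<in> F ` (K \<times> {s})" using z by blast
    qed
  qed
  show ?thesis
  proof
    show "restricted_leaves M A ?N \<subseteq> {F ` (K \<times> {s}) | s. s \<in> S}"
    proof
      fix P assume "P \<in> restricted_leaves M A ?N"
      then obtain b s where "b \<in> K" "s \<in> S" "P = path_component_of_set ?L (F (b, s))"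
        unfolding restricted_leaves_def path_components_of_def tL by blast
      then show "P \<in> {F ` (K \<times> {s}) | s. s \<in> S}" using comp by blast
    qed
    show "{F ` (K \<times> {s}) | s. s \<in> S} \<subseteq> restricted_leaves M A ?N"
    proof
      fix P assume "P \<in> {F ` (K \<times> {s}) | s. s \<in> S}"
      then obtain s where s: "s \<in> S" "P = F ` (K \<times> {s})" by blast
      obtain b where "b \<in> K" using K(2) by blast
      then have "P = path_component_of_set ?L (F (b, s))" "F (b, s) \<in> topspace ?L" using comp s tL by auto
      then show "P \<in> restricted_leaves M A ?N" unfolding restricted_leaves_def path_components_of_def by blast
    qed
  qed
qed

end

section \<open>Assembly of the box in the manifold\<close>

lemma matchbox_manifold_atlas:
  assumes "matchbox_manifold M X A g"
  shows "smooth_matchbox_atlas M X A"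
proof -
  have F: "foliated_space M X A" and S: "\<forall>c\<in>A. \<forall>d\<in>A. smooth_family (subtopology X (X interior_of fc_mod c))
        (transition_dom c d) (transition c d)"
    and td: "totally_disconnected X" and clo: "\<forall>c\<in>A. openin X (fc_mod c) \<and> closedin X (fc_mod c)"
    using assms by (auto simp: matchbox_manifold_def smooth_foliated_space_def)
  show ?thesis
  proof
    show "\<exists>c\<in>A. y \<in> fc_dom c" if "y \<in> topspace M" for y using F that unfolding foliated_space_def by blast
    show "smooth_family (subtopology X (fc_mod c)) (transition_dom c d) (transition c d)"
      if "c \<in> A" "d \<in> A" for c d using S clo that by (metis interior_of_openin)
  qed (use F td clo in \<open>auto simp: foliated_space_def\<close>)
qed

theorem theorem1p3:
  fixes M :: "'m topology" and X :: "'x topology"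
    and A :: "('m, 'n::finite, 'x) fchart set"
    and g :: "('m, 'n, 'x) fchart \<Rightarrow> 'x \<Rightarrow> real ^ 'n \<Rightarrow> real ^ 'n ^ 'n"
    and lam :: real and \<nu> :: nat and \<phi> :: "nat \<Rightarrow> ('m, 'n, 'x) fchart"
    and x :: 'm and E :: "'e topology" and e :: 'e and p :: "'e \<Rightarrow> 'm" and K :: "'m set"
  assumes "matchbox_manifold M X A g"
    and "minimal_foliation M A"
    and "\<forall>c\<in>A. cantor_space (subtopology X (fc_mod c))"
    and "regular_covering M A g lam \<nu> \<phi>"
    and "x \<in> topspace M"
    and "holonomy_covering M X A \<nu> \<phi> x E e p"
    and "proper_base M A \<nu> \<phi> x E p K"
  shows "\<exists>V \<Phi> N.
     clopen_transversal M X \<nu> \<phi> V \<and> x \<in> V \<and>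
     embedding_map (prod_topology (subtopology M K) (subtopology M V)) M \<Phi> \<and>
     N = \<Phi> ` (K \<times> V) \<and>
     foliated_on M A K V \<Phi> \<and>
     (\<forall>y\<in>K. \<Phi> (y, x) = y) \<and>
     restricted_leaves M A N = {\<Phi> ` (K \<times> {v}) | v. v \<in> V} \<and>
     continuous_family_of_cantor_transversals M A K V \<Phi> N"
proof -
  interpret smooth_matchbox_atlas M X A by (rule matchbox_manifold_atlas[OF assms(1)])
  have \<phi>A: "\<phi> i \<in> A" if "i \<in> {1..\<nu>}" for i using assms(4) that by (auto simp: regular_covering_def)
  have "x \<in> (\<Union>i\<in>{1..\<nu>}. fc_dom (\<phi> i))" using assms(4,5) by (simp add: regular_covering_def)
  then obtain i where i: "i \<in> {1..\<nu>}" "x \<in> fc_dom (\<phi> i)" by blast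
  interpret holonomy_cover M X A \<nu> \<phi> x E e p i
    by unfold_locales (use \<phi>A i assms(6) in auto)
  define w where "w = tcoord (\<phi> i) x"
  define \<xi> where "\<xi> = lcoord (\<phi> i) x"
  have ci: "\<phi> i \<in> A" using \<phi>A i by blast
  have w: "w \<in> fc_mod (\<phi> i)" and \<xi>: "\<xi> \<in> ocube 1" and x_eq: "chart_pt (\<phi> i) \<xi> w = x"
    using dom_coords[OF ci i(2)] by (simp_all add: w_def \<xi>_def)
  obtain K' where K': "connectedin E K'" "compactin E K'" "inj_on p K'" "p ` K' = K" and xK: "x \<in> K"
    using assms(7) unfolding proper_base_def by blast
  obtain \<P> where \<P>: "\<P> \<subseteq> {plaque M (\<phi> i) w | i w. i \<in> {1..\<nu>} \<and> w \<in> fc_mod (\<phi> i)}" "K = \<Union>\<P>"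
    using assms(7) unfolding proper_base_def by (elim conjE exE) (rule that)
  have Kcomp: "compactin M K" using image_compactin[OF K'(2) p_cont] K'(4) by simp
  have KM: "K \<subseteq> topspace M" using Kcomp compactin_subset_topspace by blast
  \<comment> \<open>\<open>p\<close> is continuous into the fine topology, so \<open>K\<close>, the
    image of the compact \<open>K'\<close>, is compact there; only finitely many plaques make up
    \<open>K\<close>.\<close>
  have Kpath: "path_connectedin M K" unfolding \<P>(2)
  proof (rule plaques_path_connectedin[OF \<phi>A \<P>(1)])
    show "compactin (fine_topology M A) (\<Union>\<P>)" using image_compactin[OF K'(2) p_fine] K'(4) \<P>(2) by simp
    show "connectedin M (\<Union>\<P>)" using connectedin_continuous_map_image[OF p_cont K'(1)] K'(4) \<P>(2) by simp
  qed
  obtain k where k: "\<forall>y\<in>p ` K'. \<exists>G. transverse_germ w k G y"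
    using transverse_projection_exists[OF K'(2,3), folded w_def] by (elim exE) (rule that)
  interpret transverse_projection M X A K k w
    by unfold_locales (use Kcomp k K'(4) mod_topspace[OF ci w] in auto)
  obtain H S0 where S0: "openin X S0" "w \<in> S0" and Hx: "\<And>b. b \<in> K \<Longrightarrow> H b w = b"
    and Hc0: "continuous_map (prod_topology (subtopology M K) (subtopology X S0)) M (\<lambda>z. H (fst z) (snd z))"
    and Hinj0: "inj_on (\<lambda>z. H (fst z) (snd z)) (K \<times> S0)"
    and Hs0: "\<And>s. s \<in> S0 \<Longrightarrow> continuous_map (subtopology M K) (fine_topology M A) (\<lambda>b. H b s)"
    by (rule big_box) (rule that)
  \<comment> \<open>The parameter set is shrunk to a clopen one inside the model of the chart at
    \<open>x\<close>: it is then compact, and the chart carries it to a clopen transversal.\<close>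
  have "openin X (S0 \<inter> fc_mod (\<phi> i))" "w \<in> S0 \<inter> fc_mod (\<phi> i)" using S0 mod_open[OF ci] w by auto
  then obtain S where S: "openin X S" "closedin X S" "w \<in> S" "S \<subseteq> S0 \<inter> fc_mod (\<phi> i)"
    by (rule totally_disconnected_clopen_nbhd[OF compX hausX tdX]) (rule that)
  have SX: "S \<subseteq> topspace X" using S(1) openin_subset by blast
  define F where "F = (\<lambda>z. H (fst z) (snd z))"
  have Fc: "continuous_map (prod_topology (subtopology M K) (subtopology X S)) M F"
  proof -
    have "continuous_map (subtopology (prod_topology M X) (K \<times> S0)) M F"
      using Hc0 by (simp add: F_def subtopology_Times)
    then have "continuous_map (subtopology (prod_topology M X) (K \<times> S)) M F"
      by (rule continuous_map_from_subtopology_mono) (use S(4) in auto)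
    then show ?thesis by (simp add: subtopology_Times)
  qed
  have Finj: "inj_on F (K \<times> S)" unfolding F_def by (rule inj_on_subset[OF Hinj0]) (use S(4) in auto)
  have Fs: "continuous_map (subtopology M K) (fine_topology M A) (\<lambda>b. F (b, s))" if "s \<in> S" for s
    using Hs0[of s] S(4) that by (auto simp: F_def)
  have Scomp: "compact_space (subtopology X S)"
    using closedin_compact_space[OF compX S(2)] by (simp add: compact_space_subtopology)
  have Kc: "compact_space (subtopology M K)" using Kcomp by (simp add: compact_space_subtopology)
  have tKS: "topspace (prod_topology (subtopology M K) (subtopology X S)) = K \<times> S" using KM SX by auto
  have Femb: "embedding_map (prod_topology (subtopology M K) (subtopology X S)) M F"
    by (rule compact_continuous_inj_embedding[OF _ hausM Fc])
      (use Scomp Kc Finj tKS in \<open>simp_all add: compact_space_prod_topology\<close>)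
  have leaves: "restricted_leaves M A (F ` (K \<times> S)) = {F ` (K \<times> {s}) | s. s \<in> S}"
    by (rule restricted_leaves_box[OF Femb KM SX Kpath _ Fs]) (use xK in auto)
  have cantorS: "cantor_space (subtopology X S)"
    by (rule cantor_space_clopen_subset[OF _ mod_open[OF ci]]) (use assms(3) ci S in auto)

  \<comment> \<open>The transversal of the chart \<open>i\<close> through \<open>x\<close>, cut down
    to \<open>S\<close>; \<open>t\<close> recovers the parameter, with \<open>t x = w\<close>.
    Composition with \<open>t\<close> lets points of \<open>V\<close> replace the abstract
    parameters in \<open>X\<close>.\<close>
  define V where "V = (\<lambda>s. chart_pt (\<phi> i) \<xi> s) ` S"
  define t where "t = tcoord (\<phi> i)"
  have Sm: "s \<in> fc_mod (\<phi> i)" if "s \<in> S" for s using S(4) that by blast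
  have tV: "t (chart_pt (\<phi> i) \<xi> s) = s" if "s \<in> S" for s using Sm[OF that] ci \<xi> by (simp add: t_def)
  have Vdom: "V \<subseteq> fc_dom (\<phi> i)" using chart_pt_dom[OF ci \<xi>] Sm by (auto simp: V_def)
  have tVS: "t ` V = S" using tV by (force simp: V_def)
  have tinj: "inj_on t V" using tV by (auto simp: V_def inj_on_def)
  have VM: "V \<subseteq> topspace M" using Vdom dom_topspace[OF ci] by blast
  have Veq: "V = {q \<in> M closure_of fc_dom (\<phi> i). fc_map (\<phi> i) q \<in> {\<xi>} \<times> S}"
  proof
    show "V \<subseteq> {q \<in> M closure_of fc_dom (\<phi> i). fc_map (\<phi> i) q \<in> {\<xi>} \<times> S}"
      using Vdom dom_subset_closure[OF ci] Sm ci \<xi> by (auto simp: V_def)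
    show "{q \<in> M closure_of fc_dom (\<phi> i). fc_map (\<phi> i) q \<in> {\<xi>} \<times> S} \<subseteq> V"
    proof
      fix q assume "q \<in> {q \<in> M closure_of fc_dom (\<phi> i). fc_map (\<phi> i) q \<in> {\<xi>} \<times> S}"
      then have q: "q \<in> fc_ext (\<phi> i)" "lcoord (\<phi> i) q = \<xi>" "tcoord (\<phi> i) q \<in> S"
        using closure_subset_ext[OF ci] by (auto simp: mem_Times_iff)
      then show "q \<in> V" unfolding V_def using chart_pt_inv[OF ci q(1)] by (intro image_eqI[of _ _ "tcoord (\<phi> i) q"]) auto
    qed
  qed
  have clopenV: "clopen_transversal M X \<nu> \<phi> V" unfolding clopen_transversal_def
  proof (intro bexI exI conjI)
    show "openin (subtopology X (fc_mod (\<phi> i))) S"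
      using S(1,4) by (metis Int_subset_iff inf.absorb2 openin_subtopology_Int2)
    show "closedin (subtopology X (fc_mod (\<phi> i))) S"
      using S(2,4) by (simp add: closedin_subset_topspace)
  qed (use Veq \<xi> i in auto)
  have xV: "x \<in> V" using S(3) x_eq by (force simp: V_def)
  have tx: "t x = w" by (simp add: t_def w_def)
  have tc: "continuous_map (subtopology M V) (subtopology X S) t"
    using continuous_map_from_subtopology_mono[OF coord_cont(2)[OF ci] Vdom] tVS
    by (auto simp: continuous_map_in_subtopology t_def)
  have Vcomp: "compact_space (subtopology M V)"
  proof -
    have "continuous_map (subtopology X S) M (\<lambda>s. chart_pt (\<phi> i) \<xi> s)"
      by (rule chart_pt_cont[OF ci]) (use \<xi> Sm in \<open>auto simp: continuous_map_from_subtopology\<close>)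
    then have "compactin M V" unfolding V_def
      by (intro image_compactin[of "subtopology X S"]) (use Scomp SX in \<open>auto simp: compactin_subtopology compact_space_subtopology compact_space_def Int_absorb1\<close>)
    then show ?thesis by (simp add: compact_space_subtopology)
  qed

  define \<Phi> where "\<Phi> = (\<lambda>z. F (fst z, t (snd z)))"
  have \<Phi>c: "continuous_map (prod_topology (subtopology M K) (subtopology M V)) M \<Phi>"
  proof -
    have "continuous_map (prod_topology (subtopology M K) (subtopology M V)) (prod_topology (subtopology M K) (subtopology X S)) (\<lambda>z. (fst z, t (snd z)))"
      unfolding continuous_map_pairwise
    proof
      let ?P = "prod_topology (subtopology M K) (subtopology M V)"
      show "continuous_map ?P (subtopology M K) (fst \<circ> (\<lambda>z. (fst z, t (snd z))))"
        using continuous_map_fst[of "subtopology M K" "subtopology M V"] by (simp add: o_def)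
      show "continuous_map ?P (subtopology X S) (snd \<circ> (\<lambda>z. (fst z, t (snd z))))"
        using continuous_map_compose[OF continuous_map_snd[of "subtopology M K"] tc] by (simp add: o_def)
    qed
    from continuous_map_compose[OF this Fc] show ?thesis by (simp add: \<Phi>_def o_def)
  qed
  have tKV: "topspace (prod_topology (subtopology M K) (subtopology M V)) = K \<times> V" using KM VM by auto
  have tS: "t v \<in> S" if "v \<in> V" for v using tVS that by blast
  have \<Phi>inj: "inj_on \<Phi> (K \<times> V)"
  proof (rule inj_onI)
    fix z z' assume z: "z \<in> K \<times> V" "z' \<in> K \<times> V" "\<Phi> z = \<Phi> z'"
    then have "(fst z, t (snd z)) = (fst z', t (snd z'))"
      by (intro inj_onD[OF Finj]) (use tS in \<open>auto simp: \<Phi>_def\<close>)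
    then show "z = z'" using z inj_onD[OF tinj, of "snd z" "snd z'"] by (auto simp: prod_eq_iff)
  qed
  have \<Phi>emb: "embedding_map (prod_topology (subtopology M K) (subtopology M V)) M \<Phi>"
    by (rule compact_continuous_inj_embedding[OF _ hausM \<Phi>c])
      (use Vcomp Kc \<Phi>inj tKV in \<open>simp_all add: compact_space_prod_topology\<close>)
  have im: "\<Phi> ` (Y \<times> {v}) = F ` (Y \<times> {t v})" for Y v by (force simp: \<Phi>_def)
  have N_eq: "\<Phi> ` (K \<times> V) = F ` (K \<times> S)"
  proof -
    have "\<Phi> ` (K \<times> V) = (\<Union>v\<in>V. \<Phi> ` (K \<times> {v}))" by blast
    also have "\<dots> = (\<Union>s\<in>t ` V. F ` (K \<times> {s}))" by (simp add: im)
    also have "\<dots> = F ` (K \<times> S)" unfolding tVS by blast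
    finally show ?thesis .
  qed
  have leavesV: "restricted_leaves M A (\<Phi> ` (K \<times> V)) = {\<Phi> ` (K \<times> {v}) | v. v \<in> V}"
    unfolding N_eq leaves im using tVS by (auto simp: image_iff)
  have fol: "foliated_on M A K V \<Phi>" unfolding foliated_on_def
  proof
    fix v assume v: "v \<in> V"
    have "connectedin (fine_topology M A) ((\<lambda>b. F (b, t v)) ` K)"
      by (rule connectedin_continuous_map_image[OF Fs[OF tS[OF v]]])
        (use path_connectedin_imp_connectedin[OF Kpath] in \<open>simp add: connectedin_subtopology\<close>)
    moreover have "(\<lambda>b. F (b, t v)) ` K = \<Phi> ` (K \<times> {v})" by (force simp: \<Phi>_def)
    ultimately have con: "connectedin (fine_topology M A) (\<Phi> ` (K \<times> {v}))" by simp
    have "\<Phi> (x, v) \<in> \<Phi> ` (K \<times> {v})" using xK by blast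
    then have "\<Phi> ` (K \<times> {v}) \<subseteq> leaf M A (\<Phi> (x, v))"
      unfolding leaf_def by (intro connected_component_of_maximal[OF con])
    moreover have "\<Phi> (x, v) \<in> topspace M"
      using connectedin_subset_topspace[OF con] \<open>\<Phi> (x, v) \<in> _\<close> by (auto simp: topspace_fine)
    ultimately show "\<exists>y\<in>topspace M. \<Phi> ` (K \<times> {v}) \<subseteq> leaf M A y" by blast
  qed
  have cont_fam: "continuous_family_of_cantor_transversals M A K V \<Phi> (\<Phi> ` (K \<times> V))"
    unfolding continuous_family_of_cantor_transversals_def
  proof (intro conjI ballI \<Phi>c)
    fix y assume y: "y \<in> K"
    have "continuous_map (subtopology M V) (prod_topology (subtopology M K) (subtopology M V)) (\<lambda>v. (y, v))"
      using y KM by (auto simp: continuous_map_pairwise o_def)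
    from continuous_map_compose[OF this \<Phi>c]
    have "continuous_map (subtopology M V) M (\<lambda>v. \<Phi> (y, v))" by (simp add: o_def)
    moreover have "inj_on (\<lambda>v. \<Phi> (y, v)) (topspace (subtopology M V))"
      using y inj_onD[OF \<Phi>inj] by (auto simp: inj_on_def)
    ultimately show "embedding_map (subtopology M V) M (\<lambda>v. \<Phi> (y, v))"
      by (intro compact_continuous_inj_embedding[OF Vcomp hausM])
    show "cantor_transversal M A (\<Phi> ` (K \<times> V)) (\<Phi> ` ({y} \<times> V))"
      unfolding cantor_transversal_def
    proof (intro conjI ballI)
      show "\<Phi> ` ({y} \<times> V) \<subseteq> \<Phi> ` (K \<times> V)" using y by blast
      \<comment> \<open>Each transversal is a homeomorphic copy of \<open>S\<close>, a clopen part
        of a Cantor model.\<close>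
      have "continuous_map (subtopology X S) (prod_topology (subtopology M K) (subtopology X S)) (\<lambda>s. (y, s))"
        using y KM by (auto simp: continuous_map_pairwise o_def)
      from continuous_map_compose[OF this Fc]
      have "continuous_map (subtopology X S) M (\<lambda>s. F (y, s))" by (simp add: o_def)
      moreover have "inj_on (\<lambda>s. F (y, s)) (topspace (subtopology X S))"
        using y inj_onD[OF Finj] by (auto simp: inj_on_def)
      ultimately have "embedding_map (subtopology X S) M (\<lambda>s. F (y, s))"
        by (intro compact_continuous_inj_embedding[OF Scomp hausM])
      then have "homeomorphic_map (subtopology X S) (subtopology M ((\<lambda>s. F (y, s)) ` S)) (\<lambda>s. F (y, s))"
        using SX by (simp add: embedding_map_def Int_absorb1)
      moreover have "(\<lambda>s. F (y, s)) ` S = \<Phi> ` ({y} \<times> V)" unfolding tVS[symmetric] by (force simp: \<Phi>_def)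
      ultimately show "cantor_space (subtopology M (\<Phi> ` ({y} \<times> V)))"
        using cantor_space_homeomorphic[OF cantorS] by metis
      fix L assume "L \<in> restricted_leaves M A (\<Phi> ` (K \<times> V))"
      then obtain v where v: "v \<in> V" "L = \<Phi> ` (K \<times> {v})" using leavesV by blast
      show "\<exists>!z. z \<in> \<Phi> ` ({y} \<times> V) \<inter> L"
      proof (rule ex1I[of _ "\<Phi> (y, v)"])
        show "\<Phi> (y, v) \<in> \<Phi> ` ({y} \<times> V) \<inter> L" using v y by blast
        fix z assume "z \<in> \<Phi> ` ({y} \<times> V) \<inter> L"
        then obtain v' b where z: "v' \<in> V" "b \<in> K" "z = \<Phi> (y, v')" "z = \<Phi> (b, v)" using v by blast
        have "(y, v') = (b, v)" by (rule inj_onD[OF \<Phi>inj]) (use z y v in auto)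
        then show "z = \<Phi> (y, v)" using z by simp
      qed
    qed
  qed
  have base: "\<forall>y\<in>K. \<Phi> (y, x) = y" using Hx tx by (simp add: \<Phi>_def F_def)
  show ?thesis
    by (intro exI[of _ V] exI[of _ \<Phi>] exI[of _ "\<Phi> ` (K \<times> V)"] conjI clopenV xV \<Phi>emb refl fol base leavesV cont_fam)
qed

end
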